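(* Let $H\in(0,1/2)$. The statistic $$\widetilde H_k^{(2)}=\frac12\left(\log_{2+}\frac{U_k^{H,2}}{U_{k+1}^{H,2}}+1\right)$$ is a strongly consistent estimator of $H$ (i.e. $\widetilde H_k^{(2)}\to H$ almost surely as $k\to\infty$); moreover, for any $\varepsilon>0$, almost surely $$\widetilde H_k^{(2)}=H+o(2^{k(-1/2+\varepsilon)}),\quad k\to\infty.$$ The estimator $\widetilde H_k^{(2)}$ is asymptotically normal: $$2^{k/2}\left(\widetilde H_k^{(2)}-H\right)\Rightarrow N(0,(\sigma''_H)^2),\quad k\to\infty$$ (convergence in distribution), with $$\sigma''_H=\frac1{(2^{2-2H}-2)\log2}\left(\rho''_{H,0}+2\sum_{m=1}^\infty\rho''_{H,m}\right)^{1/2},\qquad \rho''_{H,m}=\mathsf{E}[\theta_0\theta_m],$$ where, with $s_t^h=(B_{t+h}^H-B_t^H)^2$ and $c_H=2^{2H-1}$, $$\theta_m=s_m^1-(c_H+1)\left(s_m^{1/2}+s_{m+1/2}^{1/2}\right)+c_H\left(s_m^{1/4}+s_{m+1/4}^{1/4}+s_{m+1/2}^{1/4}+s_{m+3/4}^{1/4}\right).$$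
   Context: Mixed model: $M_t^H=aB_t^H+bW_t$, $t\in[0,T]$, where $T>0$, $a>0$, $b>0$, $W$ is a standard Wiener process and $B^H=\{B^H_t,t\ge0\}$ is a fractional Brownian motion with Hurst parameter $H$ (centered Gaussian, $\mathsf{E}[B^H_tB^H_s]=\frac12(t^{2H}+s^{2H}-|t-s|^{2H})$), independent of $W$. For $n\ge1$, $\Delta_i^nX=X_{T(i+1)/n}-X_{Ti/n}$, $i=0,\dots,n-1$; $V_n^{H,2}=\sum_{i=0}^{n-1}(\Delta_i^nM^H)^2$; $U_k^{H,2}=V_{2^k}^{H,2}-V_{2^{k+1}}^{H,2}$. Finally $\log_{2+}x=\log_2x$ for $x>0$ and $\log_{2+}x=0$ for $x\le0$; $\log$ is the natural logarithm. *)

theory Defs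
  imports "HOL-Probability.Probability" "HOL-Library.Landau_Symbols"
begin

text \<open>The law \<open>N(\<mu>, \<sigma>\<^sup>2)\<close>, written as an image measure because \<^term>\<open>normal_density \<mu> \<sigma>\<close>
  is identically zero when \<open>\<sigma> = 0\<close>, whereas Gaussian vectors may be degenerate;
  here \<open>\<sigma> = 0\<close> yields the point mass at \<open>\<mu>\<close>.\<close>

definition normal_law :: "real \<Rightarrow> real \<Rightarrow> real measure" where
  "normal_law \<mu> \<sigma> = distr std_normal_distribution borel (\<lambda>x. \<mu> + \<sigma> * x)"

definition (in prob_space) gaussian_process :: "'i set \<Rightarrow> ('i \<Rightarrow> 'a \<Rightarrow> real) \<Rightarrow> bool" where
  "gaussian_process I X \<longleftrightarrow>
     (\<forall>t\<in>I. random_variable borel (X t)) \<and>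
     (\<forall>J c. finite J \<and> J \<subseteq> I \<longrightarrow>
        (\<exists>\<mu> \<sigma>. distr M borel (\<lambda>\<omega>. \<Sum>t\<in>J. c t * X t \<omega>) = normal_law \<mu> \<sigma>))"

definition (in prob_space) fractional_brownian_motion :: "real \<Rightarrow> (real \<Rightarrow> 'a \<Rightarrow> real) \<Rightarrow> bool" where
  "fractional_brownian_motion H B \<longleftrightarrow>
     0 < H \<and> H < 1 \<and>
     gaussian_process {0..} B \<and>
     (\<forall>t\<ge>0. expectation (B t) = 0) \<and>
     (\<forall>s\<ge>0. \<forall>t\<ge>0. expectation (\<lambda>\<omega>. B t \<omega> * B s \<omega>) =
        1 / 2 * (t powr (2 * H) + s powr (2 * H) - \<bar>t - s\<bar> powr (2 * H)))"

definition (in prob_space) wiener_process :: "(real \<Rightarrow> 'a \<Rightarrow> real) \<Rightarrow> bool" where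
  "wiener_process W \<longleftrightarrow>
     (\<forall>t\<ge>0. random_variable borel (W t)) \<and>
     (AE \<omega> in M. W 0 \<omega> = 0) \<and>
     (\<forall>s t. 0 \<le> s \<and> s < t \<longrightarrow>
        distributed M lborel (\<lambda>\<omega>. W t \<omega> - W s \<omega>) (normal_density 0 (sqrt (t - s)))) \<and>
     (\<forall>(n::nat) \<tau>. 0 \<le> \<tau> 0 \<and> mono \<tau> \<longrightarrow>
        indep_vars (\<lambda>_. borel) (\<lambda>i \<omega>. W (\<tau> (Suc i)) \<omega> - W (\<tau> i) \<omega>) {..<n}) \<and>
     (AE \<omega> in M. continuous_on {0..} (\<lambda>t. W t \<omega>))"

text \<open>Independence of two whole processes, i.e. of the product-measurable random elements
  \<open>(X\<^sub>t)\<close> and \<open>(Y\<^sub>t)\<close>, \<open>t \<in> I\<close>.\<close>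

definition (in prob_space) indep_processes ::
  "'i set \<Rightarrow> ('i \<Rightarrow> 'a \<Rightarrow> real) \<Rightarrow> ('i \<Rightarrow> 'a \<Rightarrow> real) \<Rightarrow> bool" where
  "indep_processes I X Y \<longleftrightarrow>
     indep_var (Pi\<^sub>M I (\<lambda>_. borel)) (\<lambda>\<omega>. \<lambda>t\<in>I. X t \<omega>)
               (Pi\<^sub>M I (\<lambda>_. borel)) (\<lambda>\<omega>. \<lambda>t\<in>I. Y t \<omega>)"

definition mixed_model ::
  "real \<Rightarrow> real \<Rightarrow> (real \<Rightarrow> 'a \<Rightarrow> real) \<Rightarrow> (real \<Rightarrow> 'a \<Rightarrow> real) \<Rightarrow> real \<Rightarrow> 'a \<Rightarrow> real" where
  "mixed_model a b B W t \<omega> = a * B t \<omega> + b * W t \<omega>"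

definition increment :: "real \<Rightarrow> (real \<Rightarrow> 'a \<Rightarrow> real) \<Rightarrow> nat \<Rightarrow> nat \<Rightarrow> 'a \<Rightarrow> real" where
  "increment T X n i \<omega> = X (T * real (i + 1) / real n) \<omega> - X (T * real i / real n) \<omega>"

definition quad_var :: "real \<Rightarrow> (real \<Rightarrow> 'a \<Rightarrow> real) \<Rightarrow> nat \<Rightarrow> 'a \<Rightarrow> real" where
  "quad_var T X n \<omega> = (\<Sum>i<n. (increment T X n i \<omega>)\<^sup>2)"

definition quad_var_diff :: "real \<Rightarrow> (real \<Rightarrow> 'a \<Rightarrow> real) \<Rightarrow> nat \<Rightarrow> 'a \<Rightarrow> real" where
  "quad_var_diff T X k \<omega> = quad_var T X (2 ^ k) \<omega> - quad_var T X (2 ^ (k + 1)) \<omega>"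

definition log2_plus :: "real \<Rightarrow> real" where
  "log2_plus x = (if x > 0 then log 2 x else 0)"

definition hurst_estimator :: "real \<Rightarrow> (real \<Rightarrow> 'a \<Rightarrow> real) \<Rightarrow> nat \<Rightarrow> 'a \<Rightarrow> real" where
  "hurst_estimator T X k \<omega> =
     1 / 2 * (log2_plus (quad_var_diff T X k \<omega> / quad_var_diff T X (k + 1) \<omega>) + 1)"

definition sq_increment :: "(real \<Rightarrow> 'a \<Rightarrow> real) \<Rightarrow> real \<Rightarrow> real \<Rightarrow> 'a \<Rightarrow> real" where
  "sq_increment B h t \<omega> = (B (t + h) \<omega> - B t \<omega>)\<^sup>2"

definition c_coeff :: "real \<Rightarrow> real" where
  "c_coeff H = 2 powr (2 * H - 1)"

definition theta :: "real \<Rightarrow> (real \<Rightarrow> 'a \<Rightarrow> real) \<Rightarrow> nat \<Rightarrow> 'a \<Rightarrow> real" where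
  "theta H B m \<omega> =
     sq_increment B 1 (real m) \<omega>
     - (c_coeff H + 1) *
         (sq_increment B (1/2) (real m) \<omega> + sq_increment B (1/2) (real m + 1/2) \<omega>)
     + c_coeff H *
         (sq_increment B (1/4) (real m) \<omega> + sq_increment B (1/4) (real m + 1/4) \<omega>
          + sq_increment B (1/4) (real m + 1/2) \<omega> + sq_increment B (1/4) (real m + 3/4) \<omega>)"

definition (in prob_space) rho :: "real \<Rightarrow> (real \<Rightarrow> 'a \<Rightarrow> real) \<Rightarrow> nat \<Rightarrow> real" where
  "rho H B m = expectation (\<lambda>\<omega>. theta H B 0 \<omega> * theta H B m \<omega>)"

definition (in prob_space) long_run_variance :: "real \<Rightarrow> (real \<Rightarrow> 'a \<Rightarrow> real) \<Rightarrow> real" where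
  "long_run_variance H B = rho H B 0 + 2 * (\<Sum>m. rho H B (Suc m))"

definition (in prob_space) sigma :: "real \<Rightarrow> (real \<Rightarrow> 'a \<Rightarrow> real) \<Rightarrow> real" where
  "sigma H B = 1 / ((2 powr (2 - 2 * H) - 2) * ln 2) * sqrt (long_run_variance H B)"

end

theory Submission
  imports Defs
begin

text \<open>
  Up to normalisation the difference of the quadratic variations at levels \<open>k\<close> and \<open>k + 1\<close> is
  \<open>\<kappa>\<^sup>k (- L + h\<^sub>k)\<close> with \<open>\<kappa> = 2 powr (1 - 2 H) > 1\<close>, so the estimation error is
  \<open>ln (1 + y\<^sub>k) / (2 ln 2)\<close> with \<open>y\<^sub>k = (h\<^sub>k - h\<^sub>k\<^sub>+\<^sub>1) / (- L + h\<^sub>k\<^sub>+\<^sub>1)\<close>. The second moments of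
  \<open>h\<^sub>k\<close> decay geometrically, which gives the almost sure statements. Since \<open>H < 1/2\<close>, the
  terms involving \<open>W\<close> are negligible at the scale \<open>2 powr (- k / 2)\<close>, and the fBm part of
  \<open>h\<^sub>k - h\<^sub>k\<^sub>+\<^sub>1\<close> is exactly a normalised sum of the \<open>\<theta>\<^sub>m\<close> of the fBm rescaled to unit mesh.

  That sum is a centred quadratic form \<open>q\<close> in a Gaussian vector. By Stein's identity its
  characteristic function satisfies \<open>\<phi>' (s) = - 2 s E [G iexp (s q)]\<close> for another quadratic form \<open>G\<close>
  with mean \<open>Var q / 2\<close>, so \<open>\<phi>\<close> is close to \<open>exp (- s\<^sup>2 Var q / 2)\<close> as soon as \<open>Var G\<close> is small.
  The latter holds because fractional noise with \<open>H < 1/2\<close> is negatively correlated, hence has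
  absolutely summable covariances by telescoping.
\<close>

section \<open>Gaussian spaces\<close>

text \<open>At each level \<open>k\<close> the fBm rescaled to unit mesh is a different process on
  the same space, so there is no single stationary sequence to which a limit theorem could be
  applied. The Gaussian approximation is therefore an explicit bound in the number of summands that
  depends on the process only through covariance estimates common to all levels. The increments
  inside one \<open>theta\<close> are linearly dependent, since long ones are sums of short ones.
  Their joint law has no density to integrate by parts against, so Stein's identity is derived by
  rotating the vector together with an independent copy. Invariance of the joint law under this
  rotation is checked on characteristic functions of linear combinations. The smallness of
  \<open>Var G\<close> comes from its Wick expansion: it is a sum over 4-cycles of covariances, of
  order \<open>1 / n\<close> for \<open>n\<close> summands with weights of order
  \<open>1 / sqrt n\<close>. The variation of \<open>W\<close> also has relative fluctuations of
  order \<open>2 powr (- k / 2)\<close>. Its deterministic part is the same at all levels and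
  cancels in the differences; its fluctuation is divided by \<open>\<kappa> ^ k\<close>.\<close>

lemma real_distribution_normal_law: "real_distribution (normal_law \<mu> \<sigma>)"
proof -
  interpret real_distribution std_normal_distribution by (rule real_dist_normal_dist)
  show ?thesis unfolding normal_law_def by (rule real_distribution_distr) simp
qed

lemma char_normal_law_0: "char (normal_law 0 \<sigma>) t = exp (- (\<sigma>\<^sup>2 * t\<^sup>2 / 2))"
proof -
  have "char (normal_law 0 \<sigma>) t = char std_normal_distribution (\<sigma> * t)"
    unfolding normal_law_def char_def by (subst integral_distr) (auto simp: ac_simps)
  then show ?thesis by (simp add: char_std_normal_distribution power_mult_distrib)
qed

lemma integral_normal_law_power:
  "integral\<^sup>L (normal_law 0 \<sigma>) (\<lambda>x. x ^ n) = \<sigma> ^ n * integral\<^sup>L std_normal_distribution (\<lambda>x. x ^ n)"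
  unfolding normal_law_def by (subst integral_distr) (auto simp: power_mult_distrib)

lemma integrable_normal_law_power: "integrable (normal_law \<mu> \<sigma>) (\<lambda>x. x ^ n)"
proof -
  have "integrable std_normal_distribution (\<lambda>x. (\<mu> + \<sigma> * x) ^ n)"
    unfolding binomial_ring
    by (intro Bochner_Integration.integrable_sum)
       (simp add: power_mult_distrib mult.assoc integrable_std_normal_distribution_moment
          del: integrable_density)
  then show ?thesis
    unfolding normal_law_def by (subst integrable_distr_eq) auto
qed

lemma integral_normal_law_id: "integral\<^sup>L (normal_law \<mu> \<sigma>) (\<lambda>x. x) = \<mu>"
proof -
  interpret S: real_distribution std_normal_distribution by (rule real_dist_normal_dist)
  have i: "integrable std_normal_distribution (\<lambda>x. x)" "integral\<^sup>L std_normal_distribution (\<lambda>x. x) = 0"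
    using integrable_std_normal_distribution_moment[of 1]
      integral_std_normal_distribution_moment_odd[of 1] by auto
  have "integral\<^sup>L (normal_law \<mu> \<sigma>) (\<lambda>x. x) = integral\<^sup>L std_normal_distribution (\<lambda>x. \<mu> + \<sigma> * x)"
    unfolding normal_law_def by (subst integral_distr) auto
  also have "\<dots> = \<mu>"
    using i by (subst Bochner_Integration.integral_add) (auto simp: S.prob_space[simplified])
  finally show ?thesis .
qed

text \<open>Weighting the signs of \<open>b\<close>, \<open>c\<close>, \<open>d\<close> by their
  product kills every monomial that is even in one of the three. In degree 4 only
  \<open>a * b * c * d\<close> is left, with coefficient 4! = 24 in each of the 8 powers, and 8 * 24
  = 192.\<close>

lemma polarization4:
  fixes a b c d :: real
  shows "a * b * c * d =
    ((a+b+c+d)^4 - (a+b+c-d)^4 - (a+b-c+d)^4 + (a+b-c-d)^4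
      - (a-b+c+d)^4 + (a-b+c-d)^4 + (a-b-c+d)^4 - (a-b-c-d)^4) / 192"
  by (simp add: field_simps, algebra)

text \<open>Joint normality is encoded as closure under linear combinations, in the spirit of the
  Cramer-Wold criterion. Laws are given through \<open>normal_law\<close>, so degenerate vectors are
  included and no covariance matrix has to be inverted.\<close>

locale gaussian_space = prob_space M for M :: "'a measure" +
  fixes S :: "('a \<Rightarrow> real) set"
  assumes zero_mem: "(\<lambda>x. 0) \<in> S"
    and add_mem: "X \<in> S \<Longrightarrow> Y \<in> S \<Longrightarrow> (\<lambda>x. X x + Y x) \<in> S"
    and scale_mem: "X \<in> S \<Longrightarrow> (\<lambda>x. c * X x) \<in> S"
    and rv: "X \<in> S \<Longrightarrow> random_variable borel X"
    and normal: "X \<in> S \<Longrightarrow> \<exists>\<sigma>. distr M borel X = normal_law 0 \<sigma>"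
begin

lemma diff_mem: "X \<in> S \<Longrightarrow> Y \<in> S \<Longrightarrow> (\<lambda>x. X x - Y x) \<in> S"
  using add_mem[of X "\<lambda>x. (-1) * Y x"] scale_mem[of Y "-1"] by simp

lemma sum_mem: "(\<And>i. i \<in> I \<Longrightarrow> Y i \<in> S) \<Longrightarrow> (\<lambda>z. \<Sum>i\<in>I. Y i z) \<in> S"
proof (induction I rule: infinite_finite_induct)
  case (insert x F)
  then show ?case using add_mem[of "Y x" "\<lambda>z. \<Sum>i\<in>F. Y i z"] by simp
qed (auto simp: zero_mem)

lemma integrable_power: "X \<in> S \<Longrightarrow> integrable M (\<lambda>z. X z ^ n)"
proof -
  assume X: "X \<in> S"
  obtain \<sigma> where s: "distr M borel X = normal_law 0 \<sigma>" using normal[OF X] by blast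
  have "integrable (distr M borel X) (\<lambda>x. x ^ n)"
    unfolding s by (rule integrable_normal_law_power)
  then show ?thesis using rv[OF X] by (subst (asm) integrable_distr_eq) auto
qed

lemma expectation_power:
  assumes "X \<in> S" "distr M borel X = normal_law 0 \<sigma>"
  shows "expectation (\<lambda>z. X z ^ n) = \<sigma> ^ n * integral\<^sup>L std_normal_distribution (\<lambda>x. x ^ n)"
  unfolding integral_normal_law_power[symmetric] assms(2)[symmetric]
  using rv[OF assms(1)] by (subst integral_distr) auto

text \<open>The \<sigma> provided by \<open>normal\<close> has no prescribed sign, but the
  characteristic function only sees \<open>\<sigma>\<^sup>2\<close>, which is the second moment.
  Uniqueness then allows passing to the nonnegative root.\<close>

lemma law_mem:
  assumes "X \<in> S"
  shows "distr M borel X = normal_law 0 (sqrt (expectation (\<lambda>x. (X x)\<^sup>2)))"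
proof -
  obtain \<sigma> where s: "distr M borel X = normal_law 0 \<sigma>" using normal[OF assms] by blast
  have "expectation (\<lambda>x. (X x)\<^sup>2) = \<sigma>\<^sup>2"
    using expectation_power[OF assms s, of 2] std_normal_distribution_even_moments(1)[of 1] by simp
  then have "char (normal_law 0 \<sigma>) = char (normal_law 0 (sqrt (expectation (\<lambda>x. (X x)\<^sup>2))))"
    by (intro ext) (simp add: char_normal_law_0)
  then show ?thesis
    unfolding s by (intro Levy_uniqueness real_distribution_normal_law)
qed

lemma expectation_power4:
  assumes "X \<in> S"
  shows "expectation (\<lambda>x. (X x)^4) = 3 * (expectation (\<lambda>x. (X x)\<^sup>2))\<^sup>2"
proof -
  obtain \<sigma> where s: "distr M borel X = normal_law 0 \<sigma>" using normal[OF assms] by blast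
  have "expectation (\<lambda>x. (X x)\<^sup>2) = \<sigma>\<^sup>2"
    using expectation_power[OF assms s, of 2] std_normal_distribution_even_moments(1)[of 1] by simp
  moreover have "expectation (\<lambda>x. (X x)^4) = 3 * \<sigma>^4"
    using expectation_power[OF assms s, of 4] std_normal_distribution_even_moments(1)[of 2]
    by (simp add: fact_numeral)
  ultimately show ?thesis by (simp flip: power_mult)
qed

lemma expectation_iexp:
  assumes "X \<in> S"
  shows "expectation (\<lambda>x. iexp (X x)) = exp (- (expectation (\<lambda>x. (X x)\<^sup>2) / 2))"
proof -
  have "0 \<le> expectation (\<lambda>x. (X x)\<^sup>2)" by simp
  moreover have "expectation (\<lambda>x. iexp (X x)) = char (distr M borel X) 1"
    unfolding char_def using rv[OF assms] by (subst integral_distr) auto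
  ultimately show ?thesis unfolding law_mem[OF assms] char_normal_law_0 by simp
qed

lemma integrable_mult:
  assumes "X \<in> S" "Y \<in> S"
  shows "integrable M (\<lambda>x. X x * Y x)"
proof -
  have "(\<lambda>x. X x * Y x) = (\<lambda>x. ((X x + Y x)^2 - (X x - Y x)^2) / 4)"
    by (auto simp: power2_eq_square algebra_simps)
  moreover have "integrable M \<dots>"
    using integrable_power[OF add_mem[OF assms]] integrable_power[OF diff_mem[OF assms]] by simp
  ultimately show ?thesis by simp
qed

text \<open>Isserlis' formula. Polarization reduces it to fourth powers of members of the space,
  whose expectation is three times the squared second moment; what remains is a polynomial identity
  between covariances.\<close>

lemma wick4:
  assumes "X \<in> S" "Y \<in> S" "Z \<in> S" "U \<in> S"
  shows "integrable M (\<lambda>x. X x * Y x * Z x * U x)"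
    and "expectation (\<lambda>x. X x * Y x * Z x * U x) =
      expectation (\<lambda>x. X x * Y x) * expectation (\<lambda>x. Z x * U x)
      + expectation (\<lambda>x. X x * Z x) * expectation (\<lambda>x. Y x * U x)
      + expectation (\<lambda>x. X x * U x) * expectation (\<lambda>x. Y x * Z x)"
proof -
  define f where "f b c d x = X x + b * Y x + c * Z x + d * U x" for b c d x
  have f: "f b c d \<in> S" for b c d
    unfolding f_def by (intro add_mem scale_mem assms)
  have i4: "integrable M (\<lambda>x. f b c d x ^ 4)" for b c d by (rule integrable_power[OF f])
  have eq: "X x * Y x * Z x * U x = (f 1 1 1 x ^ 4 - f 1 1 (-1) x ^ 4 - f 1 (-1) 1 x ^ 4 + f 1 (-1) (-1) x ^ 4
     - f (-1) 1 1 x ^ 4 + f (-1) 1 (-1) x ^ 4 + f (-1) (-1) 1 x ^ 4 - f (-1) (-1) (-1) x ^ 4) / 192" for x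
    unfolding f_def by (subst polarization4) simp
  show "integrable M (\<lambda>x. X x * Y x * Z x * U x)"
    unfolding eq by (intro integrable_divide_zero Bochner_Integration.integrable_diff
        Bochner_Integration.integrable_add i4)
  define r where "r A B = expectation (\<lambda>x. A x * B x)" for A B :: "'a \<Rightarrow> real"
  have i: "integrable M (\<lambda>x. A x * B x)" if "A \<in> {X,Y,Z,U}" "B \<in> {X,Y,Z,U}" for A B
    using that assms by (intro integrable_mult) auto
  have e2: "expectation (\<lambda>x. (f b c d x)\<^sup>2) = r X X + b\<^sup>2 * r Y Y + c\<^sup>2 * r Z Z + d\<^sup>2 * r U U
     + 2 * (b * r X Y + c * r X Z + d * r X U + b * c * r Y Z + b * d * r Y U + c * d * r Z U)" for b c d
  proof -
    have "(\<lambda>x. (f b c d x)\<^sup>2) = (\<lambda>x. X x * X x + b\<^sup>2 * (Y x * Y x) + c\<^sup>2 * (Z x * Z x) + d\<^sup>2 * (U x * U x)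
       + 2 * (b * (X x * Y x) + c * (X x * Z x) + d * (X x * U x) + b * c * (Y x * Z x)
         + b * d * (Y x * U x) + c * d * (Z x * U x)))"
      unfolding f_def by (intro ext) algebra
    then show ?thesis unfolding r_def using i by simp
  qed
  have "expectation (\<lambda>x. X x * Y x * Z x * U x) =
    (3 * (expectation (\<lambda>x. (f 1 1 1 x)\<^sup>2))\<^sup>2 - 3 * (expectation (\<lambda>x. (f 1 1 (-1) x)\<^sup>2))\<^sup>2
     - 3 * (expectation (\<lambda>x. (f 1 (-1) 1 x)\<^sup>2))\<^sup>2 + 3 * (expectation (\<lambda>x. (f 1 (-1) (-1) x)\<^sup>2))\<^sup>2
     - 3 * (expectation (\<lambda>x. (f (-1) 1 1 x)\<^sup>2))\<^sup>2 + 3 * (expectation (\<lambda>x. (f (-1) 1 (-1) x)\<^sup>2))\<^sup>2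
     + 3 * (expectation (\<lambda>x. (f (-1) (-1) 1 x)\<^sup>2))\<^sup>2 - 3 * (expectation (\<lambda>x. (f (-1) (-1) (-1) x)\<^sup>2))\<^sup>2) / 192"
    unfolding eq using i4 by (simp add: expectation_power4[OF f])
  also have "\<dots> = r X Y * r Z U + r X Z * r Y U + r X U * r Y Z"
    unfolding e2 by (simp add: field_simps, algebra)
  finally show "expectation (\<lambda>x. X x * Y x * Z x * U x) =
      expectation (\<lambda>x. X x * Y x) * expectation (\<lambda>x. Z x * U x)
      + expectation (\<lambda>x. X x * Z x) * expectation (\<lambda>x. Y x * U x)
      + expectation (\<lambda>x. X x * U x) * expectation (\<lambda>x. Y x * Z x)"
    unfolding r_def .
qed

end

section \<open>Characteristic functions determine finite-dimensional laws\<close>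

text \<open>Levy's uniqueness theorem concerns probability measures, whereas the tilted measures to
  which this lemma is applied have arbitrary total mass. Hence the normalisation by
  \<open>c\<close>, with mass zero treated apart.\<close>

lemma distr_eq_of_char_eq:
  fixes f :: "'a \<Rightarrow> real" and g :: "'b \<Rightarrow> real"
  assumes "finite_measure M" "finite_measure N"
    and f[measurable]: "f \<in> borel_measurable M" and g[measurable]: "g \<in> borel_measurable N"
    and eq: "\<And>v. (CLINT x|M. iexp (v * f x)) = (CLINT x|N. iexp (v * g x))"
  shows "distr M borel f = distr N borel g"
proof -
  interpret M: finite_measure M by fact
  interpret N: finite_measure N by fact
  define c where "c = measure M (space M)"
  \<comment> \<open>Frequency 0 compares the total masses.\<close>
  have cN: "c = measure N (space N)" using eq[of 0] by (simp add: c_def)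
  show ?thesis
  proof (cases "c = 0")
    case True
    then have "emeasure M (space M) = 0" "emeasure N (space N) = 0"
      using cN by (auto simp: c_def M.emeasure_eq_measure N.emeasure_eq_measure)
    then have "emeasure M B = 0" "emeasure N C = 0" for B C
      using emeasure_space[of M B] emeasure_space[of N C] by auto
    then show ?thesis by (intro measure_eqI) (auto simp: emeasure_distr)
  next
    case False
    then have c: "c > 0" by (simp add: c_def zero_less_measure_iff)
    have rd: "real_distribution (density (distr K borel h) (\<lambda>_. ennreal (1 / c)))"
      if "finite_measure K" and [measurable]: "h \<in> borel_measurable K" and "c = measure K (space K)"
      for K :: "'c measure" and h :: "'c \<Rightarrow> real"
    proof -
      interpret K: finite_measure K by fact
      have "emeasure (density (distr K borel h) (\<lambda>_. ennreal (1 / c))) UNIV = 1"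
        using c that by (simp add: emeasure_density nn_integral_cmult emeasure_distr
            K.emeasure_eq_measure ennreal_mult[symmetric])
      then show ?thesis
        by (simp add: real_distribution_def real_distribution_axioms_def prob_space_def
            prob_space_axioms_def finite_measureI)
    qed
    have ch: "char (density (distr K borel h) (\<lambda>_. ennreal (1 / c))) v
        = (1 / c) *\<^sub>R (CLINT x|K. iexp (v * h x))"
      if [measurable]: "h \<in> borel_measurable K" for K :: "'c measure" and h :: "'c \<Rightarrow> real" and v
      unfolding char_def using c
      by (subst integral_density) (auto simp: integral_distr)
    have "density (distr M borel f) (\<lambda>_. ennreal (1 / c)) = density (distr N borel g) (\<lambda>_. ennreal (1 / c))"
    proof (intro Levy_uniqueness rd ext)
      show "char (density (distr M borel f) (\<lambda>_. ennreal (1 / c))) x =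
        char (density (distr N borel g) (\<lambda>_. ennreal (1 / c))) x" for x
        by (simp only: ch[OF f] ch[OF g] eq)
    qed (use assms(1,2) cN c_def in auto)
    then have "density (density (distr M borel f) (\<lambda>_. ennreal (1 / c))) (\<lambda>_. ennreal c)
        = density (density (distr N borel g) (\<lambda>_. ennreal (1 / c))) (\<lambda>_. ennreal c)"
      by simp
    then show ?thesis
      using c by (simp add: density_density_eq ennreal_mult[symmetric] density_1)
  qed
qed

text \<open>Kac's argument: a factor \<open>iexp\<close> of one group of coordinates is written through the
  nonnegative weights \<open>1 + cos\<close>, which reduces everything to one-dimensional uniqueness.\<close>

lemma measure_box_eq_of_char_eq:
  fixes f :: "'i \<Rightarrow> 'a \<Rightarrow> real" and g :: "'i \<Rightarrow> 'b \<Rightarrow> real"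
  assumes "finite I" "finite_measure M" "finite_measure N"
    and "\<And>i. i \<in> I \<Longrightarrow> f i \<in> borel_measurable M" "\<And>i. i \<in> I \<Longrightarrow> g i \<in> borel_measurable N"
    and "\<And>u. (CLINT x|M. iexp (\<Sum>i\<in>I. u i * f i x)) = (CLINT x|N. iexp (\<Sum>i\<in>I. u i * g i x))"
    and "\<And>i. i \<in> I \<Longrightarrow> A i \<in> sets borel"
  shows "measure M {x\<in>space M. \<forall>i\<in>I. f i x \<in> A i} = measure N {x\<in>space N. \<forall>i\<in>I. g i x \<in> A i}"
  using assms
proof (induction I arbitrary: M N rule: finite_induct)
  case empty
  from empty(5)[of "\<lambda>_. 0"] show ?case by simp
next
  case (insert k I)
  interpret M: finite_measure M by fact
  interpret N: finite_measure N by fact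
  have [measurable]: "f i \<in> borel_measurable M" "g i \<in> borel_measurable N" if "i \<in> I" for i
    using insert.prems that by auto
  have [measurable]: "f k \<in> borel_measurable M" "g k \<in> borel_measurable N" "A k \<in> sets borel"
    using insert.prems by auto
  \<comment> \<open>The weight is a nonnegative function of the coordinates in \<open>I\<close>, so
    one-dimensional uniqueness for coordinate \<open>k\<close> applies under it. Expanding the
    cosine, the transforms of the tilted measures only involve the frequency vectors
    \<open>0\<close>, \<open>u\<close> and \<open>- u\<close> on \<open>I\<close>, which the
    hypothesis covers.\<close>
  have tilt: "(LINT x|M. (1 + cos ((\<Sum>i\<in>I. u i * f i x) - \<theta>)) * indicator (A k) (f k x)) =
      (LINT x|N. (1 + cos ((\<Sum>i\<in>I. u i * g i x) - \<theta>)) * indicator (A k) (g k x))" for u \<theta>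
  proof -
    define p where "p x = (\<Sum>i\<in>I. u i * f i x)" for x
    define q where "q x = (\<Sum>i\<in>I. u i * g i x)" for x
    have [measurable]: "p \<in> borel_measurable M" "q \<in> borel_measurable N"
      unfolding p_def q_def by measurable
    define D where "D = density M (\<lambda>x. ennreal (1 + cos (p x - \<theta>)))"
    define E where "E = density N (\<lambda>x. ennreal (1 + cos (q x - \<theta>)))"
    have nn: "0 \<le> 1 + cos t" for t :: real using cos_ge_minus_one[of t] by linarith
    have fin: "finite_measure (density K (\<lambda>x. ennreal (1 + cos (h x - \<theta>))))"
      if "finite_measure K" and [measurable]: "h \<in> borel_measurable K"
      for K :: "'c measure" and h
    proof
      interpret K: finite_measure K by fact
      have "emeasure (density K (\<lambda>x. ennreal (1 + cos (h x - \<theta>)))) (space K)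
        \<le> (\<integral>\<^sup>+x. ennreal 2 \<partial>K)"
        by (subst emeasure_density, simp, simp)
          (intro nn_integral_mono, simp add: indicator_def ennreal_leI flip: ennreal_numeral)
      also have "\<dots> < \<infinity>" by (simp add: K.emeasure_eq_measure ennreal_mult_less_top)
      finally show "emeasure (density K (\<lambda>x. ennreal (1 + cos (h x - \<theta>))))
         (space (density K (\<lambda>x. ennreal (1 + cos (h x - \<theta>))))) \<noteq> \<infinity>" by simp
    qed
    have expand: "(CLINT x|density K (\<lambda>x. ennreal (1 + cos (h x - \<theta>))). iexp (v * l x))
       = (CLINT x|K. iexp (v * l x)) + iexp (-\<theta>) / 2 * (CLINT x|K. iexp (h x + v * l x))
         + iexp \<theta> / 2 * (CLINT x|K. iexp (- h x + v * l x))"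
      if "finite_measure K" and [measurable]: "h \<in> borel_measurable K" "l \<in> borel_measurable K"
      for K :: "'c measure" and h l v
    proof -
      interpret K: finite_measure K by fact
      have int: "integrable K (\<lambda>x. iexp (s x))" if [measurable]: "s \<in> borel_measurable K" for s
        by (rule K.integrable_const_bound[where B=1]) auto
      have cosE: "complex_of_real (cos t) = (iexp t + iexp (-t)) / 2" for t
        by (simp add: cos_of_real[symmetric] cos_exp_eq)
      have "(CLINT x|density K (\<lambda>x. ennreal (1 + cos (h x - \<theta>))). iexp (v * l x))
         = (CLINT x|K. (1 + cos (h x - \<theta>)) *\<^sub>R iexp (v * l x))"
        by (subst integral_density) (auto simp: nn)
      also have "\<dots> = (CLINT x|K. iexp (v * l x) + iexp (-\<theta>) / 2 * iexp (h x + v * l x)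
         + iexp \<theta> / 2 * iexp (- h x + v * l x))"
      proof (rule Bochner_Integration.integral_cong[OF refl])
        fix x
        have 1: "iexp (h x + v * l x) = iexp (h x) * iexp (v * l x)"
          "iexp (- h x + v * l x) = iexp (- h x) * iexp (v * l x)"
          "iexp (h x - \<theta>) = iexp (h x) * iexp (-\<theta>)" "iexp (-(h x - \<theta>)) = iexp (- h x) * iexp \<theta>"
          by (simp_all add: exp_add[symmetric] algebra_simps)
        show "(1 + cos (h x - \<theta>)) *\<^sub>R iexp (v * l x) = iexp (v * l x)
           + iexp (-\<theta>) / 2 * iexp (h x + v * l x) + iexp \<theta> / 2 * iexp (- h x + v * l x)"
          unfolding 1(1,2) unfolding scaleR_conv_of_real of_real_add[of 1] cosE 1(3,4) by (simp add: field_simps)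
      qed
      also have "\<dots> = (CLINT x|K. iexp (v * l x)) + iexp (-\<theta>) / 2 * (CLINT x|K. iexp (h x + v * l x))
         + iexp \<theta> / 2 * (CLINT x|K. iexp (- h x + v * l x))"
        by (subst Bochner_Integration.integral_add Bochner_Integration.integral_mult_right_zero;
            (intro Bochner_Integration.integrable_add integrable_mult_right int)?; measurable?)+
      finally show ?thesis .
    qed
    have hyp: "(CLINT x|M. iexp (s * p x + v * f k x)) = (CLINT x|N. iexp (s * q x + v * g k x))" for s v
    proof -
      have *: "(\<Sum>i\<in>insert k I. ((\<lambda>i. s * u i)(k := v)) i * h i) = s * (\<Sum>i\<in>I. u i * h i) + v * h k"
        for h :: "'i \<Rightarrow> real"
      proof -
        have "(\<Sum>i\<in>I. ((\<lambda>i. s * u i)(k := v)) i * h i) = (\<Sum>i\<in>I. s * (u i * h i))"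
          using insert.hyps by (intro sum.cong) auto
        then show ?thesis using insert.hyps by (simp add: sum_distrib_left)
      qed
      show ?thesis
        using insert.prems(5)[of "(\<lambda>i. s * u i)(k := v)"] unfolding * p_def q_def .
    qed
    have "distr D borel (f k) = distr E borel (g k)"
      unfolding D_def E_def
    proof (rule distr_eq_of_char_eq)
      show "(CLINT x|density M (\<lambda>x. ennreal (1 + cos (p x - \<theta>))). iexp (v * f k x)) =
        (CLINT x|density N (\<lambda>x. ennreal (1 + cos (q x - \<theta>))). iexp (v * g k x))" for v
        unfolding expand[OF \<open>finite_measure M\<close> \<open>p \<in> _\<close> \<open>f k \<in> _\<close>]
          expand[OF \<open>finite_measure N\<close> \<open>q \<in> _\<close> \<open>g k \<in> _\<close>]
        using hyp[of 0 v] hyp[of 1 v] hyp[of "-1" v] by simp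
    qed (auto intro!: fin insert.prems)
    then have "(LINT y|distr D borel (f k). indicator (A k) y :: real) = (LINT y|distr E borel (g k). indicator (A k) y)"
      by simp
    then have "(LINT x|D. indicator (A k) (f k x) :: real) = (LINT x|E. indicator (A k) (g k x))"
      unfolding D_def E_def by (subst (asm) (1 2) integral_distr) auto
    then show ?thesis
      unfolding D_def E_def p_def[symmetric] q_def[symmetric]
      by (subst (asm) (1 2) integral_density) (auto simp: nn)
  qed
  \<comment> \<open>Restriction to the event on coordinate \<open>k\<close>. The induction
    hypothesis holds for arbitrary finite measures, so it applies to the restrictions
    \<open>D\<close> and \<open>E\<close>.\<close>
  define D where "D = density M (\<lambda>x. ennreal (indicator (A k) (f k x)))"
  define E where "E = density N (\<lambda>x. ennreal (indicator (A k) (g k x)))"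
  have fin: "finite_measure (density K (\<lambda>x. ennreal (indicator (A k) (h x))))"
    if "finite_measure K" and [measurable]: "h \<in> borel_measurable K"
    for K :: "'c measure" and h
  proof
    interpret K: finite_measure K by fact
    have "emeasure (density K (\<lambda>x. ennreal (indicator (A k) (h x)))) (space K)
      \<le> (\<integral>\<^sup>+x. 1 \<partial>K)"
      by (subst emeasure_density, simp, simp) (intro nn_integral_mono, simp add: indicator_def)
    also have "\<dots> < \<infinity>" by (simp add: K.emeasure_eq_measure)
    finally show "emeasure (density K (\<lambda>x. ennreal (indicator (A k) (h x))))
       (space (density K (\<lambda>x. ennreal (indicator (A k) (h x))))) \<noteq> \<infinity>" by simp
  qed
  have "measure D {x\<in>space D. \<forall>i\<in>I. f i x \<in> A i} = measure E {x\<in>space E. \<forall>i\<in>I. g i x \<in> A i}"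
  proof (rule insert.IH)
    fix u :: "'i \<Rightarrow> real"
    \<comment> \<open>The angles 0, \<open>pi\<close> and \<open>pi / 2\<close> recover everything:
      \<open>J 0 + J pi\<close> is twice the mass, \<open>J 0 - J pi\<close> twice the cosine
      integral, and \<open>J (pi / 2)\<close> minus the mass is the sine integral.\<close>
    have split: "(CLINT x|density K (\<lambda>x. ennreal (indicator (A k) (l x))). iexp (h x)) =
       complex_of_real (J 0 / 2 - J pi / 2) + \<i> * complex_of_real (J (pi/2) - J 0 / 2 - J pi / 2)"
      if "finite_measure K" and [measurable]: "h \<in> borel_measurable K" "l \<in> borel_measurable K"
       and J: "\<And>\<theta>. (LINT x|K. (1 + cos (h x - \<theta>)) * indicator (A k) (l x)) = J \<theta>"
      for K :: "'c measure" and h l J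
    proof -
      interpret K: finite_measure K by fact
      have int: "integrable K (\<lambda>x. cos (h x) * indicator (A k) (l x))"
         "integrable K (\<lambda>x. sin (h x) * indicator (A k) (l x))"
         "integrable K (\<lambda>x. indicator (A k) (l x) :: real)"
        by (auto intro!: K.integrable_const_bound[where B=1] split: split_indicator)
      define a where "a = (LINT x|K. indicator (A k) (l x) :: real)"
      define C where "C = (LINT x|K. cos (h x) * indicator (A k) (l x))"
      define T where "T = (LINT x|K. sin (h x) * indicator (A k) (l x))"
      have J0: "J 0 = a + C" "J pi = a - C" "J (pi/2) = a + T"
        unfolding J[symmetric] a_def C_def T_def using int
        by (simp_all add: algebra_simps cos_diff flip: Bochner_Integration.integral_add Bochner_Integration.integral_diff)
      have "(CLINT x|density K (\<lambda>x. ennreal (indicator (A k) (l x))). iexp (h x))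
         = (CLINT x|K. complex_of_real (cos (h x) * indicator (A k) (l x))
               + \<i> * complex_of_real (sin (h x) * indicator (A k) (l x)))"
      proof (subst integral_density)
        show "(CLINT x|K. indicator (A k) (l x) *\<^sub>R iexp (h x)) =
          (CLINT x|K. complex_of_real (cos (h x) * indicator (A k) (l x))
               + \<i> * complex_of_real (sin (h x) * indicator (A k) (l x)))"
        proof (rule Bochner_Integration.integral_cong[OF refl])
          fix x
          have "iexp (h x) = complex_of_real (cos (h x)) + \<i> * complex_of_real (sin (h x))"
            by (simp add: complex_eq_iff Re_exp Im_exp)
          then show "indicator (A k) (l x) *\<^sub>R iexp (h x) =
             complex_of_real (cos (h x) * indicator (A k) (l x))
               + \<i> * complex_of_real (sin (h x) * indicator (A k) (l x))"
            by (simp only: indicator_def) simp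
        qed
      qed auto
      also have "\<dots> = complex_of_real C + \<i> * complex_of_real T"
        using int unfolding C_def T_def
        by (subst Bochner_Integration.integral_add)
          (auto simp del: of_real_mult simp: integral_complex_of_real complex_of_real_integrable_eq)
      finally show ?thesis by (simp add: J0 field_simps)
    qed
    show "(CLINT x|D. iexp (\<Sum>i\<in>I. u i * f i x)) = (CLINT x|E. iexp (\<Sum>i\<in>I. u i * g i x))"
    proof -
      have m: "(\<lambda>x. \<Sum>i\<in>I. u i * f i x) \<in> borel_measurable M" "(\<lambda>x. \<Sum>i\<in>I. u i * g i x) \<in> borel_measurable N"
        by measurable
      show ?thesis
        unfolding D_def E_def
        by (rule trans[OF split[OF \<open>finite_measure M\<close> m(1) \<open>f k \<in> _\<close> tilt]
              split[OF \<open>finite_measure N\<close> m(2) \<open>g k \<in> _\<close> refl, symmetric]])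
    qed
  qed (use insert.prems fin[of M "f k"] fin[of N "g k"] in \<open>auto simp: D_def E_def\<close>)
  moreover have "measure D {x\<in>space D. \<forall>i\<in>I. f i x \<in> A i} = measure M {x\<in>space M. \<forall>i\<in>insert k I. f i x \<in> A i}"
    unfolding D_def measure_def
    by (subst emeasure_density) (use insert.hyps insert.prems in \<open>auto intro!: arg_cong[where f=enn2real]
        simp: nn_integral_indicator[symmetric] simp del: nn_integral_indicator intro!: nn_integral_cong split: split_indicator\<close>)
  moreover have "measure E {x\<in>space E. \<forall>i\<in>I. g i x \<in> A i} = measure N {x\<in>space N. \<forall>i\<in>insert k I. g i x \<in> A i}"
    unfolding E_def measure_def
    by (subst emeasure_density) (use insert.hyps insert.prems in \<open>auto intro!: arg_cong[where f=enn2real]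
        simp: nn_integral_indicator[symmetric] simp del: nn_integral_indicator intro!: nn_integral_cong split: split_indicator\<close>)
  ultimately show ?case by simp
qed

lemma distr_PiM_eq_of_char_eq:
  fixes f :: "'i \<Rightarrow> 'a \<Rightarrow> real" and g :: "'i \<Rightarrow> 'b \<Rightarrow> real"
  assumes "finite I" "finite_measure M" "finite_measure N"
    and f: "\<And>i. i \<in> I \<Longrightarrow> f i \<in> borel_measurable M" and g: "\<And>i. i \<in> I \<Longrightarrow> g i \<in> borel_measurable N"
    and eq: "\<And>u. (CLINT x|M. iexp (\<Sum>i\<in>I. u i * f i x)) = (CLINT x|N. iexp (\<Sum>i\<in>I. u i * g i x))"
  shows "distr M (PiM I (\<lambda>_. borel)) (\<lambda>x. \<lambda>i\<in>I. f i x) = distr N (PiM I (\<lambda>_. borel)) (\<lambda>x. \<lambda>i\<in>I. g i x)"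
proof -
  interpret M: finite_measure M by fact
  interpret N: finite_measure N by fact
  note [measurable] = f g
  have mf: "(\<lambda>x. \<lambda>i\<in>I. f i x) \<in> measurable M (PiM I (\<lambda>_. borel))"
    and mg: "(\<lambda>x. \<lambda>i\<in>I. g i x) \<in> measurable N (PiM I (\<lambda>_. borel))" by measurable
  show ?thesis
  proof (rule measure_eqI_PiM_finite[OF \<open>finite I\<close>])
    fix A :: "'i \<Rightarrow> real set" assume A: "\<And>i. i \<in> I \<Longrightarrow> A i \<in> sets borel"
    have m: "measure M {x\<in>space M. \<forall>i\<in>I. f i x \<in> A i} = measure N {x\<in>space N. \<forall>i\<in>I. g i x \<in> A i}"
      by (rule measure_box_eq_of_char_eq) (use assms A in auto)
    have s: "(\<lambda>x. \<lambda>i\<in>I. f i x) -` Pi\<^sub>E I A \<inter> space M = {x\<in>space M. \<forall>i\<in>I. f i x \<in> A i}"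
      "(\<lambda>x. \<lambda>i\<in>I. g i x) -` Pi\<^sub>E I A \<inter> space N = {x\<in>space N. \<forall>i\<in>I. g i x \<in> A i}"
      by (auto simp: PiE_iff)
    have P: "Pi\<^sub>E I A \<in> sets (PiM I (\<lambda>_. borel))" using A \<open>finite I\<close> by (intro sets_PiM_I_finite) auto
    show "emeasure (distr M (PiM I (\<lambda>_. borel)) (\<lambda>x. \<lambda>i\<in>I. f i x)) (Pi\<^sub>E I A) =
      emeasure (distr N (PiM I (\<lambda>_. borel)) (\<lambda>x. \<lambda>i\<in>I. g i x)) (Pi\<^sub>E I A)"
      using m unfolding emeasure_distr[OF mf P] emeasure_distr[OF mg P] s
      by (simp add: M.emeasure_eq_measure N.emeasure_eq_measure)
  next
    show "range (\<lambda>_::nat. Pi\<^sub>E I (\<lambda>_. UNIV)) \<subseteq> prod_algebra I (\<lambda>_. borel :: real measure)"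
      using \<open>finite I\<close> by (auto intro!: prod_algebraI_finite)
    show "(\<Union>i::nat. Pi\<^sub>E I (\<lambda>_. UNIV :: real set)) = space (PiM I (\<lambda>_. borel))"
      by (simp add: space_PiM)
    interpret D: finite_measure "distr M (PiM I (\<lambda>_. borel)) (\<lambda>x. \<lambda>i\<in>I. f i x)"
      by (rule M.finite_measure_distr[OF mf])
    show "emeasure (distr M (PiM I (\<lambda>_. borel)) (\<lambda>x. \<lambda>i\<in>I. f i x)) (Pi\<^sub>E I (\<lambda>_. UNIV)) \<noteq> \<infinity>" for i :: nat
      by simp
  qed auto
qed

section \<open>Stein's identity for Gaussian quadratic forms\<close>

lemma (in pair_sigma_finite) integral_pair_mult:
  fixes f :: "'a \<Rightarrow> 'c::{real_normed_field, banach, second_countable_topology}" and g :: "'b \<Rightarrow> 'c"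
  assumes f: "integrable M1 f" and g: "integrable M2 g"
  shows "integrable (M1 \<Otimes>\<^sub>M M2) (\<lambda>p. f (fst p) * g (snd p))"
    and "(\<integral>p. f (fst p) * g (snd p) \<partial>(M1 \<Otimes>\<^sub>M M2)) = integral\<^sup>L M1 f * integral\<^sup>L M2 g"
proof -
  have [measurable]: "f \<in> borel_measurable M1" "g \<in> borel_measurable M2" using f g by auto
  show i: "integrable (M1 \<Otimes>\<^sub>M M2) (\<lambda>p. f (fst p) * g (snd p))"
    by (rule Fubini_integrable) (use f g in \<open>auto simp: norm_mult\<close>)
  show "(\<integral>p. f (fst p) * g (snd p) \<partial>(M1 \<Otimes>\<^sub>M M2)) = integral\<^sup>L M1 f * integral\<^sup>L M2 g"
    using integral_fst'[OF i] by simp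
qed

lemma norm_diff_le_of_vector_derivative:
  fixes g :: "real \<Rightarrow> 'a::real_normed_vector"
  assumes "convex A" "\<And>t. t \<in> A \<Longrightarrow> (g has_vector_derivative g' t) (at t within A)"
    and "\<And>t. t \<in> A \<Longrightarrow> norm (g' t) \<le> B" and "x \<in> A" "y \<in> A"
  shows "norm (g x - g y) \<le> B * norm (x - y)"
proof (rule differentiable_bound[of A g "\<lambda>t h. h *\<^sub>R g' t"])
  show "onorm (\<lambda>h. h *\<^sub>R g' t) \<le> B" if "t \<in> A" for t
    using assms(3)[OF that] by (intro onorm_le) (simp add: mult.commute[of B] mult_left_mono)
qed (use assms in \<open>auto simp: has_vector_derivative_def\<close>)

text \<open>The prefactor \<open>b * cos t - D * sin t\<close> is itself the derivative of
  \<open>D * cos t + b * sin t\<close>, which produces the square. The increment bound dominates the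
  difference quotients in \<open>stein_quad\<close>; it is quadratic in \<open>b\<close> and
  \<open>D\<close>, hence integrable there.\<close>

lemma rotated_product_derivative:
  fixes b D S \<sigma> :: real
  defines "g \<equiv> \<lambda>t. complex_of_real (b * cos t - D * sin t) * iexp (\<sigma> * (S + D * cos t + b * sin t))"
  shows "(g has_vector_derivative (- complex_of_real (b * sin t + D * cos t)
      + \<i> * complex_of_real (\<sigma> * (b * cos t - D * sin t)\<^sup>2)) * iexp (\<sigma> * (S + D * cos t + b * sin t))) (at t)"
    and "cmod (g t - g 0) \<le> (2 + D\<^sup>2 + b\<^sup>2 + 2 * \<bar>\<sigma>\<bar> * (D\<^sup>2 + b\<^sup>2)) * \<bar>t\<bar>"
proof -
  define g' where "g' t = (- complex_of_real (b * sin t + D * cos t)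
      + \<i> * complex_of_real (\<sigma> * (b * cos t - D * sin t)\<^sup>2)) * iexp (\<sigma> * (S + D * cos t + b * sin t))" for t
  have d: "(g has_vector_derivative g' t) (at t)" for t
  proof -
    have p: "((\<lambda>t. complex_of_real (b * cos t - D * sin t)) has_vector_derivative
        complex_of_real (- (b * sin t + D * cos t))) (at t)"
      by (intro has_vector_derivative_of_real) (auto intro!: derivative_eq_intros)
    have "((\<lambda>t. \<sigma> * (S + D * cos t + b * sin t)) has_vector_derivative \<sigma> * (b * cos t - D * sin t)) (at t)"
      unfolding has_real_derivative_iff_has_vector_derivative[symmetric]
      by (auto intro!: derivative_eq_intros simp: algebra_simps)
    then have "(iexp \<circ> (\<lambda>t. \<sigma> * (S + D * cos t + b * sin t)) has_vector_derivative
       (\<sigma> * (b * cos t - D * sin t)) *\<^sub>R (\<i> * iexp (\<sigma> * (S + D * cos t + b * sin t)))) (at t)"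
      by (intro vector_diff_chain_at has_vector_derivative_iexp)
    from has_vector_derivative_mult[OF p this[unfolded o_def]] show ?thesis
      unfolding g_def g'_def
      by (rule back_subst[where P="\<lambda>x. (_ has_vector_derivative x) _"])
         (simp add: scaleR_conv_of_real power2_eq_square algebra_simps)
  qed
  then show "(g has_vector_derivative (- complex_of_real (b * sin t + D * cos t)
      + \<i> * complex_of_real (\<sigma> * (b * cos t - D * sin t)\<^sup>2)) * iexp (\<sigma> * (S + D * cos t + b * sin t))) (at t)"
    unfolding g'_def .
  define B where "B = 2 + D\<^sup>2 + b\<^sup>2 + 2 * \<bar>\<sigma>\<bar> * (D\<^sup>2 + b\<^sup>2)"
  have bd: "norm (g' t) \<le> B" for t
  proof -
    have 1: "\<bar>b * sin t\<bar> \<le> \<bar>b\<bar>" "\<bar>b * cos t\<bar> \<le> \<bar>b\<bar>" "\<bar>D * sin t\<bar> \<le> \<bar>D\<bar>" "\<bar>D * cos t\<bar> \<le> \<bar>D\<bar>"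
      by (auto simp: abs_mult mult_left_le)
    have 2: "\<bar>b\<bar> \<le> 1 + b\<^sup>2" "\<bar>D\<bar> \<le> 1 + D\<^sup>2"
      using sum_squares_bound[of 1 "\<bar>b\<bar>"] sum_squares_bound[of 1 "\<bar>D\<bar>"] by auto
    have "\<bar>b * cos t - D * sin t\<bar> \<le> \<bar>b\<bar> + \<bar>D\<bar>" using 1 by linarith
    then have "(b * cos t - D * sin t)\<^sup>2 \<le> (\<bar>b\<bar> + \<bar>D\<bar>)\<^sup>2"
      by (metis abs_ge_zero power2_abs power_mono)
    also have "\<dots> \<le> 2 * (D\<^sup>2 + b\<^sup>2)"
      using sum_squares_bound[of "\<bar>b\<bar>" "\<bar>D\<bar>"] by (simp add: power2_sum)
    finally have 3: "\<bar>\<sigma>\<bar> * (b * cos t - D * sin t)\<^sup>2 \<le> \<bar>\<sigma>\<bar> * (2 * (D\<^sup>2 + b\<^sup>2))"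
      by (rule mult_left_mono) simp
    have "norm (g' t) \<le> \<bar>b * sin t + D * cos t\<bar> + \<bar>\<sigma>\<bar> * (b * cos t - D * sin t)\<^sup>2"
      unfolding g'_def norm_mult norm_exp_i_times mult_1_right
      by (rule order.trans[OF norm_triangle_ineq]) (simp add: norm_mult abs_mult del: of_real_add of_real_mult of_real_diff of_real_power)
    also have "\<dots> \<le> B" unfolding B_def using 1 2 3 by linarith
    finally show ?thesis .
  qed
  have "norm (g t - g 0) \<le> B * norm (t - 0)"
    by (rule norm_diff_le_of_vector_derivative[of UNIV g g']) (auto intro: has_vector_derivative_at_within d bd)
  then show "cmod (g t - g 0) \<le> (2 + D\<^sup>2 + b\<^sup>2 + 2 * \<bar>\<sigma>\<bar> * (D\<^sup>2 + b\<^sup>2)) * \<bar>t\<bar>"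
    unfolding B_def by simp
qed

lemma integral_double_sum:
  fixes f :: "'i \<Rightarrow> 'i \<Rightarrow> 'a \<Rightarrow> 'b::{real_normed_field, banach, second_countable_topology}"
  assumes "\<And>l m. l \<in> I \<Longrightarrow> m \<in> I \<Longrightarrow> integrable N (f l m)"
  shows "integrable N (\<lambda>x. \<Sum>l\<in>I. \<Sum>m\<in>I. c l m * f l m x)"
    and "(\<integral>x. (\<Sum>l\<in>I. \<Sum>m\<in>I. c l m * f l m x) \<partial>N) = (\<Sum>l\<in>I. \<Sum>m\<in>I. c l m * (\<integral>x. f l m x \<partial>N))"
proof -
  have i: "integrable N (\<lambda>x. c l m * f l m x)" if "l \<in> I" "m \<in> I" for l m
    using assms[OF that] by simp
  have ii: "integrable N (\<lambda>x. \<Sum>m\<in>I. c l m * f l m x)" if "l \<in> I" for l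
    using i that by (intro Bochner_Integration.integrable_sum) auto
  show "integrable N (\<lambda>x. \<Sum>l\<in>I. \<Sum>m\<in>I. c l m * f l m x)"
    using ii by (rule Bochner_Integration.integrable_sum)
  have "(\<integral>x. (\<Sum>l\<in>I. \<Sum>m\<in>I. c l m * f l m x) \<partial>N) = (\<Sum>l\<in>I. (\<integral>x. (\<Sum>m\<in>I. c l m * f l m x) \<partial>N))"
    using ii by (rule Bochner_Integration.integral_sum)
  also have "\<dots> = (\<Sum>l\<in>I. \<Sum>m\<in>I. c l m * (\<integral>x. f l m x \<partial>N))"
  proof (rule sum.cong[OF refl])
    fix l assume "l \<in> I"
    then have "(\<integral>x. (\<Sum>m\<in>I. c l m * f l m x) \<partial>N) = (\<Sum>m\<in>I. (\<integral>x. c l m * f l m x \<partial>N))"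
      using i by (intro Bochner_Integration.integral_sum) auto
    then show "(\<integral>x. (\<Sum>m\<in>I. c l m * f l m x) \<partial>N) = (\<Sum>m\<in>I. c l m * (\<integral>x. f l m x \<partial>N))"
      by simp
  qed
  finally show "(\<integral>x. (\<Sum>l\<in>I. \<Sum>m\<in>I. c l m * f l m x) \<partial>N) = (\<Sum>l\<in>I. \<Sum>m\<in>I. c l m * (\<integral>x. f l m x \<partial>N))" .
qed

context gaussian_space
begin

lemma expectation_iexp_pair:
  assumes "X \<in> S" "Z \<in> S"
  shows "(CLINT p|M \<Otimes>\<^sub>M M. iexp (X (fst p) + Z (snd p))) =
    exp (- (expectation (\<lambda>x. (X x)\<^sup>2) + expectation (\<lambda>x. (Z x)\<^sup>2)) / 2)"
proof -
  interpret P: pair_prob_space M M ..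
  have i: "integrable M (\<lambda>x. iexp (h x))" if "h \<in> S" for h
    using rv[OF that] by (intro integrable_const_bound[where B=1]) auto
  have "(CLINT p|M \<Otimes>\<^sub>M M. iexp (X (fst p) + Z (snd p))) =
      (CLINT p|M \<Otimes>\<^sub>M M. iexp (X (fst p)) * iexp (Z (snd p)))"
    by (simp add: exp_add distrib_left)
  also have "\<dots> = expectation (\<lambda>x. iexp (X x)) * expectation (\<lambda>x. iexp (Z x))"
    by (rule P.integral_pair_mult(2)[OF i i]) fact+
  finally show ?thesis
    unfolding expectation_iexp[OF assms(1)] expectation_iexp[OF assms(2)]
    by (simp add: exp_add[symmetric] of_real_exp[symmetric] field_simps flip: of_real_mult)
qed

text \<open>Coordinates \<open>(True, l)\<close> hold a Gaussian vector and \<open>(False, l)\<close> an independent copy of it.\<close>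

lemma distr_rotation:
  fixes Y :: "'i \<Rightarrow> 'a \<Rightarrow> real"
  assumes I: "finite I" and Y: "\<And>l. l \<in> I \<Longrightarrow> Y l \<in> S"
  defines "F \<equiv> \<lambda>t (b, l) p. if b then cos t * Y l (fst p) + sin t * Y l (snd p)
                              else cos t * Y l (snd p) - sin t * Y l (fst p)"
  shows "distr (M \<Otimes>\<^sub>M M) (PiM (UNIV \<times> I) (\<lambda>_. borel)) (\<lambda>p. \<lambda>j\<in>UNIV \<times> I. F t j p)
       = distr (M \<Otimes>\<^sub>M M) (PiM (UNIV \<times> I) (\<lambda>_. borel)) (\<lambda>p. \<lambda>j\<in>UNIV \<times> I. F 0 j p)"
proof (rule distr_PiM_eq_of_char_eq)
  interpret P: pair_prob_space M M ..
  show "finite_measure (M \<Otimes>\<^sub>M M)" "finite_measure (M \<Otimes>\<^sub>M M)" by unfold_locales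
  show "F s j \<in> borel_measurable (M \<Otimes>\<^sub>M M)" if "j \<in> UNIV \<times> I" for s j
  proof -
    obtain b l where [simp]: "j = (b, l)" by (cases j)
    have [measurable]: "Y l \<in> borel_measurable M" using that rv Y by auto
    show ?thesis by (simp add: F_def) measurable
  qed
  then show "F 0 j \<in> borel_measurable (M \<Otimes>\<^sub>M M)" if "j \<in> UNIV \<times> I" for j using that .
  fix u :: "bool \<times> 'i \<Rightarrow> real"
  define A where "A x = (\<Sum>l\<in>I. u (True, l) * Y l x)" for x
  define B where "B x = (\<Sum>l\<in>I. u (False, l) * Y l x)" for x
  have AB: "A \<in> S" "B \<in> S" unfolding A_def B_def by (intro sum_mem scale_mem Y; assumption)+
  \<comment> \<open>Moved from the vectors to the coefficients, the rotation acts on the pair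
    \<open>(A, B)\<close>. It preserves \<open>(A x)\<^sup>2 + (B x)\<^sup>2\<close> pointwise, and
    by independence the transform depends only on the expectation of this sum.\<close>
  define X where "X s x = cos s * A x - sin s * B x" for s x
  define Z where "Z s x = sin s * A x + cos s * B x" for s x
  have XZ: "X s \<in> S" "Z s \<in> S" for s
    unfolding X_def Z_def by (intro diff_mem add_mem scale_mem AB)+
  have sumF: "(\<Sum>j\<in>UNIV \<times> I. u j * F s j p) = X s (fst p) + Z s (snd p)" for s p
  proof -
    have "(\<Sum>j\<in>UNIV \<times> I. u j * F s j p) = (\<Sum>b\<in>UNIV. \<Sum>l\<in>I. u (b, l) * F s (b, l) p)"
      by (simp add: sum.cartesian_product split_def)
    also have "\<dots> = (\<Sum>l\<in>I. u (True, l) * (cos s * Y l (fst p) + sin s * Y l (snd p)))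
        + (\<Sum>l\<in>I. u (False, l) * (cos s * Y l (snd p) - sin s * Y l (fst p)))"
      by (simp add: UNIV_bool F_def)
    also have "\<dots> = X s (fst p) + Z s (snd p)"
      unfolding X_def Z_def A_def B_def sum_distrib_left
      by (simp add: sum.distrib[symmetric] sum_subtractf[symmetric] algebra_simps)
    finally show ?thesis .
  qed
  have "expectation (\<lambda>x. (X s x)\<^sup>2) + expectation (\<lambda>x. (Z s x)\<^sup>2)
      = expectation (\<lambda>x. (A x)\<^sup>2) + expectation (\<lambda>x. (B x)\<^sup>2)" for s
  proof -
    have "(X s x)\<^sup>2 + (Z s x)\<^sup>2 = (A x)\<^sup>2 + (B x)\<^sup>2" for x
    proof -
      have "(X s x)\<^sup>2 + (Z s x)\<^sup>2 = ((A x)\<^sup>2 + (B x)\<^sup>2) * ((sin s)\<^sup>2 + (cos s)\<^sup>2)"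
        unfolding X_def Z_def by algebra
      then show ?thesis by simp
    qed
    then show ?thesis
      using XZ AB by (simp add: integrable_power flip: Bochner_Integration.integral_add)
  qed
  then show "(CLINT p|M \<Otimes>\<^sub>M M. iexp (\<Sum>j\<in>UNIV \<times> I. u j * F t j p))
     = (CLINT p|M \<Otimes>\<^sub>M M. iexp (\<Sum>j\<in>UNIV \<times> I. u j * F 0 j p))"
    unfolding sumF expectation_iexp_pair[OF XZ] by presburger
qed (use I in simp)

lemma integrable_quad:
  assumes "finite I" "\<And>l. l \<in> I \<Longrightarrow> Y l \<in> S"
  shows "integrable M (\<lambda>x. \<Sum>l\<in>I. w l * (Y l x)\<^sup>2)" "integrable M (\<lambda>x. (\<Sum>l\<in>I. w l * (Y l x)\<^sup>2)\<^sup>2)"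
proof -
  show "integrable M (\<lambda>x. \<Sum>l\<in>I. w l * (Y l x)\<^sup>2)"
    using assms by (intro Bochner_Integration.integrable_sum integrable_mult_right integrable_power)
  have "(\<lambda>x. (\<Sum>l\<in>I. w l * (Y l x)\<^sup>2)\<^sup>2) = (\<lambda>x. \<Sum>l\<in>I. \<Sum>m\<in>I. w l * w m * (Y l x * Y l x * Y m x * Y m x))"
    unfolding power2_eq_square sum_product by (simp add: ac_simps)
  then show "integrable M (\<lambda>x. (\<Sum>l\<in>I. w l * (Y l x)\<^sup>2)\<^sup>2)"
    using assms by (simp only:) (intro Bochner_Integration.integrable_sum integrable_mult_right wick4)
qed

text \<open>Stein's identity for a quadratic form \<open>q\<close>, obtained by differentiating at \<open>t = 0\<close> the
  expectation of \<open>b\<^sub>t iexp (\<sigma> q\<^sub>t)\<close>, which does not depend on the rotation angle \<open>t\<close>;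
  here \<open>b\<close> is the bilinear form of \<open>q\<close> evaluated at a Gaussian vector and an independent copy.\<close>

lemma stein_quad:
  fixes Y :: "'i \<Rightarrow> 'a \<Rightarrow> real" and w :: "'i \<Rightarrow> real"
  assumes I: "finite I" and Y: "\<And>l. l \<in> I \<Longrightarrow> Y l \<in> S"
  defines "q \<equiv> \<lambda>z. \<Sum>l\<in>I. w l * (Y l z)\<^sup>2"
    and "G \<equiv> \<lambda>z. \<Sum>l\<in>I. \<Sum>m\<in>I. w l * w m * expectation (\<lambda>z. Y l z * Y m z) * (Y l z * Y m z)"
  shows "expectation (\<lambda>z. complex_of_real (q z - expectation q) * iexp (\<sigma> * q z))
    = 2 * \<i> * \<sigma> * expectation (\<lambda>z. complex_of_real (G z) * iexp (\<sigma> * q z))"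
proof -
  interpret P: pair_prob_space M M ..
  let ?P = "M \<Otimes>\<^sub>M M"
  have [measurable]: "Y l \<in> borel_measurable M" if "l \<in> I" for l using rv Y that by auto
  have [measurable]: "q \<in> borel_measurable M" unfolding q_def by measurable
  define b where "b p = (\<Sum>l\<in>I. w l * (Y l (fst p) * Y l (snd p)))" for p
  define D where "D p = (q (fst p) - q (snd p)) / 2" for p
  define E where "E p = (q (fst p) + q (snd p)) / 2" for p
  have [measurable]: "b \<in> borel_measurable ?P" "D \<in> borel_measurable ?P" "E \<in> borel_measurable ?P"
    unfolding b_def D_def E_def by measurable
  define g where "g t p = complex_of_real (b p * cos t - D p * sin t) * iexp (\<sigma> * (E p + D p * cos t + b p * sin t))" for t p
  have [measurable]: "g t \<in> borel_measurable ?P" for t unfolding g_def by measurable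
  have rot: "(\<integral>p. g t p \<partial>?P) = (\<integral>p. g 0 p \<partial>?P)" for t
  proof -
    define F where "F t = (\<lambda>(c, l) p. if c then cos t * Y l (fst p) + sin t * Y l (snd p)
                              else cos t * Y l (snd p) - sin t * Y l (fst p))" for t
    define h where "h x = complex_of_real (\<Sum>l\<in>I. w l * (x (True, l) * x (False, l)))
        * iexp (\<sigma> * (\<Sum>l\<in>I. w l * (x (True, l))\<^sup>2))" for x :: "bool \<times> 'i \<Rightarrow> real"
    have [measurable]: "h \<in> borel_measurable (PiM (UNIV \<times> I) (\<lambda>_. borel))"
      unfolding h_def by measurable
    have Fm: "(\<lambda>p. \<lambda>j\<in>UNIV \<times> I. F s j p) \<in> measurable ?P (PiM (UNIV \<times> I) (\<lambda>_. borel))" for s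
    proof (rule measurable_restrict)
      fix j :: "bool \<times> 'i" assume "j \<in> UNIV \<times> I"
      then show "F s j \<in> borel_measurable ?P" by (cases j) (auto simp: F_def)
    qed
    \<comment> \<open>Squares and products of rotated coordinates are functions of the double angle,
      which is why the rotation by \<open>t / 2\<close> is used afterwards.\<close>
    have hg: "h (\<lambda>j\<in>UNIV \<times> I. F s j p) = g (2 * s) p" for s p
    proof -
      have 1: "(\<Sum>l\<in>I. w l * (F s (True, l) p * F s (False, l) p)) = b p * cos (2 * s) - D p * sin (2 * s)"
      proof -
        have "(\<Sum>l\<in>I. w l * (F s (True, l) p * F s (False, l) p))
          = (\<Sum>l\<in>I. w l * (Y l (fst p) * Y l (snd p)) * cos (2 * s)
             - (w l * (Y l (fst p))\<^sup>2 - w l * (Y l (snd p))\<^sup>2) / 2 * sin (2 * s))"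
          by (intro sum.cong refl) (simp add: F_def cos_double sin_double, algebra)
        then show ?thesis
          by (simp only: b_def D_def q_def sum_subtractf[symmetric] sum_distrib_right sum_divide_distrib)
      qed
      have 2: "(\<Sum>l\<in>I. w l * (F s (True, l) p)\<^sup>2) = E p + D p * cos (2 * s) + b p * sin (2 * s)"
      proof -
        have c: "(cos s)\<^sup>2 = (1 + cos (2 * s)) / 2" "(sin s)\<^sup>2 = (1 - cos (2 * s)) / 2"
          using cos_double_cos[of s] sin_squared_eq[of s] by simp_all
        have "w l * (F s (True, l) p)\<^sup>2 = w l * ((cos s)\<^sup>2 * (Y l (fst p))\<^sup>2 + (sin s)\<^sup>2 * (Y l (snd p))\<^sup>2
             + 2 * sin s * cos s * (Y l (fst p) * Y l (snd p)))" for l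
          unfolding F_def by (simp, algebra)
        then have "w l * (F s (True, l) p)\<^sup>2 = (w l * (Y l (fst p))\<^sup>2 + w l * (Y l (snd p))\<^sup>2) / 2
            + (w l * (Y l (fst p))\<^sup>2 - w l * (Y l (snd p))\<^sup>2) / 2 * cos (2 * s)
            + w l * (Y l (fst p) * Y l (snd p)) * sin (2 * s)" for l
          unfolding c sin_double by (simp add: field_simps)
        then show ?thesis
          by (simp only: b_def D_def E_def q_def sum_subtractf[symmetric] sum.distrib[symmetric]
              sum_distrib_right sum_divide_distrib)
      qed
      show ?thesis
        unfolding g_def 1[symmetric] 2[symmetric] h_def by simp
    qed
    have "(\<integral>p. g (2 * s) p \<partial>?P) = (\<integral>x. h x \<partial>distr ?P (PiM (UNIV \<times> I) (\<lambda>_. borel)) (\<lambda>p. \<lambda>j\<in>UNIV \<times> I. F s j p))" for s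
      by (subst integral_distr[OF Fm]) (simp_all add: hg)
    from this[of "t / 2"] this[of 0] show ?thesis
      using distr_rotation[OF I Y, where t = "t / 2"] unfolding F_def by simp
  qed
  have int_q: "integrable M q" "integrable M (\<lambda>z. (q z)\<^sup>2)"
    unfolding q_def using integrable_quad[OF I Y] by auto
  have fst_int: "integrable ?P (\<lambda>p. f (fst p))" "integrable ?P (\<lambda>p. f (snd p))"
    if "integrable M f" for f :: "'a \<Rightarrow> real"
    using P.integral_pair_mult(1)[OF that, of "\<lambda>_. 1"] P.integral_pair_mult(1)[OF _ that, of "\<lambda>_. 1"] by auto
  have int_b2: "integrable ?P (\<lambda>p. (b p)\<^sup>2)"
  proof -
    have "(\<lambda>p. (b p)\<^sup>2) = (\<lambda>p. \<Sum>l\<in>I. \<Sum>m\<in>I. w l * w m * ((Y l (fst p) * Y m (fst p)) * (Y l (snd p) * Y m (snd p))))"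
      unfolding b_def power2_eq_square sum_product by (simp add: ac_simps)
    then show ?thesis
      by (simp only:) (intro Bochner_Integration.integrable_sum integrable_mult_right
         P.integral_pair_mult(1)[of "\<lambda>z. Y _ z * Y _ z" "\<lambda>z. Y _ z * Y _ z"] integrable_mult Y)
  qed
  have int_D2: "integrable ?P (\<lambda>p. (D p)\<^sup>2)"
  proof -
    have "integrable ?P (\<lambda>p. (q (fst p))\<^sup>2 + (q (snd p))\<^sup>2)"
      using fst_int[OF int_q(2)] by simp
    then show ?thesis
    proof (rule Bochner_Integration.integrable_bound)
      have "((x - y) / 2)\<^sup>2 \<le> x\<^sup>2 + y\<^sup>2" for x y :: real
      proof -
        have "x\<^sup>2 + y\<^sup>2 - ((x - y) / 2)\<^sup>2 = (x\<^sup>2 + y\<^sup>2) / 2 + ((x + y) / 2)\<^sup>2"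
          by (simp add: field_simps power2_eq_square)
        moreover have "0 \<le> (x\<^sup>2 + y\<^sup>2) / 2 + ((x + y) / 2)\<^sup>2" by simp
        ultimately show ?thesis by linarith
      qed
      then show "AE p in ?P. norm ((D p)\<^sup>2) \<le> norm ((q (fst p))\<^sup>2 + (q (snd p))\<^sup>2)"
        by (simp add: D_def)
    qed measurable
  qed
  define K where "K p = 2 + (D p)\<^sup>2 + (b p)\<^sup>2 + 2 * \<bar>\<sigma>\<bar> * ((D p)\<^sup>2 + (b p)\<^sup>2)" for p
  have int_K: "integrable ?P K" unfolding K_def using int_b2 int_D2 by simp
  have g_b: "norm (g t p - g 0 p) \<le> K p * \<bar>t\<bar>" for t p
    unfolding g_def K_def by (rule rotated_product_derivative(2))
  \<comment> \<open>The derivative of \<open>g\<close> at angle 0. Since \<open>E + D\<close> is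
    \<open>q\<close> of the first copy, the second copy has left the exponential.\<close>
  define g' where "g' p = (- complex_of_real (D p) + \<i> * complex_of_real (\<sigma> * (b p)\<^sup>2)) * iexp (\<sigma> * q (fst p))" for p
  have ED: "E p + D p = q (fst p)" for p by (simp add: E_def D_def field_simps)
  define \<tau> where "\<tau> n = 1 / real (Suc n)" for n
  have "(\<lambda>n. \<integral>p. (g (\<tau> n) p - g 0 p) / \<tau> n \<partial>?P) \<longlonglongrightarrow> (\<integral>p. g' p \<partial>?P)"
  proof (rule integral_dominated_convergence[where w = K])
    show "AE p in ?P. (\<lambda>n. (g (\<tau> n) p - g 0 p) / complex_of_real (\<tau> n)) \<longlonglongrightarrow> g' p"
    proof (rule AE_I2)
      fix p
      have "((\<lambda>t. g t p) has_vector_derivative g' p) (at 0)"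
        using rotated_product_derivative(1)[of "b p" "D p" \<sigma> "E p" 0]
        unfolding g_def g'_def by (simp add: ED flip: of_real_add)
      then have "((\<lambda>t. norm (g t p - g 0 p - t *\<^sub>R g' p) / norm t) \<longlongrightarrow> 0) (at 0)"
        unfolding has_vector_derivative_def has_derivative_iff_norm by simp
      then have "((\<lambda>t. norm ((g t p - g 0 p) /\<^sub>R t - g' p)) \<longlongrightarrow> 0) (at 0)"
      proof (rule Lim_transform_eventually)
        have "norm (g t p - g 0 p - t *\<^sub>R g' p) / norm t = norm ((g t p - g 0 p) /\<^sub>R t - g' p)"
          if "t \<noteq> 0" for t
        proof -
          have "(g t p - g 0 p) /\<^sub>R t - g' p = (g t p - g 0 p - t *\<^sub>R g' p) /\<^sub>R t"
            using that by (simp add: scaleR_diff_right)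
          then show ?thesis by (simp add: divide_inverse mult.commute)
        qed
        then show "\<forall>\<^sub>F t in at 0. norm (g t p - g 0 p - t *\<^sub>R g' p) / norm t = norm ((g t p - g 0 p) /\<^sub>R t - g' p)"
          by (auto simp: eventually_at_filter)
      qed
      then have "((\<lambda>t. (g t p - g 0 p) /\<^sub>R t) \<longlongrightarrow> g' p) (at 0)"
        using LIM_zero_cancel tendsto_norm_zero_iff by blast
      moreover have "filterlim \<tau> (at 0) sequentially"
        unfolding filterlim_at \<tau>_def by (auto intro!: LIMSEQ_inverse_real_of_nat[unfolded inverse_eq_divide] simp del: of_nat_Suc)
      ultimately have "(\<lambda>n. (g (\<tau> n) p - g 0 p) /\<^sub>R \<tau> n) \<longlonglongrightarrow> g' p"
        by (rule filterlim_compose)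
      then show "(\<lambda>n. (g (\<tau> n) p - g 0 p) / complex_of_real (\<tau> n)) \<longlonglongrightarrow> g' p"
        by (simp add: scaleR_conv_of_real divide_inverse mult.commute)
    qed
    show "AE p in ?P. norm ((g (\<tau> n) p - g 0 p) / complex_of_real (\<tau> n)) \<le> K p" for n
    proof (rule AE_I2)
      fix p
      have "\<tau> n > 0" by (simp add: \<tau>_def)
      then show "norm ((g (\<tau> n) p - g 0 p) / complex_of_real (\<tau> n)) \<le> K p"
        using g_b[of "\<tau> n" p] by (simp add: norm_divide divide_le_eq)
    qed
  qed (use int_K in \<open>auto simp: g'_def\<close>)
  moreover have int_g: "integrable ?P (g t)" for t
  proof -
    have g0: "integrable ?P (g 0)"
    proof (rule Bochner_Integration.integrable_bound[OF int_K])
      have "norm (g 0 p) \<le> norm (K p)" for p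
      proof -
        have "0 \<le> 2 * \<bar>\<sigma>\<bar> * ((D p)\<^sup>2 + (b p)\<^sup>2)" "0 \<le> (D p)\<^sup>2" by auto
        then have "\<bar>b p\<bar> \<le> K p"
          using sum_squares_bound[of 1 "\<bar>b p\<bar>", simplified] zero_le_power2[of "b p"] unfolding K_def by linarith
        moreover have "norm (g 0 p) = \<bar>b p\<bar>"
          by (simp only: g_def norm_mult norm_exp_i_times) simp
        ultimately show ?thesis by simp
      qed
      then show "AE p in ?P. norm (g 0 p) \<le> norm (K p)" by simp
    qed measurable
    have "integrable ?P (\<lambda>p. g t p - g 0 p)"
    proof (rule Bochner_Integration.integrable_bound)
      show "integrable ?P (\<lambda>p. K p * \<bar>t\<bar>)" using int_K by simp
      show "AE p in ?P. norm (g t p - g 0 p) \<le> norm (K p * \<bar>t\<bar>)"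
        using g_b by (intro AE_I2 order.trans[OF g_b]) simp
    qed measurable
    from Bochner_Integration.integrable_add[OF this g0] show ?thesis by simp
  qed
  moreover have "(\<integral>p. (g t p - g 0 p) / c \<partial>?P) = 0" for t c
    using int_g rot[of t] by simp
  ultimately have zero: "(\<integral>p. g' p \<partial>?P) = 0"
    by (simp only: LIMSEQ_const_iff)
  define e where "e z = iexp (\<sigma> * q z)" for z
  have [measurable]: "e \<in> borel_measurable M" unfolding e_def by measurable
  have ie: "integrable M (\<lambda>z. complex_of_real (f z) * e z)" if f: "integrable M f" for f
    by (rule Bochner_Integration.integrable_bound[OF f]) (use f in \<open>auto simp: e_def norm_mult\<close>)
  have io: "integrable M (\<lambda>z. complex_of_real (f z))" if "integrable M f" for f
    using that by simp
  have e1: "integrable M e" using ie[of "\<lambda>_. 1"] by simp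
  have D': "integrable ?P (\<lambda>p. complex_of_real (D p) * e (fst p))"
     "(\<integral>p. complex_of_real (D p) * e (fst p) \<partial>?P)
      = (expectation (\<lambda>z. complex_of_real (q z) * e z) - expectation e * complex_of_real (expectation q)) / 2"
  proof -
    have eq: "(\<lambda>p. complex_of_real (D p) * e (fst p)) =
      (\<lambda>p. ((complex_of_real (q (fst p)) * e (fst p)) * 1 - e (fst p) * complex_of_real (q (snd p))) / 2)"
      by (auto simp: D_def field_simps)
    note a = P.integral_pair_mult[OF ie[OF int_q(1)], of "\<lambda>_. 1"]
    note c = P.integral_pair_mult[OF e1 io[OF int_q(1)]]
    show "integrable ?P (\<lambda>p. complex_of_real (D p) * e (fst p))"
      unfolding eq using a c by simp
    show "(\<integral>p. complex_of_real (D p) * e (fst p) \<partial>?P)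
      = (expectation (\<lambda>z. complex_of_real (q z) * e z) - expectation e * complex_of_real (expectation q)) / 2"
      unfolding eq using a c by (simp add: prob_space)
  qed
  \<comment> \<open>Integrating out the second copy replaces its factor \<open>Y l * Y m\<close> by
    the covariance, so the square of \<open>b\<close> becomes the form \<open>G\<close> of the first
    copy alone.\<close>
  have B': "integrable ?P (\<lambda>p. complex_of_real ((b p)\<^sup>2) * e (fst p))"
     "(\<integral>p. complex_of_real ((b p)\<^sup>2) * e (fst p) \<partial>?P) = expectation (\<lambda>z. complex_of_real (G z) * e z)"
  proof -
    have eq: "(\<lambda>p. complex_of_real ((b p)\<^sup>2) * e (fst p)) =
      (\<lambda>p. \<Sum>l\<in>I. \<Sum>m\<in>I. complex_of_real (w l * w m) * ((complex_of_real (Y l (fst p) * Y m (fst p)) * e (fst p)) *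
         complex_of_real (Y l (snd p) * Y m (snd p))))"
      unfolding b_def power2_eq_square sum_product unfolding of_real_sum sum_distrib_right
      by (simp only: of_real_mult mult_ac)
    have a: "integrable ?P (\<lambda>p. (complex_of_real (Y l (fst p) * Y m (fst p)) * e (fst p)) * complex_of_real (Y l (snd p) * Y m (snd p)))"
        "(\<integral>p. (complex_of_real (Y l (fst p) * Y m (fst p)) * e (fst p)) * complex_of_real (Y l (snd p) * Y m (snd p)) \<partial>?P)
          = expectation (\<lambda>z. complex_of_real (Y l z * Y m z) * e z) * complex_of_real (expectation (\<lambda>z. Y l z * Y m z))"
      if "l \<in> I" "m \<in> I" for l m
      using P.integral_pair_mult[OF ie[OF integrable_mult[OF Y Y]] io[OF integrable_mult[OF Y Y]], of l m l m] that
      by (auto simp del: of_real_mult simp: integral_complex_of_real)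
    show "integrable ?P (\<lambda>p. complex_of_real ((b p)\<^sup>2) * e (fst p))"
      unfolding eq by (rule integral_double_sum(1)) (rule a(1))
    have "(\<integral>p. complex_of_real ((b p)\<^sup>2) * e (fst p) \<partial>?P) = (\<Sum>l\<in>I. \<Sum>m\<in>I. complex_of_real (w l * w m) *
        (\<integral>p. (complex_of_real (Y l (fst p) * Y m (fst p)) * e (fst p)) * complex_of_real (Y l (snd p) * Y m (snd p)) \<partial>?P))"
      unfolding eq by (rule integral_double_sum(2)) (rule a(1))
    also have "\<dots> = (\<Sum>l\<in>I. \<Sum>m\<in>I. complex_of_real (w l * w m) *
        (expectation (\<lambda>z. complex_of_real (Y l z * Y m z) * e z) * complex_of_real (expectation (\<lambda>z. Y l z * Y m z))))"
      by (intro sum.cong refl) (simp only: a(2))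
    also have "\<dots> = (\<Sum>l\<in>I. \<Sum>m\<in>I. complex_of_real (w l * w m * expectation (\<lambda>z. Y l z * Y m z)) *
        expectation (\<lambda>z. complex_of_real (Y l z * Y m z) * e z))"
      by (intro sum.cong refl) (simp only: of_real_mult mult_ac)
    also have "\<dots> = expectation (\<lambda>z. \<Sum>l\<in>I. \<Sum>m\<in>I. complex_of_real (w l * w m * expectation (\<lambda>z. Y l z * Y m z)) *
        (complex_of_real (Y l z * Y m z) * e z))"
      by (rule integral_double_sum(2)[symmetric]) (intro ie integrable_mult Y)
    also have "\<dots> = expectation (\<lambda>z. complex_of_real (G z) * e z)"
      unfolding G_def of_real_sum sum_distrib_right by (simp only: of_real_mult mult.assoc)
    finally show "(\<integral>p. complex_of_real ((b p)\<^sup>2) * e (fst p) \<partial>?P) = expectation (\<lambda>z. complex_of_real (G z) * e z)" .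
  qed
  have "0 = (\<integral>p. \<i> * complex_of_real \<sigma> * (complex_of_real ((b p)\<^sup>2) * e (fst p)) - complex_of_real (D p) * e (fst p) \<partial>?P)"
    unfolding zero[symmetric] g'_def e_def by (simp add: algebra_simps)
  also have "\<dots> = \<i> * complex_of_real \<sigma> * expectation (\<lambda>z. complex_of_real (G z) * e z)
     - (expectation (\<lambda>z. complex_of_real (q z) * e z) - expectation e * complex_of_real (expectation q)) / 2"
    using B' D' by (subst Bochner_Integration.integral_diff) (auto simp del: of_real_power)
  finally have "expectation (\<lambda>z. complex_of_real (q z) * e z) - expectation e * complex_of_real (expectation q)
     = 2 * \<i> * \<sigma> * expectation (\<lambda>z. complex_of_real (G z) * e z)"
    by (simp add: field_simps)
  moreover have "expectation (\<lambda>z. complex_of_real (q z - expectation q) * e z)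
    = expectation (\<lambda>z. complex_of_real (q z) * e z) - expectation e * complex_of_real (expectation q)"
  proof -
    have "expectation (\<lambda>z. complex_of_real (q z - expectation q) * e z)
      = expectation (\<lambda>z. complex_of_real (q z) * e z - e z * complex_of_real (expectation q))"
      by (simp add: algebra_simps)
    also have "\<dots> = expectation (\<lambda>z. complex_of_real (q z) * e z) - expectation e * complex_of_real (expectation q)"
      by (subst Bochner_Integration.integral_diff[OF ie[OF int_q(1)]]) (use e1 in auto)
    finally show ?thesis .
  qed
  ultimately show ?thesis unfolding e_def by simp
qed

end

section \<open>A quantitative central limit theorem for Gaussian quadratic forms\<close>

text \<open>Differentiation under the expectation: the second-order remainder of \<open>iexp\<close>
  is at most half the squared step times the square of \<open>Z\<close>, which is
  integrable.\<close>

lemma (in prob_space) char_has_vector_derivative: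
  fixes Z :: "'a \<Rightarrow> real"
  assumes [measurable]: "Z \<in> borel_measurable M" and Z1: "integrable M Z" and Z2: "integrable M (\<lambda>\<omega>. (Z \<omega>)\<^sup>2)"
  shows "((\<lambda>s. expectation (\<lambda>\<omega>. iexp (s * Z \<omega>))) has_vector_derivative
     \<i> * expectation (\<lambda>\<omega>. complex_of_real (Z \<omega>) * iexp (s * Z \<omega>))) (at s)"
proof -
  have ie: "integrable M (\<lambda>\<omega>. iexp (s * Z \<omega>))" for s
    by (rule integrable_const_bound[where B=1]) auto
  have iz: "integrable M (\<lambda>\<omega>. complex_of_real (Z \<omega>) * iexp (s * Z \<omega>))"
    by (rule Bochner_Integration.integrable_bound[OF Z1]) (auto simp: norm_mult)
  show ?thesis
    unfolding has_vector_derivative_def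
  proof (rule has_derivativeI_sandwich[of 1 _ _ _ _ "\<lambda>y. \<bar>y - s\<bar> * (expectation (\<lambda>\<omega>. (Z \<omega>)\<^sup>2) / 2)"])
    show "bounded_linear (\<lambda>x. x *\<^sub>R (\<i> * expectation (\<lambda>\<omega>. complex_of_real (Z \<omega>) * iexp (s * Z \<omega>))))"
      by (rule bounded_linear_scaleR_left)
    show "((\<lambda>y. \<bar>y - s\<bar> * (expectation (\<lambda>\<omega>. (Z \<omega>)\<^sup>2) / 2)) \<longlongrightarrow> 0) (at s)"
      by (auto intro!: tendsto_eq_intros)
    fix y assume "y \<noteq> s"
    let ?h = "y - s"
    define err where "err \<omega> = iexp (s * Z \<omega>) * (iexp (?h * Z \<omega>) - (1 + \<i> * complex_of_real (?h * Z \<omega>)))" for \<omega>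
    have err: "err \<omega> = iexp (y * Z \<omega>) - (iexp (s * Z \<omega>) + complex_of_real ?h * \<i> * (complex_of_real (Z \<omega>) * iexp (s * Z \<omega>)))" for \<omega>
    proof -
      have alg: "a * (b - (1 + \<i> * (h * z))) = a * b - (a + h * \<i> * (z * a))" for a b h z :: complex
        by (simp add: algebra_simps)
      have "iexp (y * Z \<omega>) = iexp (s * Z \<omega> + ?h * Z \<omega>)" by (simp add: algebra_simps)
      also have "\<dots> = iexp (s * Z \<omega>) * iexp (?h * Z \<omega>)" by (simp only: of_real_add distrib_left exp_add)
      finally show ?thesis unfolding err_def of_real_mult[of ?h] alg by (simp only: of_real_mult)
    qed
    note im = integrable_mult_right[OF iz, of "complex_of_real ?h * \<i>"]
    note ia = Bochner_Integration.integrable_add[OF ie[of s] im]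
    have ierr: "expectation err = expectation (\<lambda>\<omega>. iexp (y * Z \<omega>)) - (expectation (\<lambda>\<omega>. iexp (s * Z \<omega>))
        + complex_of_real ?h * \<i> * expectation (\<lambda>\<omega>. complex_of_real (Z \<omega>) * iexp (s * Z \<omega>)))"
      unfolding err[abs_def] by (simp only: Bochner_Integration.integral_diff[OF ie[of y] ia] Bochner_Integration.integral_add[OF ie[of s] im] integral_mult_right_zero)
    have "cmod (expectation err) \<le> expectation (\<lambda>\<omega>. cmod (err \<omega>))" by (rule integral_norm_bound)
    also have "\<dots> \<le> expectation (\<lambda>\<omega>. ?h\<^sup>2 / 2 * (Z \<omega>)\<^sup>2)"
    proof (rule integral_mono_AE')
      show "integrable M (\<lambda>\<omega>. ?h\<^sup>2 / 2 * (Z \<omega>)\<^sup>2)" using Z2 by simp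
      have "cmod (err \<omega>) \<le> ?h\<^sup>2 / 2 * (Z \<omega>)\<^sup>2" for \<omega>
        using iexp_approx1[of "?h * Z \<omega>" 1] unfolding err_def norm_mult norm_exp_i_times
        by (simp add: numeral_2_eq_2[symmetric] abs_mult power_mult_distrib)
      then show "AE \<omega> in M. cmod (err \<omega>) \<le> ?h\<^sup>2 / 2 * (Z \<omega>)\<^sup>2" by simp
    qed auto
    also have "\<dots> = \<bar>?h\<bar> * (expectation (\<lambda>\<omega>. (Z \<omega>)\<^sup>2) / 2) * \<bar>?h\<bar>"
    proof -
      have "?h\<^sup>2 = \<bar>?h\<bar> * \<bar>?h\<bar>" by (simp add: power2_eq_square)
      then show ?thesis by (simp only: integral_mult_right_zero) simp
    qed
    finally show "norm (expectation (\<lambda>\<omega>. iexp (y * Z \<omega>)) - expectation (\<lambda>\<omega>. iexp (s * Z \<omega>))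
        - ?h *\<^sub>R (\<i> * expectation (\<lambda>\<omega>. complex_of_real (Z \<omega>) * iexp (s * Z \<omega>)))) / norm ?h
       \<le> \<bar>?h\<bar> * (expectation (\<lambda>\<omega>. (Z \<omega>)\<^sup>2) / 2)"
      using \<open>y \<noteq> s\<close> unfolding ierr scaleR_conv_of_real
      by (subst divide_le_eq) (simp add: algebra_simps del: of_real_diff)
  qed simp_all
qed

lemma (in prob_space) expectation_abs_le_sqrt:
  fixes Z :: "'a \<Rightarrow> real"
  assumes "integrable M Z" "integrable M (\<lambda>x. (Z x)\<^sup>2)"
  shows "expectation (\<lambda>x. \<bar>Z x\<bar>) \<le> sqrt (expectation (\<lambda>x. (Z x)\<^sup>2))"
proof -
  have "0 \<le> variance (\<lambda>x. \<bar>Z x\<bar>)" by (rule variance_positive)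
  also have "\<dots> = expectation (\<lambda>x. (Z x)\<^sup>2) - (expectation (\<lambda>x. \<bar>Z x\<bar>))\<^sup>2"
    using assms by (subst variance_eq) auto
  finally show ?thesis by (intro real_le_rsqrt) simp
qed

context gaussian_space
begin

text \<open>Of the three Wick pairings one cancels against the product of the means, and the other
  two coincide.\<close>

lemma expectation_centered_squares:
  assumes "X \<in> S" "Y \<in> S"
  shows "expectation (\<lambda>z. ((X z)\<^sup>2 - expectation (\<lambda>z. (X z)\<^sup>2)) * ((Y z)\<^sup>2 - expectation (\<lambda>z. (Y z)\<^sup>2)))
    = 2 * (expectation (\<lambda>z. X z * Y z))\<^sup>2"
    and "integrable M (\<lambda>z. ((X z)\<^sup>2 - expectation (\<lambda>z. (X z)\<^sup>2)) * ((Y z)\<^sup>2 - expectation (\<lambda>z. (Y z)\<^sup>2)))"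
proof -
  define x where "x = expectation (\<lambda>z. (X z)\<^sup>2)"
  define y where "y = expectation (\<lambda>z. (Y z)\<^sup>2)"
  note i = wick4(1)[OF assms(1,1,2,2)] integrable_power[OF assms(1), of 2] integrable_power[OF assms(2), of 2]
  have eq: "((X z)\<^sup>2 - x) * ((Y z)\<^sup>2 - y)
     = X z * X z * Y z * Y z - y * (X z)\<^sup>2 - x * (Y z)\<^sup>2 + x * y" for z
    by (simp add: power2_eq_square algebra_simps)
  have "expectation (\<lambda>z. ((X z)\<^sup>2 - x) * ((Y z)\<^sup>2 - y))
      = expectation (\<lambda>z. X z * X z * Y z * Y z) - y * x - x * y + x * y"
    unfolding eq using i by (simp add: prob_space x_def[symmetric] y_def[symmetric])
  also have "\<dots> = 2 * (expectation (\<lambda>z. X z * Y z))\<^sup>2"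
    unfolding wick4(2)[OF assms(1,1,2,2)] by (simp add: x_def y_def power2_eq_square)
  finally show "expectation (\<lambda>z. ((X z)\<^sup>2 - expectation (\<lambda>z. (X z)\<^sup>2)) * ((Y z)\<^sup>2 - expectation (\<lambda>z. (Y z)\<^sup>2)))
    = 2 * (expectation (\<lambda>z. X z * Y z))\<^sup>2" unfolding x_def y_def .
  show "integrable M (\<lambda>z. ((X z)\<^sup>2 - expectation (\<lambda>z. (X z)\<^sup>2)) * ((Y z)\<^sup>2 - expectation (\<lambda>z. (Y z)\<^sup>2)))"
    unfolding x_def[symmetric] y_def[symmetric] eq using i by simp
qed

lemma variance_quad:
  fixes w :: "'i \<Rightarrow> real"
  assumes I: "finite I" and Y: "\<And>l. l \<in> I \<Longrightarrow> Y l \<in> S"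
  defines "q \<equiv> \<lambda>x. \<Sum>l\<in>I. w l * (Y l x)\<^sup>2"
  shows "variance q = 2 * (\<Sum>l\<in>I. \<Sum>m\<in>I. w l * w m * (expectation (\<lambda>x. Y l x * Y m x))\<^sup>2)"
proof -
  have "expectation q = (\<Sum>l\<in>I. w l * expectation (\<lambda>x. (Y l x)\<^sup>2))"
    unfolding q_def using integrable_power[OF Y] by (subst Bochner_Integration.integral_sum) auto
  then have "(q x - expectation q)\<^sup>2 = (\<Sum>l\<in>I. \<Sum>m\<in>I. w l * w m * (((Y l x)\<^sup>2 - expectation (\<lambda>x. (Y l x)\<^sup>2))
      * ((Y m x)\<^sup>2 - expectation (\<lambda>x. (Y m x)\<^sup>2))))" for x
    unfolding q_def power2_eq_square[of "_ - _"]
    by (simp only: sum_subtractf[symmetric] right_diff_distrib[symmetric] sum_product) (simp only: mult_ac)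
  then have "variance q = (\<Sum>l\<in>I. \<Sum>m\<in>I. w l * w m * expectation (\<lambda>x. ((Y l x)\<^sup>2 - expectation (\<lambda>x. (Y l x)\<^sup>2))
      * ((Y m x)\<^sup>2 - expectation (\<lambda>x. (Y m x)\<^sup>2))))"
    using expectation_centered_squares(2)[OF Y Y] by (simp only: integral_double_sum(2))
  also have "\<dots> = (\<Sum>l\<in>I. \<Sum>m\<in>I. 2 * (w l * w m * (expectation (\<lambda>x. Y l x * Y m x))\<^sup>2))"
    by (intro sum.cong refl) (simp add: expectation_centered_squares(1)[OF Y Y])
  finally show ?thesis by (simp add: sum_distrib_left)
qed

text \<open>The pairs \<open>ab\<close>, \<open>ac\<close>, \<open>bd\<close> form a path from
  \<open>c\<close> over \<open>a\<close> and \<open>b\<close> to \<open>d\<close>. Summing over its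
  two ends and then over \<open>b\<close> costs a factor \<open>K\<close> each time, and the last
  free index \<open>a\<close> costs \<open>card I\<close>. The constant \<open>R\<close> stands for
  the fourth covariance that would close the cycle.\<close>

lemma sum_pairs_le:
  fixes r :: "'i \<Rightarrow> 'i \<Rightarrow> real"
  assumes K: "\<And>l. l \<in> I \<Longrightarrow> (\<Sum>m\<in>I. \<bar>r l m\<bar>) \<le> K"
    and x: "\<And>a b c d. a \<in> I \<Longrightarrow> b \<in> I \<Longrightarrow> c \<in> I \<Longrightarrow> d \<in> I \<Longrightarrow>
      \<bar>x a b c d\<bar> \<le> C * \<bar>r a b\<bar> * \<bar>r a c\<bar> * \<bar>r b d\<bar> * R"
    and C: "0 \<le> C" "0 \<le> R" "0 \<le> K"
  shows "\<bar>\<Sum>a\<in>I. \<Sum>b\<in>I. \<Sum>c\<in>I. \<Sum>d\<in>I. x a b c d\<bar> \<le> real (card I) * (C * R * K ^ 3)"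
proof -
  have "\<bar>\<Sum>a\<in>I. \<Sum>b\<in>I. \<Sum>c\<in>I. \<Sum>d\<in>I. x a b c d\<bar> \<le> (\<Sum>a\<in>I. \<Sum>b\<in>I. \<Sum>c\<in>I. \<Sum>d\<in>I. \<bar>x a b c d\<bar>)"
    by (intro order.trans[OF sum_abs] sum_mono order.refl)
  also have "\<dots> \<le> (\<Sum>a\<in>I. \<Sum>b\<in>I. \<Sum>c\<in>I. \<Sum>d\<in>I. (C * R * \<bar>r a b\<bar>) * (\<bar>r a c\<bar> * \<bar>r b d\<bar>))"
    by (intro sum_mono order.trans[OF x]) (auto simp: mult_ac)
  also have "\<dots> = (\<Sum>a\<in>I. \<Sum>b\<in>I. (C * R * \<bar>r a b\<bar>) * ((\<Sum>c\<in>I. \<bar>r a c\<bar>) * (\<Sum>d\<in>I. \<bar>r b d\<bar>)))"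
    unfolding sum_product unfolding sum_distrib_left ..
  also have "\<dots> \<le> (\<Sum>a\<in>I. \<Sum>b\<in>I. (C * R * \<bar>r a b\<bar>) * (K * K))"
    using K C by (intro sum_mono mult_left_mono mult_mono) (auto intro!: sum_nonneg)
  also have "\<dots> = (\<Sum>a\<in>I. (C * R * (K * K)) * (\<Sum>b\<in>I. \<bar>r a b\<bar>))"
    by (simp only: sum_distrib_left mult_ac)
  also have "\<dots> \<le> (\<Sum>a\<in>I. (C * R * (K * K)) * K)"
    using K C by (intro sum_mono mult_left_mono) auto
  finally show ?thesis by (simp add: power3_eq_cube mult_ac)
qed

text \<open>In the Wick expansion of the square of \<open>G\<close>, pairing inside each factor
  gives the squared mean. The two other pairings agree after exchanging the last two indices, and
  each is a sum of \<open>r\<close> over 4-cycles, which \<open>sum_pairs_le\<close>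
  controls.\<close>

lemma variance_bilinear_le:
  fixes w :: "'i \<Rightarrow> real"
  assumes I: "finite I" and Y: "\<And>l. l \<in> I \<Longrightarrow> Y l \<in> S"
    and w: "\<And>l. l \<in> I \<Longrightarrow> \<bar>w l\<bar> \<le> W"
    and R: "\<And>l m. l \<in> I \<Longrightarrow> m \<in> I \<Longrightarrow> \<bar>expectation (\<lambda>x. Y l x * Y m x)\<bar> \<le> R"
    and K: "\<And>l. l \<in> I \<Longrightarrow> (\<Sum>m\<in>I. \<bar>expectation (\<lambda>x. Y l x * Y m x)\<bar>) \<le> K"
    and nonneg: "0 \<le> W" "0 \<le> R" "0 \<le> K"
  defines "G \<equiv> \<lambda>x. \<Sum>l\<in>I. \<Sum>m\<in>I. w l * w m * expectation (\<lambda>x. Y l x * Y m x) * (Y l x * Y m x)"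
  shows "integrable M G" "integrable M (\<lambda>x. (G x)\<^sup>2)"
    "expectation G = (\<Sum>l\<in>I. \<Sum>m\<in>I. w l * w m * (expectation (\<lambda>x. Y l x * Y m x))\<^sup>2)"
    "variance G \<le> 2 * (real (card I) * (W ^ 4 * R * K ^ 3))"
proof -
  define r where "r l m = expectation (\<lambda>x. Y l x * Y m x)" for l m
  note R = R[folded r_def] and K = K[folded r_def] and G_def = G_def[folded r_def]
  have rsym: "r l m = r m l" for l m unfolding r_def by (simp add: mult.commute)
  show iG: "integrable M G" unfolding G_def by (intro integral_double_sum integrable_mult Y)
  have eG: "expectation G = (\<Sum>l\<in>I. \<Sum>m\<in>I. w l * w m * (r l m)\<^sup>2)"
  proof -
    have "expectation G = (\<Sum>l\<in>I. \<Sum>m\<in>I. w l * w m * r l m * r l m)"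
      unfolding G_def r_def[of "_" "_", symmetric]
      by (subst integral_double_sum) (auto intro: integrable_mult Y simp: r_def)
    then show ?thesis by (simp add: power2_eq_square mult_ac)
  qed
  then show "expectation G = (\<Sum>l\<in>I. \<Sum>m\<in>I. w l * w m * (expectation (\<lambda>x. Y l x * Y m x))\<^sup>2)"
    unfolding r_def .
  define c where "c = (\<lambda>(l, m). w l * w m * r l m)"
  define Z where "Z = (\<lambda>(l, m) x. Y l x * Y m x)"
  have G2: "(G x)\<^sup>2 = (\<Sum>p\<in>I \<times> I. \<Sum>p'\<in>I \<times> I. (c p * c p') * (Z p x * Z p' x))" for x
  proof -
    have "G x = (\<Sum>p\<in>I \<times> I. c p * Z p x)"
      unfolding G_def c_def Z_def by (simp add: sum.cartesian_product split_def)
    then show ?thesis by (simp only: power2_eq_square sum_product mult_ac)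
  qed
  have iZ: "integrable M (\<lambda>x. Z p x * Z p' x)" if "p \<in> I \<times> I" "p' \<in> I \<times> I" for p p'
    using that wick4(1)[OF Y Y Y Y] unfolding Z_def by (auto simp: mult.assoc)
  show iG2: "integrable M (\<lambda>x. (G x)\<^sup>2)"
    unfolding G2 by (intro integral_double_sum iZ)
  have "expectation (\<lambda>x. (G x)\<^sup>2) = (\<Sum>p\<in>I \<times> I. \<Sum>p'\<in>I \<times> I. (c p * c p') * expectation (\<lambda>x. Z p x * Z p' x))"
    unfolding G2 by (intro integral_double_sum iZ)
  also have "\<dots> = (\<Sum>a\<in>I. \<Sum>b\<in>I. \<Sum>k\<in>I. \<Sum>d\<in>I. (w a * w b * r a b * (w k * w d * r k d)) *
      expectation (\<lambda>x. (Y a x * Y b x) * (Y k x * Y d x)))"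
    unfolding c_def Z_def by (simp add: sum.cartesian_product')
  also have "\<dots> = (\<Sum>a\<in>I. \<Sum>b\<in>I. \<Sum>k\<in>I. \<Sum>d\<in>I. (w a * w b * r a b * (w k * w d * r k d)) *
      (r a b * r k d + (r a k * r b d + r a d * r b k)))"
    using Y wick4(2)[OF Y Y Y Y] by (intro sum.cong refl) (simp add: mult.assoc[symmetric] r_def)
  also have "\<dots> = (expectation G)\<^sup>2
     + (\<Sum>a\<in>I. \<Sum>b\<in>I. \<Sum>k\<in>I. \<Sum>d\<in>I. (w a * w b * w k * w d) * (r a b * r k d * r a k * r b d))
     + (\<Sum>a\<in>I. \<Sum>b\<in>I. \<Sum>k\<in>I. \<Sum>d\<in>I. (w a * w b * w k * w d) * (r a b * r k d * r a d * r b k))"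
  proof -
    have "(expectation G)\<^sup>2 = (\<Sum>p\<in>I\<times>I. \<Sum>p'\<in>I\<times>I. (w (fst p) * w (snd p) * (r (fst p) (snd p))\<^sup>2) * (w (fst p') * w (snd p') * (r (fst p') (snd p'))\<^sup>2))"
      unfolding eG power2_eq_square[of "sum _ _"] sum_product[symmetric]
      by (simp add: sum.cartesian_product split_def)
    also have "\<dots> = (\<Sum>a\<in>I. \<Sum>b\<in>I. \<Sum>k\<in>I. \<Sum>d\<in>I. (w a * w b * (r a b)\<^sup>2) * (w k * w d * (r k d)\<^sup>2))"
      by (simp add: sum.cartesian_product')
    finally show ?thesis
      by (simp only: sum.distrib[symmetric]) (intro sum.cong refl, simp add: power2_eq_square algebra_simps)
  qed
  finally have EG2: "expectation (\<lambda>x. (G x)\<^sup>2) - (expectation G)\<^sup>2 =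
     (\<Sum>a\<in>I. \<Sum>b\<in>I. \<Sum>k\<in>I. \<Sum>d\<in>I. (w a * w b * w k * w d) * (r a b * r k d * r a k * r b d))
     + (\<Sum>a\<in>I. \<Sum>b\<in>I. \<Sum>k\<in>I. \<Sum>d\<in>I. (w a * w b * w k * w d) * (r a b * r k d * r a d * r b k))"
    by simp
  have W4: "\<bar>w a * w b * w k * w d\<bar> \<le> W ^ 4" if "a \<in> I" "b \<in> I" "k \<in> I" "d \<in> I" for a b k d
  proof -
    have "\<bar>w a * w b * w k * w d\<bar> \<le> W * W * W * W"
      unfolding abs_mult using that w nonneg by (intro mult_mono) auto
    then show ?thesis by (simp add: power4_eq_xxxx)
  qed
  have "\<bar>\<Sum>a\<in>I. \<Sum>b\<in>I. \<Sum>k\<in>I. \<Sum>d\<in>I. (w a * w b * w k * w d) * (r a b * r k d * r a k * r b d)\<bar>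
    \<le> real (card I) * (W ^ 4 * R * K ^ 3)"
  proof (rule sum_pairs_le[of I r K])
    fix a b k d assume abkd: "a \<in> I" "b \<in> I" "k \<in> I" "d \<in> I"
    have "\<bar>(w a * w b * w k * w d) * (r a b * r k d * r a k * r b d)\<bar>
      = \<bar>w a * w b * w k * w d\<bar> * (\<bar>r a b\<bar> * \<bar>r a k\<bar> * \<bar>r b d\<bar> * \<bar>r k d\<bar>)"
      by (simp add: abs_mult mult_ac)
    also have "\<dots> \<le> W ^ 4 * (\<bar>r a b\<bar> * \<bar>r a k\<bar> * \<bar>r b d\<bar> * R)"
      using abkd by (intro mult_mono W4 mult_left_mono R) auto
    finally show "\<bar>(w a * w b * w k * w d) * (r a b * r k d * r a k * r b d)\<bar>
      \<le> W ^ 4 * \<bar>r a b\<bar> * \<bar>r a k\<bar> * \<bar>r b d\<bar> * R" by (simp add: mult_ac)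
  qed (use R K nonneg in auto)
  moreover have "(\<Sum>a\<in>I. \<Sum>b\<in>I. \<Sum>k\<in>I. \<Sum>d\<in>I. (w a * w b * w k * w d) * (r a b * r k d * r a d * r b k))
    = (\<Sum>a\<in>I. \<Sum>b\<in>I. \<Sum>k\<in>I. \<Sum>d\<in>I. (w a * w b * w k * w d) * (r a b * r k d * r a k * r b d))"
    by (rule sum.cong[OF refl], rule sum.cong[OF refl], subst sum.swap, intro sum.cong refl)
      (simp add: rsym mult_ac)
  ultimately show "variance G \<le> 2 * (real (card I) * (W ^ 4 * R * K ^ 3))"
    using EG2 variance_eq[OF iG iG2] by linarith
qed

text \<open>By Stein's identity the transform \<phi> of the centred form almost solves the Gaussian
  equation \<open>\<phi>' s = - s * v * \<phi> s\<close>. After multiplication by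
  \<open>exp (s\<^sup>2 * v / 2)\<close> the derivative only contains the defect
  \<open>G - v / 2\<close>. As \<open>v / 2\<close> is the mean of \<open>G\<close>, the first
  absolute moment of the defect is at most the standard deviation of \<open>G\<close>.\<close>

lemma char_quad_bound:
  fixes w :: "'i \<Rightarrow> real"
  assumes I: "finite I" and Y: "\<And>l. l \<in> I \<Longrightarrow> Y l \<in> S"
    and w: "\<And>l. l \<in> I \<Longrightarrow> \<bar>w l\<bar> \<le> W"
    and R: "\<And>l m. l \<in> I \<Longrightarrow> m \<in> I \<Longrightarrow> \<bar>expectation (\<lambda>z. Y l z * Y m z)\<bar> \<le> R"
    and K: "\<And>l. l \<in> I \<Longrightarrow> (\<Sum>m\<in>I. \<bar>expectation (\<lambda>z. Y l z * Y m z)\<bar>) \<le> K"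
    and nonneg: "0 \<le> W" "0 \<le> R" "0 \<le> K"
  defines "q \<equiv> \<lambda>z. \<Sum>l\<in>I. w l * (Y l z)\<^sup>2"
  shows "cmod (expectation (\<lambda>z. iexp (\<sigma> * (q z - expectation q))) - exp (- (\<sigma>\<^sup>2 * variance q / 2)))
    \<le> 2 * \<sigma>\<^sup>2 * sqrt (2 * (real (card I) * (W ^ 4 * R * K ^ 3)))"
proof -
  define G where "G z = (\<Sum>l\<in>I. \<Sum>m\<in>I. w l * w m * expectation (\<lambda>z. Y l z * Y m z) * (Y l z * Y m z))" for z
  note G = variance_bilinear_le[of I Y w W R K, OF I Y w R K nonneg, folded G_def]
  define \<mu> where "\<mu> = expectation q"
  define v where "v = variance q"
  define d where "d = sqrt (2 * (real (card I) * (W ^ 4 * R * K ^ 3)))"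
  have EG: "expectation G = v / 2"
    unfolding v_def q_def by (subst variance_quad[OF I Y]) (simp_all add: G(3))
  have v0: "0 \<le> v" unfolding v_def by (rule variance_positive)
  have iq: "integrable M q" "integrable M (\<lambda>z. (q z)\<^sup>2)"
    unfolding q_def using integrable_quad[OF I Y] by auto
  have [measurable]: "q \<in> borel_measurable M" "G \<in> borel_measurable M" using iq(1) G(1) by auto
  define e where "e s z = iexp (s * (q z - \<mu>))" for s z
  have [measurable]: "e s \<in> borel_measurable M" for s unfolding e_def by measurable
  have ie: "integrable M (\<lambda>z. complex_of_real (f z) * e s z)" if f: "integrable M f" for f s
    by (rule Bochner_Integration.integrable_bound[OF f]) (use f in \<open>auto simp: e_def norm_mult simp del: of_real_diff\<close>)
  define \<phi> where "\<phi> s = expectation (e s)" for s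
  have e_split: "e s z = iexp (- s * \<mu>) * iexp (s * q z)" for s z
    unfolding e_def by (simp add: exp_add[symmetric] algebra_simps)
  have stein: "expectation (\<lambda>z. complex_of_real (q z - \<mu>) * e s z) = 2 * \<i> * s * expectation (\<lambda>z. complex_of_real (G z) * e s z)" for s
  proof -
    have pull: "expectation (\<lambda>z. f z * e s z) = iexp (- s * \<mu>) * expectation (\<lambda>z. f z * iexp (s * q z))" for f
      unfolding e_split Bochner_Integration.integral_mult_right_zero[symmetric]
      by (intro Bochner_Integration.integral_cong refl) (simp only: mult_ac)
    have st: "expectation (\<lambda>z. complex_of_real (q z - \<mu>) * iexp (s * q z)) =
       2 * \<i> * s * expectation (\<lambda>z. complex_of_real (G z) * iexp (s * q z))"
      using stein_quad[OF I Y, where w = w and \<sigma> = s] unfolding \<mu>_def q_def G_def by simp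
    show ?thesis unfolding pull st by (simp only: mult_ac)
  qed
  define \<phi>' where "\<phi>' s = - 2 * complex_of_real s * expectation (\<lambda>z. complex_of_real (G z) * e s z)" for s
  have d\<phi>: "(\<phi> has_vector_derivative \<phi>' s) (at s)" for s
  proof -
    have "((\<lambda>s. expectation (\<lambda>z. iexp (s * (q z - \<mu>)))) has_vector_derivative
       \<i> * expectation (\<lambda>z. complex_of_real (q z - \<mu>) * iexp (s * (q z - \<mu>)))) (at s)"
    proof (rule char_has_vector_derivative)
      have "(q z - \<mu>)\<^sup>2 = (q z)\<^sup>2 - 2 * \<mu> * q z + \<mu>\<^sup>2" for z by (simp add: power2_eq_square algebra_simps)
      then show "integrable M (\<lambda>z. (q z - \<mu>)\<^sup>2)" using iq by simp
    qed (use iq in auto)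
    moreover have "\<phi>' s = \<i> * expectation (\<lambda>z. complex_of_real (q z - \<mu>) * e s z)"
    proof -
      have alg: "- 2 * c * x = \<i> * (2 * \<i> * c * x)" for c x :: complex
      proof -
        have "\<i> * (2 * \<i> * c * x) = (\<i> * \<i>) * (2 * c * x)" by (simp only: mult_ac)
        then show ?thesis by (simp only: i_squared) simp
      qed
      show ?thesis unfolding stein \<phi>'_def by (rule alg)
    qed
    ultimately show ?thesis
      unfolding \<phi>_def[abs_def] e_def[abs_def] by (simp only:)
  qed
  define \<psi> where "\<psi> s = complex_of_real (exp (s\<^sup>2 * v / 2)) * \<phi> s" for s
  define \<psi>' where "\<psi>' s = complex_of_real (exp (s\<^sup>2 * v / 2)) * \<phi>' s + complex_of_real (s * v * exp (s\<^sup>2 * v / 2)) * \<phi> s" for s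
  have d\<psi>: "(\<psi> has_vector_derivative \<psi>' s) (at s)" for s
    unfolding \<psi>_def[abs_def] \<psi>'_def
    by (intro has_vector_derivative_mult has_vector_derivative_of_real d\<phi>)
       (auto intro!: derivative_eq_intros)
  have b\<psi>: "cmod (\<psi>' s) \<le> 2 * \<bar>\<sigma>\<bar> * exp (\<sigma>\<^sup>2 * v / 2) * d" if s: "s \<in> {-\<bar>\<sigma>\<bar>..\<bar>\<sigma>\<bar>}" for s
  proof -
    have "\<psi>' s = complex_of_real (exp (s\<^sup>2 * v / 2) * (- 2 * s)) *
       (expectation (\<lambda>z. complex_of_real (G z) * e s z) - complex_of_real (v / 2) * \<phi> s)"
      unfolding \<psi>'_def \<phi>'_def by (simp add: algebra_simps)
    also have "expectation (\<lambda>z. complex_of_real (G z) * e s z) - complex_of_real (v / 2) * \<phi> s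
       = expectation (\<lambda>z. complex_of_real (G z - v / 2) * e s z)"
    proof -
      have "expectation (\<lambda>z. complex_of_real (G z - v / 2) * e s z)
         = expectation (\<lambda>z. complex_of_real (G z) * e s z - complex_of_real (v / 2) * e s z)"
        by (simp only: of_real_diff left_diff_distrib)
      also have "\<dots> = expectation (\<lambda>z. complex_of_real (G z) * e s z) - expectation (\<lambda>z. complex_of_real (v / 2) * e s z)"
        by (rule Bochner_Integration.integral_diff) (rule ie, use G in simp)+
      finally show ?thesis unfolding \<phi>_def by simp
    qed
    finally have eq: "cmod (\<psi>' s) = exp (s\<^sup>2 * v / 2) * (2 * \<bar>s\<bar>) * cmod (expectation (\<lambda>z. complex_of_real (G z - v / 2) * e s z))"
      by (simp only: norm_mult norm_of_real abs_mult) simp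
    have "cmod (expectation (\<lambda>z. complex_of_real (G z - v / 2) * e s z)) \<le> expectation (\<lambda>z. \<bar>G z - v / 2\<bar>)"
      by (rule order.trans[OF integral_norm_bound]) (simp add: norm_mult e_def del: of_real_diff)
    also have "\<dots> \<le> sqrt (expectation (\<lambda>z. (G z - v / 2)\<^sup>2))"
    proof (rule expectation_abs_le_sqrt)
      have "(G z - v / 2)\<^sup>2 = (G z)\<^sup>2 - v * G z + (v / 2)\<^sup>2" for z by (simp add: power2_eq_square algebra_simps)
      then show "integrable M (\<lambda>z. (G z - v / 2)\<^sup>2)" using G by simp
    qed (use G in auto)
    also have "\<dots> \<le> d"
      unfolding d_def using G(4) by (simp add: EG)
    finally have 1: "cmod (expectation (\<lambda>z. complex_of_real (G z - v / 2) * e s z)) \<le> d" .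
    have "s\<^sup>2 \<le> \<sigma>\<^sup>2" using s by (auto simp: abs_le_square_iff[symmetric])
    then have 2: "exp (s\<^sup>2 * v / 2) \<le> exp (\<sigma>\<^sup>2 * v / 2)" using v0 by (simp add: mult_right_mono)
    have "cmod (\<psi>' s) \<le> exp (\<sigma>\<^sup>2 * v / 2) * (2 * \<bar>\<sigma>\<bar>) * d"
      unfolding eq using s by (intro mult_mono 1 2) auto
    then show ?thesis by (simp add: mult_ac)
  qed
  have "cmod (\<psi> \<sigma> - \<psi> 0) \<le> (2 * \<bar>\<sigma>\<bar> * exp (\<sigma>\<^sup>2 * v / 2) * d) * norm (\<sigma> - 0)"
    by (rule norm_diff_le_of_vector_derivative[of "{-\<bar>\<sigma>\<bar>..\<bar>\<sigma>\<bar>}" \<psi> \<psi>'])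
      (auto intro: has_vector_derivative_at_within d\<psi> b\<psi>)
  moreover have "\<psi> 0 = 1" unfolding \<psi>_def \<phi>_def e_def by (simp add: prob_space)
  moreover have "\<phi> \<sigma> - exp (- (\<sigma>\<^sup>2 * v / 2)) = complex_of_real (exp (- (\<sigma>\<^sup>2 * v / 2))) * (\<psi> \<sigma> - 1)"
    unfolding \<psi>_def right_diff_distrib mult.assoc[symmetric] of_real_mult[symmetric]
    by (simp add: exp_add[symmetric] del: of_real_mult)
  \<comment> \<open>The growth of the integrating factor over the interval cancels against the
    factor reintroduced here, so no exponential of the variance survives in the bound.\<close>
  ultimately have "cmod (\<phi> \<sigma> - exp (- (\<sigma>\<^sup>2 * v / 2))) \<le> exp (- (\<sigma>\<^sup>2 * v / 2)) * ((2 * \<bar>\<sigma>\<bar> * exp (\<sigma>\<^sup>2 * v / 2) * d) * \<bar>\<sigma>\<bar>)"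
    by (simp add: norm_mult)
  also have "\<dots> = (exp (- (\<sigma>\<^sup>2 * v / 2)) * exp (\<sigma>\<^sup>2 * v / 2)) * (2 * (\<bar>\<sigma>\<bar> * \<bar>\<sigma>\<bar>) * d)" by (simp only: mult_ac)
  also have "\<dots> = 2 * \<sigma>\<^sup>2 * d" by (simp add: exp_add[symmetric] power2_eq_square)
  finally show ?thesis unfolding \<phi>_def e_def \<mu>_def v_def d_def .
qed

end

section \<open>Fractional Brownian motion with small Hurst index\<close>

text \<open>The covariance of the fBm increments from \<open>s\<close> to \<open>t\<close> and from
  \<open>s'\<close> to \<open>t'\<close>, see \<open>expectation_increments\<close>. In this form
  translation invariance and additivity in each interval can be read off.\<close>

definition fbm_cov :: "real \<Rightarrow> real \<Rightarrow> real \<Rightarrow> real \<Rightarrow> real \<Rightarrow> real" where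
  "fbm_cov H s t s' t' = (\<bar>t - s'\<bar> powr (2 * H) + \<bar>s - t'\<bar> powr (2 * H)
     - \<bar>t - t'\<bar> powr (2 * H) - \<bar>s - s'\<bar> powr (2 * H)) / 2"

definition fbm_span :: "(real \<Rightarrow> 'a \<Rightarrow> real) \<Rightarrow> ('a \<Rightarrow> real) set" where
  "fbm_span B = {X. \<exists>J c. finite J \<and> J \<subseteq> {0..} \<and> X = (\<lambda>x. \<Sum>t\<in>J. c t * B t x)}"

lemma fbm_spanI: "finite J \<Longrightarrow> J \<subseteq> {0..} \<Longrightarrow> (\<lambda>x. \<Sum>t\<in>J. c t * B t x) \<in> fbm_span B"
  unfolding fbm_span_def by blast

lemma mem_fbm_span: "0 \<le> t \<Longrightarrow> B t \<in> fbm_span B"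
  using fbm_spanI[of "{t}" "\<lambda>_. 1" B] by simp

locale fbm_space = prob_space M for M :: "'a measure" +
  fixes H :: real and B :: "real \<Rightarrow> 'a \<Rightarrow> real"
  assumes fbm: "fractional_brownian_motion H B" and H_less: "H < 1 / 2"
begin

lemma H_pos: "0 < H" using fbm by (simp add: fractional_brownian_motion_def)

lemma fbm_measurable: "0 \<le> t \<Longrightarrow> B t \<in> borel_measurable M"
  using fbm by (simp add: fractional_brownian_motion_def gaussian_process_def)

end

text \<open>\<open>gaussian_process\<close> leaves the mean of a linear combination open. The zero
  mean of the fBm forces \<open>\<mu> = 0\<close> in each such law, which is what a centred Gaussian
  space requires.\<close>

sublocale fbm_space \<subseteq> gaussian_space M "fbm_span B"
proof
  show "(\<lambda>z. 0) \<in> fbm_span B" using fbm_spanI[of "{}" _ B] by simp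
  show "(\<lambda>z. X z + Y z) \<in> fbm_span B" if X: "X \<in> fbm_span B" and Y: "Y \<in> fbm_span B" for X Y
  proof -
    obtain J c where J: "finite J" "J \<subseteq> {0..}" "X = (\<lambda>z. \<Sum>t\<in>J. c t * B t z)"
      using X unfolding fbm_span_def by blast
    obtain K d where K: "finite K" "K \<subseteq> {0..}" "Y = (\<lambda>z. \<Sum>t\<in>K. d t * B t z)"
      using Y unfolding fbm_span_def by blast
    have "(\<Sum>t\<in>J. c t * B t z) = (\<Sum>t\<in>J \<union> K. (if t \<in> J then c t else 0) * B t z)"
      "(\<Sum>t\<in>K. d t * B t z) = (\<Sum>t\<in>J \<union> K. (if t \<in> K then d t else 0) * B t z)" for z
      using J(1) K(1) by (auto intro!: sum.mono_neutral_cong_left)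
    then have "(\<lambda>z. X z + Y z) = (\<lambda>z. \<Sum>t\<in>J \<union> K. ((if t \<in> J then c t else 0) + (if t \<in> K then d t else 0)) * B t z)"
      unfolding J(3) K(3) distrib_right sum.distrib by simp
    then show ?thesis using fbm_spanI[of "J \<union> K" _ B] J K by simp
  qed
  show "(\<lambda>z. c * X z) \<in> fbm_span B" if X: "X \<in> fbm_span B" for X c
  proof -
    obtain J d where J: "finite J" "J \<subseteq> {0..}" "X = (\<lambda>z. \<Sum>t\<in>J. d t * B t z)"
      using X unfolding fbm_span_def by blast
    have "(\<lambda>z. c * X z) = (\<lambda>z. \<Sum>t\<in>J. (c * d t) * B t z)"
      unfolding J(3) by (simp add: sum_distrib_left mult.assoc)
    then show ?thesis using fbm_spanI[OF J(1,2)] by simp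
  qed
  show "random_variable borel X" if X: "X \<in> fbm_span B" for X
    using X fbm_measurable by (auto simp: fbm_span_def subset_eq intro!: borel_measurable_sum)
  show "\<exists>\<sigma>. distr M borel X = normal_law 0 \<sigma>" if X: "X \<in> fbm_span B" for X
  proof -
    have law: "\<exists>\<mu> \<sigma>. distr M borel (\<lambda>z. \<Sum>t\<in>J. c t * B t z) = normal_law \<mu> \<sigma>" if "finite J" "J \<subseteq> {0..}" for J c
      using fbm that by (auto simp: fractional_brownian_motion_def gaussian_process_def)
    have int: "integrable M (B t)" if "0 \<le> t" for t
    proof -
      obtain \<mu> \<sigma> where "distr M borel (B t) = normal_law \<mu> \<sigma>" using law[of "{t}" "\<lambda>_. 1"] \<open>0 \<le> t\<close> by auto
      then have "integrable (distr M borel (B t)) (\<lambda>x. x)"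
        using integrable_normal_law_power[of \<mu> \<sigma> 1] by simp
      then show ?thesis using fbm_measurable[OF that] by (subst (asm) integrable_distr_eq) auto
    qed
    obtain J c where J: "finite J" "J \<subseteq> {0..}" "X = (\<lambda>z. \<Sum>t\<in>J. c t * B t z)"
      using X unfolding fbm_span_def by blast
    obtain \<mu> \<sigma> where ms: "distr M borel X = normal_law \<mu> \<sigma>" using law[OF J(1,2)] J(3) by blast
    have [measurable]: "X \<in> borel_measurable M"
      using fbm_measurable J by (auto simp: subset_eq intro!: borel_measurable_sum)
    have "\<mu> = expectation X"
      using integral_normal_law_id[of \<mu> \<sigma>] unfolding ms[symmetric] by (subst (asm) integral_distr) auto
    also have "\<dots> = (\<Sum>t\<in>J. c t * expectation (B t))"
      unfolding J(3) using J(2) int by (subst Bochner_Integration.integral_sum) auto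
    also have "\<dots> = 0"
      using fbm J(2) by (intro sum.neutral) (auto simp: fractional_brownian_motion_def)
    finally show ?thesis using ms by auto
  qed
qed

context fbm_space
begin

lemma increment_mem: "0 \<le> s \<Longrightarrow> 0 \<le> t \<Longrightarrow> (\<lambda>x. B t x - B s x) \<in> fbm_span B"
  by (intro diff_mem mem_fbm_span)

lemma expectation_increments:
  assumes "0 \<le> s" "0 \<le> t" "0 \<le> s'" "0 \<le> t'"
  shows "expectation (\<lambda>x. (B t x - B s x) * (B t' x - B s' x)) = fbm_cov H s t s' t'"
proof -
  have c: "expectation (\<lambda>x. B t x * B s x) = 1 / 2 * (t powr (2 * H) + s powr (2 * H) - \<bar>t - s\<bar> powr (2 * H))"
    if "0 \<le> s" "0 \<le> t" for s t using fbm that by (auto simp: fractional_brownian_motion_def)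
  have i: "integrable M (\<lambda>x. B s x * B t x)" if "0 \<le> s" "0 \<le> t" for s t
    using that by (intro integrable_mult mem_fbm_span)
  have "expectation (\<lambda>x. (B t x - B s x) * (B t' x - B s' x)) =
     expectation (\<lambda>x. B t x * B t' x - B t x * B s' x - (B s x * B t' x - B s x * B s' x))"
    by (simp add: algebra_simps)
  also have "\<dots> = expectation (\<lambda>x. B t x * B t' x) - expectation (\<lambda>x. B t x * B s' x)
     - (expectation (\<lambda>x. B s x * B t' x) - expectation (\<lambda>x. B s x * B s' x))"
    using assms i by simp
  also have "\<dots> = fbm_cov H s t s' t'"
    using assms by (simp add: c fbm_cov_def field_simps abs_minus_commute)
  finally show ?thesis .
qed

text \<open>Self-similarity. Taking the mesh of an observation grid for \<kappa> moves that grid to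
  the integers, so that one set of covariance estimates serves every level.\<close>

lemma fbm_scaled:
  assumes "0 < \<kappa>"
  shows "fbm_space M H (\<lambda>t x. \<kappa> powr (- H) * B (\<kappa> * t) x)"
proof unfold_locales
  let ?B = "\<lambda>t x. \<kappa> powr (- H) * B (\<kappa> * t) x"
  have m: "random_variable borel (?B t)" if "0 \<le> t" for t
    using fbm_measurable[of "\<kappa> * t"] that assms by simp
  have law: "\<exists>\<mu> \<sigma>. distr M borel (\<lambda>x. \<Sum>t\<in>J. c t * ?B t x) = normal_law \<mu> \<sigma>" if J: "finite J" "J \<subseteq> {0..}" for J c
  proof -
    have "(\<lambda>x. \<Sum>t\<in>J. c t * ?B t x) \<in> fbm_span B"
      using J assms by (intro sum_mem scale_mem mem_fbm_span) auto
    then show ?thesis using normal by blast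
  qed
  have mean: "expectation (?B t) = 0" if "0 \<le> t" for t
    using fbm assms that by (auto simp: fractional_brownian_motion_def)
  have cov: "expectation (\<lambda>x. ?B t x * ?B s x) =
        1 / 2 * (t powr (2 * H) + s powr (2 * H) - \<bar>t - s\<bar> powr (2 * H))" if "0 \<le> s" "0 \<le> t" for s t
  proof -
    have "expectation (\<lambda>x. ?B t x * ?B s x) = expectation (\<lambda>x. (\<kappa> powr (- H) * \<kappa> powr (- H)) * (B (\<kappa> * t) x * B (\<kappa> * s) x))"
      by (simp add: mult_ac)
    also have "\<dots> = \<kappa> powr (- 2 * H) * expectation (\<lambda>x. B (\<kappa> * t) x * B (\<kappa> * s) x)"
      by (simp add: powr_add[symmetric])
    also have "expectation (\<lambda>x. B (\<kappa> * t) x * B (\<kappa> * s) x)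
       = 1 / 2 * ((\<kappa> * t) powr (2 * H) + (\<kappa> * s) powr (2 * H) - \<bar>\<kappa> * t - \<kappa> * s\<bar> powr (2 * H))"
      using fbm that assms by (simp add: fractional_brownian_motion_def)
    also have "\<bar>\<kappa> * t - \<kappa> * s\<bar> = \<kappa> * \<bar>t - s\<bar>"
      using assms by (simp add: right_diff_distrib[symmetric] abs_mult)
    also have "\<kappa> powr (- 2 * H) * (1 / 2 * ((\<kappa> * t) powr (2 * H) + (\<kappa> * s) powr (2 * H) - (\<kappa> * \<bar>t - s\<bar>) powr (2 * H)))
      = (\<kappa> powr (- 2 * H) * \<kappa> powr (2 * H)) * (1 / 2 * (t powr (2 * H) + s powr (2 * H) - \<bar>t - s\<bar> powr (2 * H)))"
      using that assms by (simp add: powr_mult algebra_simps)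
    also have "\<kappa> powr (- 2 * H) * \<kappa> powr (2 * H) = 1"
      using assms by (simp add: powr_add[symmetric])
    finally show ?thesis by simp
  qed
  have "gaussian_process {0..} ?B"
    unfolding gaussian_process_def using m law by (intro conjI ballI allI impI) blast+
  then show "fractional_brownian_motion H ?B"
    unfolding fractional_brownian_motion_def
  proof (intro conjI allI impI)
    show "expectation (?B t) = 0" if "0 \<le> t" for t by (rule mean[OF that])
    show "expectation (\<lambda>x. ?B t x * ?B s x) =
        1 / 2 * (t powr (2 * H) + s powr (2 * H) - \<bar>t - s\<bar> powr (2 * H))" if "0 \<le> s" "0 \<le> t" for s t
      by (rule cov[OF that])
  qed (use H_pos H_less in simp_all)
  show "H < 1 / 2" by (rule H_less)
qed

end

section \<open>Autocovariances of fractional Gaussian noise\<close>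

definition fgn_cov :: "real \<Rightarrow> nat \<Rightarrow> real" where
  "fgn_cov H j = (real (j + 1) powr (2 * H) + \<bar>real j - 1\<bar> powr (2 * H) - 2 * real j powr (2 * H)) / 2"

text \<open>Truncated subtraction makes \<open>(p - q) + (q - p)\<close> the distance of two grid
  cells. Stationarity leaves only this distance, and self-similarity accounts for the power of
  \<delta>.\<close>

lemma fbm_cov_grid:
  assumes "0 < \<delta>"
  shows "fbm_cov H (real p * \<delta>) (real (p + 1) * \<delta>) (real q * \<delta>) (real (q + 1) * \<delta>)
    = \<delta> powr (2 * H) * fgn_cov H ((p - q) + (q - p))"
proof -
  have 1: "\<bar>x * \<delta> - y * \<delta>\<bar> powr (2 * H) = \<delta> powr (2 * H) * \<bar>x - y\<bar> powr (2 * H)" for x y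
    using assms by (simp add: left_diff_distrib[symmetric] abs_mult powr_mult)
  show ?thesis
  proof (cases "q \<le> p")
    case True
    then obtain k where k: "p = q + k" by (auto simp: le_iff_add)
    have "\<bar>real k - 1\<bar> = \<bar>real q + real k - (1 + real q)\<bar>" by simp
    then show ?thesis
      unfolding fbm_cov_def 1 fgn_cov_def k by (simp add: algebra_simps)
  next
    case False
    then obtain k where k: "q = p + k" by (metis le_iff_add nat_le_linear)
    have "\<bar>real k - 1\<bar> = \<bar>real p + 1 - (real p + real k)\<bar>" by simp
    then show ?thesis
      unfolding fbm_cov_def 1 fgn_cov_def k by (simp add: algebra_simps)
  qed
qed

text \<open>Bernoulli's inequality for exponents below 1: Young's inequality for the numbers
  \<open>1 + t\<close> and 1 with weights \<open>a\<close> and \<open>1 - a\<close>. At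
  \<open>t = -1\<close> the base is 0.\<close>

lemma powr_Bernoulli_le:
  fixes a t :: real
  assumes "0 < a" "a < 1" "-1 \<le> t"
  shows "(1 + t) powr a \<le> 1 + a * t"
proof (cases "t = -1")
  case False
  have "(1 + t) powr a * 1 powr (1 - a) \<le> a * (1 + t) + (1 - a) * 1"
    by (rule Youngs_inequality_0) (use assms False in auto)
  then show ?thesis by (simp add: algebra_simps)
qed (use assms in simp)

text \<open>At a positive lag the covariance is half a second difference of the concave function
  \<open>x powr (2 * H)\<close>. In the bounds for the two neighbours of \<open>j\<close> the
  first-order terms \<open>2 * H / j\<close> have opposite signs and cancel.\<close>

lemma fgn_cov_nonpos:
  assumes "0 < H" "H < 1 / 2" "1 \<le> j"
  shows "fgn_cov H j \<le> 0"
proof -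
  have j: "0 < real j" using assms by simp
  have "real (j + 1) = real j * (1 + 1 / real j)" using j by (simp add: field_simps)
  then have "real (j + 1) powr (2 * H) = real j powr (2 * H) * (1 + 1 / real j) powr (2 * H)"
    using j by (simp only: powr_mult)
  also have "\<dots> \<le> real j powr (2 * H) * (1 + 2 * H * (1 / real j))"
    using assms by (intro mult_left_mono powr_Bernoulli_le) (auto intro: order.trans[of _ 0])
  finally have 1: "real (j + 1) powr (2 * H) \<le> real j powr (2 * H) * (1 + 2 * H * (1 / real j))" .
  have "\<bar>real j - 1\<bar> = real j * (1 + - (1 / real j))" using j assms(3) by (simp add: field_simps)
  then have "\<bar>real j - 1\<bar> powr (2 * H) = real j powr (2 * H) * (1 + - (1 / real j)) powr (2 * H)"
    using j by (simp only: powr_mult)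
  also have "\<dots> \<le> real j powr (2 * H) * (1 + 2 * H * (- (1 / real j)))"
    using assms by (intro mult_left_mono powr_Bernoulli_le) auto
  finally have 2: "\<bar>real j - 1\<bar> powr (2 * H) \<le> real j powr (2 * H) * (1 + 2 * H * (- (1 / real j)))" .
  show ?thesis using 1 2 unfolding fgn_cov_def by (simp add: algebra_simps)
qed

text \<open>For \<open>H < 1/2\<close> the noise is negatively correlated, so the absolute covariances telescope.\<close>

lemma sum_abs_fgn_cov_le:
  assumes "0 < H" "H < 1 / 2"
  shows "(\<Sum>j<N. \<bar>fgn_cov H j\<bar>) \<le> 3 / 2"
proof -
  \<comment> \<open>Lag 0 contributes 1. The later terms are negated second differences and
    telescope to a first difference, which is nonnegative by monotonicity; this leaves 3/2.\<close>
  have "(\<Sum>j<Suc n. \<bar>fgn_cov H j\<bar>) = 3 / 2 - (real (n + 1) powr (2 * H) - real n powr (2 * H)) / 2" for n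
  proof (induction n)
    case 0
    then show ?case by (simp add: fgn_cov_def)
  next
    case (Suc n)
    have "\<bar>fgn_cov H (Suc n)\<bar> = - fgn_cov H (Suc n)"
      using fgn_cov_nonpos[OF assms, of "Suc n"] by simp
    also have "\<dots> = - (real (n + 2) powr (2 * H) + real n powr (2 * H) - 2 * real (n + 1) powr (2 * H)) / 2"
    proof -
      have eqs: "real (Suc n + 1) = real (n + 2)" "\<bar>real (Suc n) - 1\<bar> = real n" "real (Suc n) = real (n + 1)" by auto
      show ?thesis unfolding fgn_cov_def eqs(1,2) unfolding eqs(3) by (simp only: minus_divide_left)
    qed
    finally have "\<bar>fgn_cov H (Suc n)\<bar> = - (real (n + 2) powr (2 * H) + real n powr (2 * H) - 2 * real (n + 1) powr (2 * H)) / 2" .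
    moreover have eqs: "real (Suc n + 1) = real (n + 2)" "real (Suc n) = real (n + 1)" by auto
    ultimately show ?case using Suc unfolding sum.lessThan_Suc[of _ "Suc n"] eqs by argo
  qed
  moreover have "0 \<le> (real (n + 1) powr (2 * H) - real n powr (2 * H)) / 2" for n
    using assms by (simp add: powr_mono2)
  ultimately have "(\<Sum>j<Suc n. \<bar>fgn_cov H j\<bar>) \<le> 3 / 2" for n by (simp only: diff_le_eq le_add_same_cancel1)
  moreover have "(\<Sum>j<N. \<bar>fgn_cov H j\<bar>) \<le> (\<Sum>j<Suc N. \<bar>fgn_cov H j\<bar>)" by simp
  ultimately show ?thesis by (meson order.trans)
qed

text \<open>Every positive distance from \<open>q\<close> is attained at most twice, once on each
  side.\<close>

lemma sum_distance_le:
  fixes f :: "nat \<Rightarrow> real"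
  assumes "\<And>j. 0 \<le> f j" and "\<And>N. (\<Sum>j<N. f j) \<le> C"
  shows "(\<Sum>p<N. f ((p - q) + (q - p))) \<le> 2 * C"
proof -
  have "(\<Sum>p<N. f ((p - q) + (q - p))) \<le> (\<Sum>p\<in>{..<q} \<union> {q..<q + N}. f ((p - q) + (q - p)))"
    using assms(1) by (intro sum_mono2) auto
  also have "\<dots> = (\<Sum>p<q. f (q - p)) + (\<Sum>p\<in>{q..<q + N}. f (p - q))"
    by (subst sum.union_disjoint) auto
  also have "(\<Sum>p<q. f (q - p)) = (\<Sum>j\<in>{1..q}. f j)"
    by (rule sum.reindex_bij_witness[of _ "\<lambda>j. q - j" "\<lambda>p. q - p"]) auto
  also have "\<dots> \<le> (\<Sum>j<Suc q. f j)" using assms(1) by (intro sum_mono2) auto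
  also have "\<dots> \<le> C" by (rule assms(2))
  also have "(\<Sum>p\<in>{q..<q + N}. f (p - q)) = (\<Sum>j<N. f j)"
    by (rule sum.reindex_bij_witness[of _ "\<lambda>j. q + j" "\<lambda>p. p - q"]) auto
  also have "\<dots> \<le> C" by (rule assms(2))
  finally show ?thesis by simp
qed

lemma sum_abs_fgn_cov_distance_le:
  assumes "0 < H" "H < 1 / 2"
  shows "(\<Sum>p<N. \<bar>fgn_cov H ((p - q) + (q - p))\<bar>) \<le> 3"
  using sum_distance_le[of "\<lambda>j. \<bar>fgn_cov H j\<bar>" "3 / 2"] sum_abs_fgn_cov_le[OF assms] by simp

section \<open>Covariances of the increments that make up \<open>theta\<close>\<close>

lemma fbm_cov_sym: "fbm_cov H s t s' t' = fbm_cov H s' t' s t"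
  by (simp add: fbm_cov_def abs_minus_commute)

lemma fbm_cov_translate: "fbm_cov H (s + x) (t + x) (s' + x) (t' + x) = fbm_cov H s t s' t'"
  by (simp add: fbm_cov_def)

lemma fbm_cov_telescope:
  assumes "a \<le> b"
  shows "fbm_cov H (f a) (f b) s t = (\<Sum>i = a..<b. fbm_cov H (f i) (f (Suc i)) s t)"
  using assms by (induction b rule: dec_induct) (simp_all add: fbm_cov_def field_simps)

lemma fbm_cov_telescope2:
  assumes "a \<le> b" "c \<le> d"
  shows "fbm_cov H (f a) (f b) (f c) (f d)
    = (\<Sum>i = a..<b. \<Sum>j = c..<d. fbm_cov H (f i) (f (Suc i)) (f j) (f (Suc j)))"
  unfolding fbm_cov_telescope[OF assms(1)]
  by (subst fbm_cov_sym, subst fbm_cov_telescope[OF assms(2)], subst fbm_cov_sym) simp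

text \<open>The seven increments entering \<open>theta\<close>, in units of a quarter: left end, length, weight.\<close>

definition theta_lo :: "nat \<Rightarrow> nat" where "theta_lo j = [0, 0, 2, 0, 1, 2, 3] ! j"
definition theta_len :: "nat \<Rightarrow> nat" where "theta_len j = [4, 2, 2, 1, 1, 1, 1] ! j"
definition theta_wt :: "real \<Rightarrow> nat \<Rightarrow> real" where
  "theta_wt H j = [1, - (c_coeff H + 1), - (c_coeff H + 1), c_coeff H, c_coeff H, c_coeff H, c_coeff H] ! j"

definition block_lo :: "nat \<Rightarrow> nat \<Rightarrow> real" where
  "block_lo m j = real (4 * m + theta_lo j) * (1 / 4)"
definition block_hi :: "nat \<Rightarrow> nat \<Rightarrow> real" where
  "block_hi m j = real (4 * m + theta_lo j + theta_len j) * (1 / 4)"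
definition block :: "(real \<Rightarrow> 'a \<Rightarrow> real) \<Rightarrow> nat \<Rightarrow> nat \<Rightarrow> 'a \<Rightarrow> real" where
  "block B m j x = B (block_hi m j) x - B (block_lo m j) x"
definition block_cov :: "real \<Rightarrow> nat \<Rightarrow> nat \<Rightarrow> nat \<Rightarrow> nat \<Rightarrow> real" where
  "block_cov H m j m' j' = fbm_cov H (block_lo m j) (block_hi m j) (block_lo m' j') (block_hi m' j')"
text \<open>The covariance of \<open>theta\<close> at \<open>m\<close> and \<open>m'\<close>, see
  \<open>expectation_theta_mult\<close>: squares of centred Gaussians have twice the squared
  covariance. Being a function of \<open>H\<close> and the indices alone, it is shared by all
  rescaled processes.\<close>

definition theta_cov :: "real \<Rightarrow> nat \<Rightarrow> nat \<Rightarrow> real" where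
  "theta_cov H m m' = 2 * (\<Sum>j<7. \<Sum>j'<7. theta_wt H j * theta_wt H j' * (block_cov H m j m' j')\<^sup>2)"

lemma sum_lessThan_7: "(\<Sum>j<7. f j) = f 0 + f 1 + f 2 + f 3 + f 4 + f 5 + f (6::nat)"
  by (simp add: numeral_eq_Suc)

lemma less_7_cases: "j < 7 \<longleftrightarrow> j = 0 \<or> j = 1 \<or> j = 2 \<or> j = 3 \<or> j = 4 \<or> j = 5 \<or> j = (6::nat)"
  by auto

lemma theta_eq_blocks: "theta H B m x = (\<Sum>j<7. theta_wt H j * (block B m j x)\<^sup>2)"
  unfolding sum_lessThan_7
  by (simp add: theta_def sq_increment_def block_def block_lo_def block_hi_def theta_lo_def theta_len_def
      theta_wt_def add_divide_distrib algebra_simps)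

lemma c_coeff_bounds: "0 < H \<Longrightarrow> H < 1 / 2 \<Longrightarrow> 0 < c_coeff H \<and> c_coeff H < 1"
  using powr_less_mono[of "2 * H - 1" 0 2] unfolding c_coeff_def by simp

lemma abs_theta_wt_le: "0 < H \<Longrightarrow> H < 1 / 2 \<Longrightarrow> j < 7 \<Longrightarrow> \<bar>theta_wt H j\<bar> \<le> 2"
  using c_coeff_bounds[of H] unfolding less_7_cases by (auto simp: theta_wt_def)

lemma theta_block_le: "j < 7 \<Longrightarrow> theta_lo j + theta_len j \<le> 4"
  unfolding less_7_cases by (auto simp: theta_lo_def theta_len_def)

lemma block_cov_sym: "block_cov H m j m' j' = block_cov H m' j' m j"
  unfolding block_cov_def by (rule fbm_cov_sym)

lemma block_cov_translate: "block_cov H (m + k) j (m' + k) j' = block_cov H m j m' j'"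
proof -
  have "block_lo (m + k) j = block_lo m j + real k" "block_hi (m + k) j = block_hi m j + real k" for m j
    by (simp_all add: block_lo_def block_hi_def field_simps)
  then show ?thesis unfolding block_cov_def by (simp only: fbm_cov_translate)
qed

lemma theta_cov_sym: "theta_cov H m m' = theta_cov H m' m"
  unfolding theta_cov_def
  by (subst sum.swap) (simp only: block_cov_sym[of H m] mult.commute)

lemma theta_cov_translate: "theta_cov H (m + k) (m' + k) = theta_cov H m m'"
  unfolding theta_cov_def block_cov_translate ..

text \<open>Both increments are sums of noise over quarter cells, contained in the four cells of
  their unit intervals. The scaling factor \<open>(1/4) powr (2 * H)\<close> is at most 1.\<close>

lemma abs_block_cov_le:
  assumes H: "0 < H" "H < 1 / 2" and j: "j < 7" "j' < 7"
  shows "\<bar>block_cov H m j m' j'\<bar> \<le>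
    (\<Sum>i<4. \<Sum>i'<4. \<bar>fgn_cov H ((4 * m' + i' - (4 * m + i)) + (4 * m + i - (4 * m' + i')))\<bar>)"
proof -
  let ?g = "\<lambda>p q. \<bar>fgn_cov H ((q - p) + (p - q))\<bar>"
  let ?A = "{4 * m + theta_lo j..<4 * m + theta_lo j + theta_len j}"
  let ?A' = "{4 * m' + theta_lo j'..<4 * m' + theta_lo j' + theta_len j'}"
  have "block_cov H m j m' j' = (\<Sum>p\<in>?A. \<Sum>q\<in>?A'. fbm_cov H (real p * (1/4)) (real (p + 1) * (1/4)) (real q * (1/4)) (real (q + 1) * (1/4)))"
    unfolding block_cov_def block_lo_def block_hi_def
    by (subst fbm_cov_telescope2[where f = "\<lambda>i. real i * (1/4)"]) simp_all
  also have "\<dots> = (\<Sum>p\<in>?A. \<Sum>q\<in>?A'. (1/4) powr (2 * H) * fgn_cov H ((p - q) + (q - p)))"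
    by (intro sum.cong refl fbm_cov_grid) simp
  finally have "\<bar>block_cov H m j m' j'\<bar> \<le> (\<Sum>p\<in>?A. \<Sum>q\<in>?A'. \<bar>(1/4) powr (2 * H) * fgn_cov H ((p - q) + (q - p))\<bar>)"
    by (simp only:) (intro order.trans[OF sum_abs] sum_mono order.refl)
  also have "\<dots> \<le> (\<Sum>p\<in>?A. \<Sum>q\<in>?A'. ?g p q)"
  proof (intro sum_mono)
    fix p q
    have "(1/4::real) powr (2 * H) \<le> 1" using H by (intro powr_le1) auto
    then have "(1/4::real) powr (2 * H) * \<bar>fgn_cov H ((p - q) + (q - p))\<bar> \<le> \<bar>fgn_cov H ((p - q) + (q - p))\<bar>"
      by (intro mult_left_le_one_le) auto
    then show "\<bar>(1/4) powr (2 * H) * fgn_cov H ((p - q) + (q - p))\<bar> \<le> ?g p q"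
      by (simp add: abs_mult add.commute)
  qed
  also have "\<dots> \<le> (\<Sum>p\<in>?A. \<Sum>q\<in>{4 * m'..<4 * m' + 4}. ?g p q)"
    using theta_block_le[OF j(2)] by (intro sum_mono sum_mono2) auto
  also have "\<dots> \<le> (\<Sum>p\<in>{4 * m..<4 * m + 4}. \<Sum>q\<in>{4 * m'..<4 * m' + 4}. ?g p q)"
    using theta_block_le[OF j(1)] by (intro sum_mono2) (auto intro!: sum_nonneg)
  also have "\<dots> = (\<Sum>i<4. \<Sum>i'<4. ?g (4 * m + i) (4 * m' + i'))"
  proof -
    have sh: "(\<Sum>p\<in>{k..<k + 4}. f p) = (\<Sum>i<4. f (k + i))" for k :: nat and f :: "nat \<Rightarrow> real"
      by (rule sum.reindex_bij_witness[of _ "\<lambda>i. k + i" "\<lambda>p. p - k"]) auto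
    show ?thesis unfolding sh ..
  qed
  finally show ?thesis .
qed

text \<open>84 = 7 * 4 * 3: seven increments \<open>j'\<close>, four quarter cells in the unit
  interval of \<open>m\<close>, and the bound 3 for each row of the noise covariance.\<close>

lemma sum_abs_block_cov_le:
  assumes H: "0 < H" "H < 1 / 2" and j: "j < 7"
  shows "(\<Sum>m'<n. \<Sum>j'<7. \<bar>block_cov H m j m' j'\<bar>) \<le> 84"
proof -
  let ?g = "\<lambda>p q. \<bar>fgn_cov H ((q - p) + (p - q))\<bar>"
  have "(\<Sum>m'<n. \<Sum>j'<7. \<bar>block_cov H m j m' j'\<bar>) \<le> (\<Sum>m'<n. \<Sum>j'<(7::nat). \<Sum>i<4. \<Sum>i'<4. ?g (4 * m + i) (4 * m' + i'))"
    using assms by (intro sum_mono abs_block_cov_le) auto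
  also have "\<dots> = 7 * (\<Sum>m'<n. \<Sum>i<4. \<Sum>i'<4. ?g (4 * m + i) (4 * m' + i'))"
    by (simp add: sum_distrib_left)
  also have "\<dots> = 7 * (\<Sum>i<4. \<Sum>m'<n. \<Sum>i'<4. ?g (4 * m + i) (4 * m' + i'))"
    by (subst sum.swap) simp
  also have "\<dots> = 7 * (\<Sum>i<4. \<Sum>q<n * 4. ?g (4 * m + i) q)"
  proof -
    have "(\<Sum>m'<n. \<Sum>i'<4. f (4 * m' + i')) = (\<Sum>q<n * 4. f q)" for f :: "nat \<Rightarrow> real"
    proof -
      have "(\<Sum>i'<4. f (4 * m' + i')) = sum f {m' * 4..<m' * 4 + 4}" for m'
        by (rule sum.reindex_bij_witness[of _ "\<lambda>q. q - 4 * m'" "\<lambda>i. 4 * m' + i"]) auto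
      then show ?thesis by (simp only: sum.nat_group)
    qed
    from this[of "?g (4 * m + i)" for i] show ?thesis by (simp only:)
  qed
  also have "\<dots> \<le> 7 * (\<Sum>i<(4::nat). 3)"
    by (intro mult_left_mono sum_mono sum_abs_fgn_cov_distance_le H) auto
  finally show ?thesis by simp
qed

lemma abs_block_cov_le_84:
  assumes H: "0 < H" "H < 1 / 2" and j: "j < 7" "j' < 7"
  shows "\<bar>block_cov H m j m' j'\<bar> \<le> 84"
proof -
  have "\<bar>block_cov H m j m' j'\<bar> \<le> (\<Sum>j'<7. \<bar>block_cov H m j m' j'\<bar>)"
    using j by (intro member_le_sum) auto
  also have "\<dots> \<le> (\<Sum>m'<Suc m'. \<Sum>j'<7. \<bar>block_cov H m j m' j'\<bar>)"
    by (intro member_le_sum[of m' "{..<Suc m'}" "\<lambda>m'. \<Sum>j'<7. \<bar>block_cov H m j m' j'\<bar>"]) (auto intro!: sum_nonneg)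
  also have "\<dots> \<le> 84" by (rule sum_abs_block_cov_le[OF H j(1)])
  finally show ?thesis .
qed

text \<open>One factor of the squared covariance is bounded by 84 and the other is summed along its
  row, which again gives 84; a product of two weights is at most 4.\<close>

lemma summable_theta_cov:
  assumes H: "0 < H" "H < 1 / 2"
  shows "summable (\<lambda>m. theta_cov H 0 (Suc m))"
proof -
  have "(\<Sum>m<n. norm (theta_cov H 0 m)) \<le> 2 * (7 * (4 * (84 * 84)))" for n
  proof -
    have "(\<Sum>m<n. norm (theta_cov H 0 m)) \<le> (\<Sum>m<n. 2 * (\<Sum>j<7. \<Sum>j'<7. 4 * (84 * \<bar>block_cov H 0 j m j'\<bar>)))"
    proof (intro sum_mono)
      fix m
      have "\<bar>theta_wt H j * theta_wt H j' * (block_cov H 0 j m j')\<^sup>2\<bar> \<le> 4 * (84 * \<bar>block_cov H 0 j m j'\<bar>)"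
        if "j < 7" "j' < 7" for j j'
      proof -
        have "\<bar>theta_wt H j * theta_wt H j'\<bar> \<le> 2 * 2"
          unfolding abs_mult using that by (intro mult_mono abs_theta_wt_le H) auto
        moreover have "(block_cov H 0 j m j')\<^sup>2 \<le> 84 * \<bar>block_cov H 0 j m j'\<bar>"
          using mult_right_mono[OF abs_block_cov_le_84[OF H that, of 0 m], of "\<bar>block_cov H 0 j m j'\<bar>"]
          by (simp add: power2_eq_square)
        ultimately show ?thesis
          unfolding abs_mult[of "_ * _" "_\<^sup>2"] by (intro mult_mono) auto
      qed
      then have "\<bar>\<Sum>j<7. \<Sum>j'<7. theta_wt H j * theta_wt H j' * (block_cov H 0 j m j')\<^sup>2\<bar>
        \<le> (\<Sum>j<7. \<Sum>j'<7. 4 * (84 * \<bar>block_cov H 0 j m j'\<bar>))"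
        by (intro order.trans[OF sum_abs] sum_mono) (auto intro!: order.trans[OF sum_abs] sum_mono)
      then show "norm (theta_cov H 0 m) \<le> 2 * (\<Sum>j<7. \<Sum>j'<7. 4 * (84 * \<bar>block_cov H 0 j m j'\<bar>))"
        unfolding theta_cov_def by (simp add: abs_mult)
    qed
    also have "\<dots> = 2 * (\<Sum>j<7. 4 * (84 * (\<Sum>m<n. \<Sum>j'<7. \<bar>block_cov H 0 j m j'\<bar>)))"
      by (simp only: sum_distrib_left[symmetric] sum.swap[of _ "{..<7}" "{..<n}"])
    also have "\<dots> \<le> 2 * (\<Sum>j<(7::nat). 4 * (84 * 84))"
      by (intro mult_left_mono sum_mono sum_abs_block_cov_le H) auto
    finally show ?thesis by simp
  qed
  then have "summable (\<lambda>m. norm (theta_cov H 0 m))"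
    by (intro summableI_nonneg_bounded) auto
  then show ?thesis by (subst summable_Suc_iff) (rule summable_norm_cancel)
qed

section \<open>Convergence of the normalised variance to the long-run variance\<close>

lemma cesaro_mean:
  fixes x :: "nat \<Rightarrow> real"
  assumes x: "x \<longlonglongrightarrow> L"
  shows "(\<lambda>n. (\<Sum>m<n. x m) / real n) \<longlonglongrightarrow> L"
proof (rule LIMSEQ_I)
  fix e :: real assume e: "e > 0"
  obtain N where N: "\<And>m. m \<ge> N \<Longrightarrow> norm (x m - L) < e / 2"
    using LIMSEQ_D[OF x, of "e / 2"] e by auto
  define C where "C = (\<Sum>m<N. norm (x m - L))"
  have C0: "0 \<le> C" unfolding C_def by (intro sum_nonneg) auto
  obtain N' :: nat where N': "real N' > 2 * C / e" using reals_Archimedean2 by blast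
  have "norm ((\<Sum>m<n. x m) / real n - L) < e" if n: "n \<ge> N + N' + 1" for n
  proof -
    have n0: "real n > 0" using n by simp
    have "(\<Sum>m<n. x m) / real n - L = (\<Sum>m<n. x m - L) / real n"
      using n0 by (simp add: sum_subtractf field_simps)
    then have "norm ((\<Sum>m<n. x m) / real n - L) \<le> (\<Sum>m<n. norm (x m - L)) / real n"
      using n0 by (simp add: abs_div_pos sum_abs divide_right_mono flip: real_norm_def) (simp add: divide_right_mono sum_abs)
    also have "(\<Sum>m<n. norm (x m - L)) = C + (\<Sum>m\<in>{N..<n}. norm (x m - L))"
      unfolding C_def using n by (subst sum.union_disjoint[symmetric]) (auto intro!: sum.cong)
    also have "(\<Sum>m\<in>{N..<n}. norm (x m - L)) \<le> (\<Sum>m\<in>{N..<n}. e / 2)"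
      using N by (intro sum_mono less_imp_le) auto
    also have "\<dots> \<le> real n * (e / 2)" using e by (simp add: mult_right_mono)
    also have "C < real n * (e / 2)"
    proof -
      have "2 * C / e < real n" using N' n by linarith
      then show ?thesis using e by (simp add: field_simps)
    qed
    finally show ?thesis using n0 by (simp add: field_simps divide_right_mono)
  qed
  then show "\<exists>no. \<forall>n\<ge>no. norm ((\<Sum>m<n. x m) / real n - L) < e" by blast
qed

text \<open>Enlarging a symmetric Toeplitz matrix by one adds a row and a column, each a partial sum
  over lags. Divided by \<open>n\<close>, the right-hand side is a Cesaro mean of the partial sums
  of the long-run variance.\<close>

lemma theta_cov_double_sum:
  "(\<Sum>m<n. \<Sum>m'<n. theta_cov H m m') = (\<Sum>m<n. theta_cov H 0 0 + 2 * (\<Sum>k<m. theta_cov H 0 (Suc k)))"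
proof (induction n)
  case (Suc n)
  have row: "(\<Sum>m<n. theta_cov H m n) = (\<Sum>k<n. theta_cov H 0 (Suc k))"
  proof (rule sum.reindex_bij_witness[of _ "\<lambda>k. n - Suc k" "\<lambda>m. n - Suc m"])
    fix m assume "m \<in> {..<n}"
    then show "theta_cov H 0 (Suc (n - Suc m)) = theta_cov H m n"
      using theta_cov_translate[of H 0 m "Suc (n - Suc m)"] by (simp add: Suc_diff_Suc)
  qed auto
  have "(\<Sum>m<Suc n. \<Sum>m'<Suc n. theta_cov H m m')
     = (\<Sum>m<n. \<Sum>m'<n. theta_cov H m m') + (\<Sum>m<n. theta_cov H m n) + ((\<Sum>m'<n. theta_cov H n m') + theta_cov H n n)"
    by (simp add: sum.distrib)
  also have "(\<Sum>m'<n. theta_cov H n m') = (\<Sum>m<n. theta_cov H m n)" by (simp add: theta_cov_sym)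
  also have "theta_cov H n n = theta_cov H 0 0" using theta_cov_translate[of H 0 n 0] by simp
  finally show ?case using Suc row by simp
qed simp

lemma theta_cov_mean_tendsto:
  assumes H: "0 < H" "H < 1 / 2"
  shows "(\<lambda>n. (\<Sum>m<n. \<Sum>m'<n. theta_cov H m m') / real n) \<longlonglongrightarrow>
    theta_cov H 0 0 + 2 * (\<Sum>k. theta_cov H 0 (Suc k))"
  unfolding theta_cov_double_sum
  by (intro cesaro_mean tendsto_intros summable_LIMSEQ summable_theta_cov H)

section \<open>Moments of \<open>theta\<close> and the Gaussian approximation of its sums\<close>

context fbm_space
begin

lemma block_mem: "block B m j \<in> fbm_span B"
  unfolding block_def[abs_def] by (intro increment_mem) (auto simp: block_lo_def block_hi_def)

lemma expectation_blocks: "expectation (\<lambda>x. block B m j x * block B m' j' x) = block_cov H m j m' j'"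
  unfolding block_def block_cov_def
  by (rule expectation_increments) (auto simp: block_lo_def block_hi_def)

text \<open>With \<open>y = 2 powr (2 * H)\<close> and \<open>c_coeff H = y / 2\<close> the mean is
  \<open>1 - (y / 2 + 1) * 2 / y + (y / 2) * 4 / y\<^sup>2\<close>, which vanishes.\<close>

lemma expectation_theta: "expectation (theta H B m) = 0"
proof -
  define y where "y = (2::real) powr (2 * H)"
  have y: "y > 0" unfolding y_def by simp
  have c: "c_coeff H = y / 2" unfolding c_coeff_def y_def by (simp add: powr_diff)
  have half: "(1/2::real) powr (2 * H) = 1 / y" unfolding y_def by (simp add: powr_divide)
  have "(4::real) powr (2 * H) = (2 * 2) powr (2 * H)" by simp
  also have "\<dots> = y * y" unfolding y_def by (subst powr_mult) simp_all
  finally have quarter: "(1/4::real) powr (2 * H) = 1 / (y * y)" by (simp add: powr_divide)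
  have e: "expectation (\<lambda>x. (block B m j x)\<^sup>2) = (real (theta_len j) * (1/4)) powr (2 * H)" for j
  proof -
    have "expectation (\<lambda>x. (block B m j x)\<^sup>2) = block_cov H m j m j"
      using expectation_blocks[of m j m j] by (simp add: power2_eq_square)
    also have "\<dots> = \<bar>block_hi m j - block_lo m j\<bar> powr (2 * H)"
      by (simp add: block_cov_def fbm_cov_def abs_minus_commute)
    also have "block_hi m j - block_lo m j = real (theta_len j) * (1/4)"
      by (simp add: block_hi_def block_lo_def field_simps)
    finally show ?thesis by simp
  qed
  have "expectation (theta H B m) = (\<Sum>j<7. theta_wt H j * expectation (\<lambda>x. (block B m j x)\<^sup>2))"
    unfolding theta_eq_blocks[abs_def] using integrable_power[OF block_mem]
    by (subst Bochner_Integration.integral_sum) auto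
  also have "\<dots> = 1 - (c_coeff H + 1) * 2 * (1/2) powr (2 * H) + c_coeff H * 4 * (1/4) powr (2 * H)"
    unfolding sum_lessThan_7 e by (simp add: theta_wt_def theta_len_def algebra_simps)
  also have "\<dots> = 0"
    unfolding c half quarter using y by (simp add: field_simps)
  finally show ?thesis .
qed

lemma expectation_theta_mult:
  "integrable M (\<lambda>x. theta H B m x * theta H B m' x)"
  "expectation (\<lambda>x. theta H B m x * theta H B m' x) = theta_cov H m m'"
proof -
  define Z where "Z m j x = (block B m j x)\<^sup>2 - expectation (\<lambda>x. (block B m j x)\<^sup>2)" for m j x
  \<comment> \<open>Since the weighted means cancel, each square may be centred separately without
    changing \<open>theta\<close>.\<close>
  have "theta H B m x = (\<Sum>j<7. theta_wt H j * Z m j x)" for m x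
  proof -
    have "0 = (\<Sum>j<7. theta_wt H j * expectation (\<lambda>x. (block B m j x)\<^sup>2))"
      unfolding expectation_theta[of m, symmetric] theta_eq_blocks[abs_def] using integrable_power[OF block_mem]
      by (subst Bochner_Integration.integral_sum) auto
    then show ?thesis unfolding theta_eq_blocks Z_def by (simp add: right_diff_distrib sum_subtractf)
  qed
  then have eq: "theta H B m x * theta H B m' x = (\<Sum>j<7. \<Sum>j'<7. theta_wt H j * theta_wt H j' * (Z m j x * Z m' j' x))" for x
    by (simp only: sum_product mult_ac)
  have Z: "integrable M (\<lambda>x. Z m j x * Z m' j' x)" "expectation (\<lambda>x. Z m j x * Z m' j' x) = 2 * (block_cov H m j m' j')\<^sup>2" for j j'
    unfolding Z_def using expectation_centered_squares[OF block_mem block_mem, of m j m' j']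
    unfolding expectation_blocks by auto
  show "integrable M (\<lambda>x. theta H B m x * theta H B m' x)"
    unfolding eq by (intro integral_double_sum Z)
  have "expectation (\<lambda>x. theta H B m x * theta H B m' x) =
    (\<Sum>j<7. \<Sum>j'<7. theta_wt H j * theta_wt H j' * expectation (\<lambda>x. Z m j x * Z m' j' x))"
    unfolding eq by (intro integral_double_sum Z)
  then show "expectation (\<lambda>x. theta H B m x * theta H B m' x) = theta_cov H m m'"
    unfolding Z theta_cov_def by (simp add: sum_distrib_left mult_ac)
qed

lemma rho_eq: "rho H B m = theta_cov H 0 m"
  unfolding rho_def by (rule expectation_theta_mult)

lemma long_run_variance_eq: "long_run_variance H B = theta_cov H 0 0 + 2 * (\<Sum>k. theta_cov H 0 (Suc k))"
  unfolding long_run_variance_def rho_eq ..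

lemma theta_measurable [measurable]: "theta H B m \<in> borel_measurable M"
  unfolding theta_eq_blocks[abs_def] using rv[OF block_mem] by measurable

text \<open>The sum is a quadratic form in \<open>7 * n\<close> increments with weights at most
  \<open>2 / sqrt n\<close>, whose fourth power is \<open>16 / n\<^sup>2\<close>; 84 bounds the
  covariances as well as their row sums. No quantity in the bound refers to the process, so it is
  uniform over the rescaled ones.\<close>

lemma theta_sum_char_bound:
  assumes n: "0 < n"
  shows "cmod (expectation (\<lambda>x. iexp (\<sigma> * ((\<Sum>m<n. theta H B m x) / sqrt n)))
      - exp (- (\<sigma>\<^sup>2 * ((\<Sum>m<n. \<Sum>m'<n. theta_cov H m m') / n) / 2)))
    \<le> 2 * \<sigma>\<^sup>2 * sqrt (2 * 7 * 16 * 84 ^ 4 / n)"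
proof -
  let ?I = "{..<n} \<times> {..<(7::nat)}"
  define Y where "Y p = block B (fst p) (snd p)" for p
  define w where "w p = theta_wt H (snd p) / sqrt n" for p :: "nat \<times> nat"
  define q where "q x = (\<Sum>p\<in>?I. w p * (Y p x)\<^sup>2)" for x
  have H: "0 < H" "H < 1 / 2" using H_pos H_less by auto
  have YS: "Y p \<in> fbm_span B" for p unfolding Y_def by (rule block_mem)
  have r: "expectation (\<lambda>x. Y p x * Y p' x) = block_cov H (fst p) (snd p) (fst p') (snd p')" for p p'
    unfolding Y_def by (rule expectation_blocks)
  have q_eq: "q x = (\<Sum>m<n. theta H B m x) / sqrt n" for x
    unfolding q_def w_def Y_def theta_eq_blocks
    by (simp add: sum.cartesian_product' sum_divide_distrib)
  have Eq: "expectation q = 0"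
  proof -
    have i: "integrable M (theta H B m)" for m
      unfolding theta_eq_blocks[abs_def]
      by (intro Bochner_Integration.integrable_sum integrable_mult_right integrable_power block_mem)
    have "expectation q = (\<Sum>m<n. expectation (theta H B m)) / sqrt n"
      unfolding q_eq[abs_def] using i by simp
    then show ?thesis by (simp add: expectation_theta)
  qed
  have "variance q = 2 * (\<Sum>p\<in>?I. \<Sum>p'\<in>?I. w p * w p' * (expectation (\<lambda>x. Y p x * Y p' x))\<^sup>2)"
    unfolding q_def[abs_def] by (rule variance_quad) (auto intro: YS)
  also have "\<dots> = 2 * (\<Sum>m<n. \<Sum>j<7. \<Sum>m'<n. \<Sum>j'<7. theta_wt H j * theta_wt H j' * (block_cov H m j m' j')\<^sup>2 / n)"
  proof -
    have "a / sqrt n * (b / sqrt n) = a * b / n" for a b by simp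
    then show ?thesis unfolding r w_def by (simp add: sum.cartesian_product')
  qed
  also have "\<dots> = (\<Sum>m<n. \<Sum>m'<n. theta_cov H m m') / n"
  proof -
    have "(\<Sum>m<n. \<Sum>j<7. \<Sum>m'<n. \<Sum>j'<7. f m j m' j') = (\<Sum>m<n. \<Sum>m'<n. \<Sum>j<(7::nat). \<Sum>j'<(7::nat). f m j m' j' :: real)" for f
      by (intro sum.cong refl sum.swap)
    then show ?thesis
      unfolding theta_cov_def by (simp add: sum_divide_distrib[symmetric] sum_distrib_left[symmetric])
  qed
  finally have V: "variance q = (\<Sum>m<n. \<Sum>m'<n. theta_cov H m m') / n" .
  have "cmod (expectation (\<lambda>x. iexp (\<sigma> * (q x - expectation q))) - exp (- (\<sigma>\<^sup>2 * variance q / 2)))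
    \<le> 2 * \<sigma>\<^sup>2 * sqrt (2 * (real (card ?I) * ((2 / sqrt n) ^ 4 * 84 * 84 ^ 3)))"
    unfolding q_def[abs_def]
  proof (rule char_quad_bound)
    show "\<bar>w p\<bar> \<le> 2 / sqrt n" if "p \<in> ?I" for p
      unfolding w_def using that abs_theta_wt_le[OF H, of "snd p"] n by (auto simp: divide_right_mono)
    show "\<bar>expectation (\<lambda>x. Y p x * Y p' x)\<bar> \<le> 84" if "p \<in> ?I" "p' \<in> ?I" for p p'
      unfolding r using that by (intro abs_block_cov_le_84 H) auto
    show "(\<Sum>p'\<in>?I. \<bar>expectation (\<lambda>x. Y p x * Y p' x)\<bar>) \<le> 84" if "p \<in> ?I" for p
      unfolding r sum.cartesian_product' fst_conv snd_conv using that by (intro sum_abs_block_cov_le H) auto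
  qed (auto intro: YS)
  moreover have "2 * (real (card ?I) * ((2 / sqrt n) ^ 4 * 84 * 84 ^ 3)) = 2 * 7 * 16 * 84 ^ 4 / n"
  proof -
    have "(2 / sqrt n) ^ 4 = 16 / (real n)\<^sup>2"
      using n by (simp add: power_divide power4_eq_xxxx power2_eq_square)
    then show ?thesis using n by (simp add: power2_eq_square)
  qed
  ultimately show ?thesis unfolding V unfolding Eq diff_0_right q_eq by (simp only:)
qed

end

section \<open>Second moments of the variations\<close>

context prob_space
begin

text \<open>Geometrically decaying second moments make the series of squares integrable, hence
  almost surely finite, so its terms tend to 0.\<close>

lemma AE_tendsto_zero_of_second_moment:
  fixes Z :: "nat \<Rightarrow> 'a \<Rightarrow> real"
  assumes Z: "\<And>k. integrable M (\<lambda>x. (Z k x)\<^sup>2)" and bound: "\<And>k. expectation (\<lambda>x. (Z k x)\<^sup>2) \<le> C * r ^ k"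
    and r: "0 \<le> r" "r < 1"
  shows "AE x in M. (\<lambda>k. Z k x) \<longlonglongrightarrow> 0"
proof -
  have [measurable]: "(\<lambda>x. (Z k x)\<^sup>2) \<in> borel_measurable M" for k using Z by auto
  have s: "summable (\<lambda>k. expectation (\<lambda>x. (Z k x)\<^sup>2))"
  proof (rule summable_comparison_test')
    show "summable (\<lambda>k. C * r ^ k)" using r by (intro summable_mult summable_geometric) simp
    show "norm (expectation (\<lambda>x. (Z k x)\<^sup>2)) \<le> C * r ^ k" if "0 \<le> k" for k using bound[of k] by simp
  qed
  have "(\<integral>\<^sup>+x. (\<Sum>k. ennreal ((Z k x)\<^sup>2)) \<partial>M) = (\<Sum>k. \<integral>\<^sup>+x. ennreal ((Z k x)\<^sup>2) \<partial>M)"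
    by (rule nn_integral_suminf) simp
  also have "\<dots> = (\<Sum>k. ennreal (expectation (\<lambda>x. (Z k x)\<^sup>2)))"
    using Z by (simp add: nn_integral_eq_integral)
  also have "\<dots> = ennreal (\<Sum>k. expectation (\<lambda>x. (Z k x)\<^sup>2))"
    using s by (intro suminf_ennreal2) auto
  finally have "(\<integral>\<^sup>+x. (\<Sum>k. ennreal ((Z k x)\<^sup>2)) \<partial>M) \<noteq> \<infinity>" by simp
  then have "AE x in M. (\<Sum>k. ennreal ((Z k x)\<^sup>2)) \<noteq> \<infinity>"
    by (intro nn_integral_PInf_AE) simp
  then show ?thesis
  proof eventually_elim
    fix x assume "(\<Sum>k. ennreal ((Z k x)\<^sup>2)) \<noteq> \<infinity>"
    then have "summable (\<lambda>k. (Z k x)\<^sup>2)"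
      by (intro summable_suminf_not_top) auto
    then have "(\<lambda>k. (Z k x)\<^sup>2) \<longlonglongrightarrow> 0" by (rule summable_LIMSEQ_zero)
    then have "(\<lambda>k. sqrt ((Z k x)\<^sup>2)) \<longlonglongrightarrow> sqrt 0" by (rule tendsto_real_sqrt)
    then show "(\<lambda>k. Z k x) \<longlonglongrightarrow> 0"
      by (simp add: tendsto_rabs_zero_iff)
  qed
qed

lemma second_moment_orthogonal_sum:
  fixes Z :: "'i \<Rightarrow> 'a \<Rightarrow> real"
  assumes "finite I" and i: "\<And>i j. i \<in> I \<Longrightarrow> j \<in> I \<Longrightarrow> integrable M (\<lambda>x. Z i x * Z j x)"
    and o: "\<And>i j. i \<in> I \<Longrightarrow> j \<in> I \<Longrightarrow> i \<noteq> j \<Longrightarrow> expectation (\<lambda>x. Z i x * Z j x) = 0"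
  shows "integrable M (\<lambda>x. (\<Sum>i\<in>I. Z i x)\<^sup>2)"
    and "expectation (\<lambda>x. (\<Sum>i\<in>I. Z i x)\<^sup>2) = (\<Sum>i\<in>I. expectation (\<lambda>x. (Z i x)\<^sup>2))"
proof -
  have eq: "(\<Sum>i\<in>I. Z i x)\<^sup>2 = (\<Sum>i\<in>I. \<Sum>j\<in>I. 1 * (Z i x * Z j x))" for x
    by (simp add: power2_eq_square sum_product)
  show "integrable M (\<lambda>x. (\<Sum>i\<in>I. Z i x)\<^sup>2)"
    unfolding eq by (intro integral_double_sum i)
  have "expectation (\<lambda>x. (\<Sum>i\<in>I. Z i x)\<^sup>2) = (\<Sum>i\<in>I. \<Sum>j\<in>I. 1 * expectation (\<lambda>x. Z i x * Z j x))"
    unfolding eq by (intro integral_double_sum i)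
  also have "\<dots> = (\<Sum>i\<in>I. \<Sum>j\<in>I. if i = j then expectation (\<lambda>x. Z i x * Z i x) else 0)"
    using o by (intro sum.cong refl) auto
  also have "\<dots> = (\<Sum>i\<in>I. expectation (\<lambda>x. (Z i x)\<^sup>2))"
    using \<open>finite I\<close> by (simp add: sum.delta power2_eq_square)
  finally show "expectation (\<lambda>x. (\<Sum>i\<in>I. Z i x)\<^sup>2) = (\<Sum>i\<in>I. expectation (\<lambda>x. (Z i x)\<^sup>2))" .
qed

lemma second_moment_add_le:
  fixes X Y :: "'a \<Rightarrow> real"
  assumes [measurable]: "X \<in> borel_measurable M" "Y \<in> borel_measurable M"
    and X: "integrable M (\<lambda>z. (X z)\<^sup>2)" and Y: "integrable M (\<lambda>z. (Y z)\<^sup>2)"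
  shows "integrable M (\<lambda>z. (X z + Y z)\<^sup>2)"
    and "expectation (\<lambda>z. (X z + Y z)\<^sup>2) \<le> 2 * expectation (\<lambda>z. (X z)\<^sup>2) + 2 * expectation (\<lambda>z. (Y z)\<^sup>2)"
proof -
  have le: "(x + y)\<^sup>2 \<le> 2 * x\<^sup>2 + 2 * y\<^sup>2" for x y :: real
    using sum_squares_bound[of x y] by (simp add: power2_sum)
  show i: "integrable M (\<lambda>z. (X z + Y z)\<^sup>2)"
    by (rule Bochner_Integration.integrable_bound[of M "\<lambda>z. 2 * (X z)\<^sup>2 + 2 * (Y z)\<^sup>2"]) (use X Y le in auto)
  have "expectation (\<lambda>z. (X z + Y z)\<^sup>2) \<le> expectation (\<lambda>z. 2 * (X z)\<^sup>2 + 2 * (Y z)\<^sup>2)"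
    using i X Y le by (intro integral_mono) auto
  then show "expectation (\<lambda>z. (X z + Y z)\<^sup>2) \<le> 2 * expectation (\<lambda>z. (X z)\<^sup>2) + 2 * expectation (\<lambda>z. (Y z)\<^sup>2)"
    using X Y by simp
qed

lemma normal_distributed_moments:
  assumes D: "distributed M lborel D (normal_density 0 s)" and s: "0 < s"
  shows "integrable M (\<lambda>z. (D z) ^ n)" "expectation D = 0"
    "expectation (\<lambda>z. (D z)\<^sup>2) = s\<^sup>2" "expectation (\<lambda>z. (D z) ^ 4) = 3 * s ^ 4"
proof -
  have e: "expectation (\<lambda>z. (D z) ^ n) = (\<integral>x. normal_density 0 s x * x ^ n \<partial>lborel)" for n
    by (rule distributed_integral[OF D, symmetric]) auto
  show "integrable M (\<lambda>z. (D z) ^ n)"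
    using integrable_normal_moment[OF s, of 0 n] by (subst distributed_integrable[OF D, symmetric]) auto
  show "expectation D = 0" using e[of 1] integral_normal_moment_odd[OF s, of 0 0] by simp
  show "expectation (\<lambda>z. (D z)\<^sup>2) = s\<^sup>2"
    using e[of 2] integral_normal_moment_even[OF s, of 0 1] by simp
  show "expectation (\<lambda>z. (D z) ^ 4) = 3 * s ^ 4"
    using e[of 4] integral_normal_moment_even[OF s, of 0 2] by (simp add: fact_numeral power_divide field_simps)
qed

section \<open>Wiener increments and their interaction with the fBm\<close>

lemma wiener_increment_moments:
  assumes W: "wiener_process W" and T: "0 < T" and n: "0 < n"
  shows "integrable M (\<lambda>x. (increment T W n i x) ^ p)"
    and "expectation (increment T W n i) = 0"
    and "expectation (\<lambda>x. (increment T W n i x)\<^sup>2) = T / real n"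
    and "expectation (\<lambda>x. ((increment T W n i x)\<^sup>2 - T / real n)\<^sup>2) = 2 * (T / real n)\<^sup>2"
    and "integrable M (\<lambda>x. ((increment T W n i x)\<^sup>2 - T / real n)\<^sup>2)"
proof -
  have "T * real (i + 1) / real n - T * real i / real n = T / real n"
    by (simp add: diff_divide_distrib[symmetric] algebra_simps)
  moreover have "0 \<le> T * real i / real n \<and> T * real i / real n < T * real (i + 1) / real n"
    using T n by (auto simp: divide_strict_right_mono)
  ultimately have D: "distributed M lborel (increment T W n i) (normal_density 0 (sqrt (T / real n)))"
    using W unfolding wiener_process_def increment_def[abs_def] by metis
  have s: "0 < sqrt (T / real n)" using T n by simp
  note m = normal_distributed_moments[OF D s]
  show "integrable M (\<lambda>x. (increment T W n i x) ^ p)" "expectation (increment T W n i) = 0"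
    by (rule m)+
  have s2: "(sqrt (T / real n))\<^sup>2 = T / real n" using T n by simp
  then show v: "expectation (\<lambda>x. (increment T W n i x)\<^sup>2) = T / real n" using m(3) by simp
  have s4: "(sqrt (T / real n)) ^ 4 = (T / real n)\<^sup>2"
  proof -
    have "(sqrt (T / real n)) ^ 4 = ((sqrt (T / real n))\<^sup>2)\<^sup>2" by (simp only: power_mult[symmetric]) simp
    then show ?thesis by (simp only: s2)
  qed
  have eq: "((increment T W n i x)\<^sup>2 - T / real n)\<^sup>2 = (increment T W n i x) ^ 4 - 2 * (T / real n) * (increment T W n i x)\<^sup>2 + (T / real n)\<^sup>2" for x
    by (simp add: power2_eq_square power4_eq_xxxx algebra_simps)
  show "integrable M (\<lambda>x. ((increment T W n i x)\<^sup>2 - T / real n)\<^sup>2)"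
    unfolding eq using m(1) by simp
  have "expectation (\<lambda>x. ((increment T W n i x)\<^sup>2 - T / real n)\<^sup>2) = 3 * (T / real n)\<^sup>2 - 2 * (T / real n) * (T / real n) + (T / real n)\<^sup>2"
    unfolding eq using m(1) v m(4) unfolding s4 by (simp add: prob_space)
  then show "expectation (\<lambda>x. ((increment T W n i x)\<^sup>2 - T / real n)\<^sup>2) = 2 * (T / real n)\<^sup>2"
    by (simp add: power2_eq_square)
qed

lemma wiener_increments_indep:
  assumes W: "wiener_process W" and T: "0 < T" and n: "0 < n" and ij: "i < n" "j < n" "i \<noteq> j"
  shows "indep_var borel (increment T W n i) borel (increment T W n j)"
proof -
  define \<tau> where "\<tau> i = T * real i / real n" for i
  have "0 \<le> \<tau> 0 \<and> mono \<tau>"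
    using T n by (auto simp: \<tau>_def mono_def divide_right_mono)
  moreover have "\<forall>(n::nat) \<tau>. 0 \<le> \<tau> 0 \<and> mono \<tau> \<longrightarrow>
      indep_vars (\<lambda>_. borel) (\<lambda>i x. W (\<tau> (Suc i)) x - W (\<tau> i) x) {..<n}"
    using W unfolding wiener_process_def by blast
  ultimately have "indep_vars (\<lambda>_. borel) (\<lambda>i x. W (\<tau> (Suc i)) x - W (\<tau> i) x) {..<n}" by blast
  moreover have "(\<lambda>i x. W (\<tau> (Suc i)) x - W (\<tau> i) x) = increment T W n"
    by (intro ext) (simp add: increment_def \<tau>_def)
  ultimately have I: "indep_vars (\<lambda>_. borel) (increment T W n) {..<n}" by simp
  have "indep_var borel ((\<lambda>f. f i) \<circ> (\<lambda>x. restrict (\<lambda>i. increment T W n i x) {i}))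
       borel ((\<lambda>f. f j) \<circ> (\<lambda>x. restrict (\<lambda>i. increment T W n i x) {j}))"
    by (rule indep_var_compose[OF indep_var_restrict[OF I]]) (use ij in auto)
  then show ?thesis by (simp add: comp_def)
qed

lemma wiener_quad_var_second_moment:
  assumes W: "wiener_process W" and T: "0 < T" and n: "0 < n"
  shows "integrable M (\<lambda>z. (quad_var T W n z - T)\<^sup>2)"
    and "expectation (\<lambda>z. (quad_var T W n z - T)\<^sup>2) = 2 * T\<^sup>2 / real n"
proof -
  define Z where "Z i z = (increment T W n i z)\<^sup>2 - T / real n" for i z
  note m = wiener_increment_moments[OF W T n]
  have Z1: "integrable M (Z i)" "expectation (Z i) = 0" for i
    unfolding Z_def[abs_def] using m(1)[of i 2] m(3) by (simp_all add: prob_space)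
  have ind: "indep_var borel (Z i) borel (Z j)" if "i < n" "j < n" "i \<noteq> j" for i j
    using indep_var_compose[OF wiener_increments_indep[OF W T n that], of "\<lambda>x. x\<^sup>2 - T / real n" borel "\<lambda>x. x\<^sup>2 - T / real n" borel]
    unfolding Z_def[abs_def] comp_def by simp
  have o: "integrable M (\<lambda>z. Z i z * Z j z)" "i \<noteq> j \<Longrightarrow> expectation (\<lambda>z. Z i z * Z j z) = 0"
    if ij: "i \<in> {..<n}" "j \<in> {..<n}" for i j
  proof -
    show "integrable M (\<lambda>z. Z i z * Z j z)"
    proof (cases "i = j")
      case True
      then show ?thesis using m(5)[of i] by (simp add: Z_def power2_eq_square)
    next
      case False
      then show ?thesis using ij by (intro indep_var_integrable ind Z1) auto
    qed
    show "expectation (\<lambda>z. Z i z * Z j z) = 0" if "i \<noteq> j"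
      using ij that Z1 by (subst indep_var_lebesgue_integral[OF ind]) auto
  qed
  have eq: "quad_var T W n z - T = (\<Sum>i\<in>{..<n}. Z i z)" for z
    unfolding quad_var_def Z_def using n by (simp add: sum_subtractf)
  show "integrable M (\<lambda>z. (quad_var T W n z - T)\<^sup>2)"
    unfolding eq by (rule second_moment_orthogonal_sum) (use o in auto)
  have "expectation (\<lambda>z. (quad_var T W n z - T)\<^sup>2) = (\<Sum>i\<in>{..<n}. expectation (\<lambda>z. (Z i z)\<^sup>2))"
    unfolding eq by (rule second_moment_orthogonal_sum) (use o in auto)
  also have "\<dots> = 2 * T\<^sup>2 / real n"
    unfolding Z_def using m(4) n by (simp add: power2_eq_square)
  finally show "expectation (\<lambda>z. (quad_var T W n z - T)\<^sup>2) = 2 * T\<^sup>2 / real n" .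
qed

text \<open>Independence is given for whole paths in the product space; a product of two increments
  is a measurable functional of finitely many coordinates.\<close>

lemma indep_processes_increments:
  assumes "indep_processes {0..} B W" and "0 \<le> T"
  shows "indep_var borel (\<lambda>x. increment T B n i x * increment T B n j x)
    borel (\<lambda>x. increment T W n i x * increment T W n j x)"
proof -
  define h where "h f = (f (T * real (i + 1) / real n) - f (T * real i / real n)) *
     (f (T * real (j + 1) / real n) - f (T * real j / real n))" for f :: "real \<Rightarrow> real"
  have t: "T * real k / real n \<in> {0..}" for k using assms(2) by simp
  have [measurable]: "h \<in> borel_measurable (PiM {0..} (\<lambda>_. borel))"
    unfolding h_def using t by (intro borel_measurable_times borel_measurable_diff measurable_component_singleton)
  have "indep_var borel (h \<circ> (\<lambda>x. \<lambda>t\<in>{0..}. B t x)) borel (h \<circ> (\<lambda>x. \<lambda>t\<in>{0..}. W t x))"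
    using assms(1) unfolding indep_processes_def by (rule indep_var_compose) measurable
  then show ?thesis using t unfolding comp_def h_def increment_def by (simp only: restrict_apply if_True)
qed

end

context fbm_space
begin

lemma increment_second_moment:
  assumes "0 < T" "0 < n"
  shows "expectation (\<lambda>x. (increment T B n i x)\<^sup>2) = (T / real n) powr (2 * H)"
    and "integrable M (\<lambda>x. increment T B n i x * increment T B n j x)"
    and "increment T B n i \<in> borel_measurable M"
proof -
  have m: "increment T B n i \<in> fbm_span B" for i
    unfolding increment_def[abs_def] using assms by (intro increment_mem) auto
  then show "integrable M (\<lambda>x. increment T B n i x * increment T B n j x)" by (intro integrable_mult)
  show "increment T B n i \<in> borel_measurable M" using m by (rule rv)
  have "\<bar>T * real (i + 1) / real n - T * real i / real n\<bar> = T / real n"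
    using assms by (simp add: diff_divide_distrib[symmetric] algebra_simps)
  then show "expectation (\<lambda>x. (increment T B n i x)\<^sup>2) = (T / real n) powr (2 * H)"
    unfolding increment_def power2_eq_square using assms
    by (subst expectation_increments) (auto simp: fbm_cov_def abs_minus_commute)
qed

text \<open>The fBm increments are correlated, but those of \<open>W\<close> are centred,
  independent of each other and of \<open>B\<close>. The products are therefore orthogonal, and the
  second moment is a sum of \<open>n\<close> equal terms.\<close>

lemma cross_variation_second_moment:
  assumes W: "wiener_process W" and T: "0 < T" and n: "0 < n" and BW: "indep_processes {0..} B W"
  shows "integrable M (\<lambda>x. (\<Sum>i<n. increment T B n i x * increment T W n i x)\<^sup>2)"
    and "expectation (\<lambda>x. (\<Sum>i<n. increment T B n i x * increment T W n i x)\<^sup>2) = T * (T / real n) powr (2 * H)"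
proof -
  define Z where "Z i x = increment T B n i x * increment T W n i x" for i x
  note m = wiener_increment_moments[OF W T n]
  have iW: "integrable M (\<lambda>x. increment T W n i x * increment T W n j x)"
    if "i < n" "j < n" for i j
  proof (cases "i = j")
    case True
    then show ?thesis using m(1)[of i 2] by (simp add: power2_eq_square)
  next
    case False
    then show ?thesis using m(1)[of _ 1] that by (intro indep_var_integrable wiener_increments_indep[OF W T n]) auto
  qed
  have ZZ: "Z i x * Z j x = (increment T B n i x * increment T B n j x) * (increment T W n i x * increment T W n j x)" for i j x
    by (simp add: Z_def)
  have ind: "indep_var borel (\<lambda>x. increment T B n i x * increment T B n j x)
    borel (\<lambda>x. increment T W n i x * increment T W n j x)" for i j
    using BW T by (intro indep_processes_increments) auto
  have iZ: "integrable M (\<lambda>x. Z i x * Z j x)"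
    "expectation (\<lambda>x. Z i x * Z j x) = expectation (\<lambda>x. increment T B n i x * increment T B n j x)
      * expectation (\<lambda>x. increment T W n i x * increment T W n j x)" if "i < n" "j < n" for i j
    unfolding ZZ using ind iW[OF that] increment_second_moment(2)[OF T n]
    by (auto intro: indep_var_integrable indep_var_lebesgue_integral)
  have o: "expectation (\<lambda>x. Z i x * Z j x) = 0" if "i < n" "j < n" "i \<noteq> j" for i j
  proof -
    have "expectation (\<lambda>x. increment T W n i x * increment T W n j x) = 0"
      using m(1)[of _ 1] m(2) by (subst indep_var_lebesgue_integral[OF wiener_increments_indep[OF W T n that]]) auto
    then show ?thesis using iZ that by simp
  qed
  show "integrable M (\<lambda>x. (\<Sum>i<n. increment T B n i x * increment T W n i x)\<^sup>2)"
    unfolding Z_def[symmetric] by (rule second_moment_orthogonal_sum) (use iZ o in auto)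
  have "expectation (\<lambda>x. (\<Sum>i<n. Z i x)\<^sup>2) = (\<Sum>i<n. expectation (\<lambda>x. (Z i x)\<^sup>2))"
    by (rule second_moment_orthogonal_sum) (use iZ o in auto)
  also have "\<dots> = (\<Sum>i<n. (T / real n) powr (2 * H) * (T / real n))"
    using iZ(2) increment_second_moment(1)[OF T n] m(3) by (intro sum.cong refl) (simp add: power2_eq_square)
  also have "\<dots> = T * (T / real n) powr (2 * H)" using n by simp
  finally show "expectation (\<lambda>x. (\<Sum>i<n. increment T B n i x * increment T W n i x)\<^sup>2) = T * (T / real n) powr (2 * H)"
    unfolding Z_def .
qed

text \<open>9 = 2 * (3/2) * 3: the factor 2 of \<open>variance_quad\<close>, the bound 3/2 for one
  factor of each squared covariance, and 3 for the row sum of the other.\<close>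

lemma unit_quad_var_second_moment:
  assumes n: "0 < n"
  defines "q \<equiv> \<lambda>x. \<Sum>i<n. (B (real i + 1) x - B (real i) x)\<^sup>2"
  shows "integrable M (\<lambda>x. (q x / n - 1)\<^sup>2)" and "expectation (\<lambda>x. (q x / n - 1)\<^sup>2) \<le> 9 / n"
proof -
  define Y where "Y i x = B (real i + 1) x - B (real i) x" for i x
  have Y: "Y i \<in> fbm_span B" for i unfolding Y_def[abs_def] by (intro increment_mem) auto
  have r: "expectation (\<lambda>x. Y i x * Y j x) = fgn_cov H ((i - j) + (j - i))" for i j
    unfolding Y_def using fbm_cov_grid[of 1 H i j] by (subst expectation_increments) (auto simp: add.commute)
  have q: "q = (\<lambda>x. \<Sum>i<n. 1 * (Y i x)\<^sup>2)" unfolding q_def Y_def by simp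
  have H: "0 < H" "H < 1 / 2" using H_pos H_less by auto
  have iq: "integrable M q" "integrable M (\<lambda>x. (q x)\<^sup>2)"
    unfolding q by (intro integrable_quad Y finite_lessThan)+
  have Eq: "expectation q = n"
  proof -
    have "expectation q = (\<Sum>i<n. expectation (\<lambda>x. 1 * (Y i x)\<^sup>2))"
      unfolding q using integrable_power[OF Y] by (intro Bochner_Integration.integral_sum) simp
    moreover have "expectation (\<lambda>x. 1 * (Y i x)\<^sup>2) = 1" for i
      using r[of i i] by (simp add: power2_eq_square fgn_cov_def)
    ultimately show ?thesis by simp
  qed
  have eq: "(q x / n - 1)\<^sup>2 = (q x - expectation q)\<^sup>2 / n\<^sup>2" for x
  proof -
    have "q x / n - 1 = (q x - expectation q) / n" unfolding Eq using n by (simp add: diff_divide_distrib)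
    then show ?thesis by (simp only: power_divide of_nat_power)
  qed
  have "(q x - expectation q)\<^sup>2 = (q x)\<^sup>2 - 2 * n * q x + n\<^sup>2" for x
    unfolding Eq by (simp add: power2_eq_square algebra_simps)
  then show "integrable M (\<lambda>x. (q x / n - 1)\<^sup>2)" unfolding eq using iq by simp
  have "variance q = 2 * (\<Sum>i<n. \<Sum>j<n. 1 * 1 * (expectation (\<lambda>x. Y i x * Y j x))\<^sup>2)"
    unfolding q by (rule variance_quad) (auto intro: Y)
  also have "\<dots> \<le> 2 * (\<Sum>i<n. 3 / 2 * (\<Sum>j<n. \<bar>fgn_cov H ((j - i) + (i - j))\<bar>))"
    unfolding sum_distrib_left[of "3/2"] r
  proof (intro mult_left_mono sum_mono)
    fix i j
    have "\<bar>fgn_cov H k\<bar> \<le> 3 / 2" for k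
    proof -
      have "\<bar>fgn_cov H k\<bar> \<le> (\<Sum>j<Suc k. \<bar>fgn_cov H j\<bar>)"
        by (intro member_le_sum[of k "{..<Suc k}" "\<lambda>j. \<bar>fgn_cov H j\<bar>"]) auto
      also have "\<dots> \<le> 3 / 2" by (rule sum_abs_fgn_cov_le[OF H])
      finally show ?thesis .
    qed
    from mult_right_mono[OF this, of "\<bar>fgn_cov H ((i - j) + (j - i))\<bar>" "(i - j) + (j - i)"]
    show "1 * 1 * (fgn_cov H ((i - j) + (j - i)))\<^sup>2 \<le> 3 / 2 * \<bar>fgn_cov H ((j - i) + (i - j))\<bar>"
      by (simp add: power2_eq_square add.commute)
  qed simp
  also have "\<dots> \<le> 2 * (\<Sum>i<n. 3 / 2 * 3)"
    by (intro mult_left_mono sum_mono sum_abs_fgn_cov_distance_le H) auto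
  finally have "variance q / n\<^sup>2 \<le> 9 * n / n\<^sup>2" by (intro divide_right_mono) auto
  also have "\<dots> = 9 / n" using n by (simp add: power2_eq_square)
  finally show "expectation (\<lambda>x. (q x / n - 1)\<^sup>2) \<le> 9 / n" unfolding eq by simp
qed

end

section \<open>Asymptotics of the estimator\<close>

lemma abs_ln_one_plus_le:
  fixes y :: real
  assumes "\<bar>y\<bar> \<le> 1 / 2"
  shows "\<bar>ln (1 + y)\<bar> \<le> 2 * \<bar>y\<bar>"
proof -
  have "\<bar>ln (1 + y) - y\<bar> \<le> 2 * y\<^sup>2" by (rule abs_ln_one_plus_x_minus_x_bound[OF assms])
  moreover have "2 * y\<^sup>2 \<le> \<bar>y\<bar>"
    using mult_right_mono[OF assms, of "2 * \<bar>y\<bar>"] by (simp add: power2_eq_square)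
  ultimately show ?thesis by linarith
qed

text \<open>\<open>U k\<close> and \<open>U (k + 1)\<close> are eventually both negative, so their
  ratio is positive and \<open>log2_plus\<close> is a logarithm there. The ratio is
  \<open>(1 + y k) / \<kappa>\<close>, and \<open>log 2 \<kappa> = 1 - 2 * H\<close> is what yields
  \<open>H\<close>.\<close>

lemma estimator_eq_ln:
  fixes U h :: "nat \<Rightarrow> real" and H L :: real
  defines "\<kappa> \<equiv> 2 powr (1 - 2 * H)"
  assumes L: "0 < L" and U: "\<And>k. U k = \<kappa> ^ k * (- L + h k)" and h: "h \<longlonglongrightarrow> 0"
  defines "y \<equiv> \<lambda>k. (h k - h (Suc k)) / (- L + h (Suc k))"
  shows "y \<longlonglongrightarrow> 0"
    and "\<forall>\<^sub>F k in sequentially. 1 / 2 * (log2_plus (U k / U (k + 1)) + 1) - H = ln (1 + y k) / (2 * ln 2)"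
proof -
  have \<kappa>: "0 < \<kappa>" unfolding \<kappa>_def by simp
  have hS: "(\<lambda>k. h (Suc k)) \<longlonglongrightarrow> 0" using h by (rule LIMSEQ_Suc)
  have "y \<longlonglongrightarrow> (0 - 0) / (- L + 0)"
    unfolding y_def using L by (intro tendsto_intros h hS) auto
  then show "y \<longlonglongrightarrow> 0" by simp
  have "\<forall>\<^sub>F k in sequentially. h k < L" using order_tendstoD(2)[OF h L] .
  moreover have "\<forall>\<^sub>F k in sequentially. h (Suc k) < L" using order_tendstoD(2)[OF hS L] .
  ultimately show "\<forall>\<^sub>F k in sequentially. 1 / 2 * (log2_plus (U k / U (k + 1)) + 1) - H = ln (1 + y k) / (2 * ln 2)"
  proof eventually_elim
    case (elim k)
    have ratio: "U k / U (k + 1) = (1 + y k) / \<kappa>"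
      unfolding U y_def using \<kappa> elim by (simp add: field_simps)
    have pos: "1 + y k = (L - h k) / (L - h (Suc k))"
      unfolding y_def using elim by (simp add: field_simps)
    then have y1: "0 < 1 + y k" using elim by simp
    then have "log2_plus (U k / U (k + 1)) = log 2 (1 + y k) - (1 - 2 * H)"
      unfolding ratio log2_plus_def using \<kappa> by (simp add: log_divide) (simp add: \<kappa>_def)
    then show ?case by (simp add: log_def field_simps)
  qed
qed

text \<open>\<open>y\<close> inherits the rate of \<open>h\<close>, and the logarithm costs at most
  a factor 2. The scale \<open>c\<close> may decay, as it does in the application with large
  \<epsilon>; this is why the convergence of \<open>h\<close> itself is a separate
  hypothesis.\<close>

lemma estimator_rate:
  fixes U h c :: "nat \<Rightarrow> real" and H L :: real
  assumes L: "0 < L" and U: "\<And>k. U k = (2 powr (1 - 2 * H)) ^ k * (- L + h k)" and h: "h \<longlonglongrightarrow> 0"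
    and c: "(\<lambda>k. c k * h k) \<longlonglongrightarrow> 0" "(\<lambda>k. c k * h (Suc k)) \<longlonglongrightarrow> 0"
  shows "(\<lambda>k. c k * (1 / 2 * (log2_plus (U k / U (k + 1)) + 1) - H)) \<longlonglongrightarrow> 0"
proof -
  define y where "y k = (h k - h (Suc k)) / (- L + h (Suc k))" for k
  note e = estimator_eq_ln[OF L U h, folded y_def]
  have cy: "(\<lambda>k. c k * y k) \<longlonglongrightarrow> 0"
  proof -
    have "(\<lambda>k. (c k * h k - c k * h (Suc k)) / (- L + h (Suc k))) \<longlonglongrightarrow> (0 - 0) / (- L + 0)"
      using L by (intro tendsto_intros c LIMSEQ_Suc h) auto
    then show ?thesis unfolding y_def by (simp add: right_diff_distrib)
  qed
  have "(\<lambda>k. 2 * \<bar>c k * y k\<bar> / (2 * ln 2)) \<longlonglongrightarrow> 2 * \<bar>0\<bar> / (2 * ln 2)"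
    by (intro tendsto_intros cy) auto
  then have lim: "(\<lambda>k. 2 * \<bar>c k * y k\<bar> / (2 * ln 2)) \<longlonglongrightarrow> 0" by simp
  have "\<forall>\<^sub>F k in sequentially. \<bar>y k\<bar> < 1 / 2"
    using tendstoD[OF e(1), of "1/2"] by simp
  with e(2) have "\<forall>\<^sub>F k in sequentially. norm (c k * (1 / 2 * (log2_plus (U k / U (k + 1)) + 1) - H))
      \<le> 2 * \<bar>c k * y k\<bar> / (2 * ln 2)"
  proof eventually_elim
    case (elim k)
    have "\<bar>c k\<bar> * \<bar>ln (1 + y k)\<bar> \<le> \<bar>c k\<bar> * (2 * \<bar>y k\<bar>)"
      using elim by (intro mult_left_mono abs_ln_one_plus_le) auto
    then have "\<bar>c k\<bar> * \<bar>ln (1 + y k)\<bar> / (2 * ln 2) \<le> \<bar>c k\<bar> * (2 * \<bar>y k\<bar>) / (2 * ln 2)"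
      by (intro divide_right_mono) auto
    moreover have "norm (c k * (ln (1 + y k) / (2 * ln 2))) = \<bar>c k\<bar> * \<bar>ln (1 + y k)\<bar> / (2 * ln 2)"
      by (simp add: abs_mult)
    moreover have "2 * \<bar>c k * y k\<bar> = \<bar>c k\<bar> * (2 * \<bar>y k\<bar>)" by (simp add: abs_mult)
    ultimately show ?case unfolding elim(1) by (simp only:)
  qed
  then show ?thesis by (rule Lim_null_comparison[OF _ lim])
qed

text \<open>\<open>2 powr (k / 2)\<close> is the square of \<open>2 powr (k / 4)\<close>, so the
  assumed rate makes every term quadratic in \<open>h\<close> negligible. The plus sign in the
  conclusion reflects that the denominator of \<open>y\<close> tends to \<open>- L\<close>.\<close>

lemma estimator_linearization:
  fixes U h :: "nat \<Rightarrow> real" and H L :: real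
  assumes L: "0 < L" and U: "\<And>k. U k = (2 powr (1 - 2 * H)) ^ k * (- L + h k)"
    and h: "(\<lambda>k. 2 powr (k / 4) * h k) \<longlonglongrightarrow> 0"
  shows "(\<lambda>k. 2 powr (k / 2) * (1 / 2 * (log2_plus (U k / U (k + 1)) + 1) - H)
     + 2 powr (k / 2) * (h k - h (Suc k)) / (2 * L * ln 2)) \<longlonglongrightarrow> 0"
proof -
  define d :: "nat \<Rightarrow> real" where "d k = 2 powr (k / 4)" for k
  have d2: "2 powr (real k / 2) = (d k)\<^sup>2" for k
    unfolding d_def by (simp add: power2_eq_square powr_add[symmetric])
  have d1: "1 \<le> d k" for k unfolding d_def by (simp add: ge_one_powr_ge_zero)
  have dh: "(\<lambda>k. d k * h k) \<longlonglongrightarrow> 0" using h unfolding d_def .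
  have dhS: "(\<lambda>k. d k * h (Suc k)) \<longlonglongrightarrow> 0"
  proof (rule Lim_null_comparison)
    show "(\<lambda>k. \<bar>d (Suc k) * h (Suc k)\<bar>) \<longlonglongrightarrow> 0"
      using LIMSEQ_Suc[OF dh] by (rule tendsto_rabs_zero)
    have "\<bar>d k\<bar> \<le> \<bar>d (Suc k)\<bar>" for k unfolding d_def by simp
    then show "\<forall>\<^sub>F k in sequentially. norm (d k * h (Suc k)) \<le> \<bar>d (Suc k) * h (Suc k)\<bar>"
      by (intro always_eventually allI) (simp only: real_norm_def abs_mult, intro mult_right_mono, auto)
  qed
  have h0: "h \<longlonglongrightarrow> 0"
  proof (rule Lim_null_comparison)
    show "(\<lambda>k. \<bar>d k * h k\<bar>) \<longlonglongrightarrow> 0" using dh by (rule tendsto_rabs_zero)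
    show "\<forall>\<^sub>F k in sequentially. norm (h k) \<le> \<bar>d k * h k\<bar>"
      using d1 by (intro always_eventually allI)
        (simp add: abs_mult, metis abs_ge_self abs_ge_zero mult_right_mono mult_1 order.trans)
  qed
  define y where "y k = (h k - h (Suc k)) / (- L + h (Suc k))" for k
  note e = estimator_eq_ln[OF L U h0, folded y_def]
  have hS: "(\<lambda>k. h (Suc k)) \<longlonglongrightarrow> 0" using h0 by (rule LIMSEQ_Suc)
  have dy: "(\<lambda>k. d k * y k) \<longlonglongrightarrow> 0"
  proof -
    have "(\<lambda>k. (d k * h k - d k * h (Suc k)) / (- L + h (Suc k))) \<longlonglongrightarrow> (0 - 0) / (- L + 0)"
      using L by (intro tendsto_intros dh dhS hS) auto
    then show ?thesis unfolding y_def by (simp add: right_diff_distrib)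
  qed
  \<comment> \<open>Two quadratic remainders: the logarithm against its linear part, and the
    denominator \<open>- L + h (Suc k)\<close> against \<open>- L\<close>.\<close>
  define z where "z k = (d k)\<^sup>2 * (ln (1 + y k) - y k) / (2 * ln 2)
     + (d k * h k - d k * h (Suc k)) * (d k * h (Suc k)) / ((- L + h (Suc k)) * (2 * L * ln 2))" for k
  have "z \<longlonglongrightarrow> 0"
  proof -
    have "(\<lambda>k. (d k)\<^sup>2 * (ln (1 + y k) - y k)) \<longlonglongrightarrow> 0"
    proof (rule Lim_null_comparison)
      have "(\<lambda>k. 2 * (d k * y k)\<^sup>2) \<longlonglongrightarrow> 2 * 0\<^sup>2" by (intro tendsto_intros dy)
      then show "(\<lambda>k. 2 * (d k * y k)\<^sup>2) \<longlonglongrightarrow> 0" by simp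
      have "\<forall>\<^sub>F k in sequentially. \<bar>y k\<bar> < 1 / 2" using tendstoD[OF e(1), of "1/2"] by simp
      then show "\<forall>\<^sub>F k in sequentially. norm ((d k)\<^sup>2 * (ln (1 + y k) - y k)) \<le> 2 * (d k * y k)\<^sup>2"
      proof eventually_elim
        case (elim k)
        have "(d k)\<^sup>2 * \<bar>ln (1 + y k) - y k\<bar> \<le> (d k)\<^sup>2 * (2 * (y k)\<^sup>2)"
          using elim by (intro mult_left_mono abs_ln_one_plus_x_minus_x_bound) auto
        then show ?case by (simp add: abs_mult power_mult_distrib)
      qed
    qed
    then have "z \<longlonglongrightarrow> 0 / (2 * ln 2) + (0 - 0) * 0 / ((- L + 0) * (2 * L * ln 2))"
      unfolding z_def using L by (intro tendsto_intros dh dhS hS) auto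
    then show ?thesis by simp
  qed
  moreover have "\<forall>\<^sub>F k in sequentially. z k = 2 powr (k / 2) * (1 / 2 * (log2_plus (U k / U (k + 1)) + 1) - H)
     + 2 powr (k / 2) * (h k - h (Suc k)) / (2 * L * ln 2)"
    using e(2) order_tendstoD(2)[OF hS L]
  proof eventually_elim
    case (elim k)
    have nz: "- L + h (Suc k) \<noteq> 0" "L \<noteq> 0" "ln (2::real) \<noteq> 0" using elim L by auto
    have "(d k)\<^sup>2 * y k / (2 * ln 2) + (d k)\<^sup>2 * (h k - h (Suc k)) / (2 * L * ln 2)
       = (d k * h k - d k * h (Suc k)) * (d k * h (Suc k)) / ((- L + h (Suc k)) * (2 * L * ln 2))"
      unfolding y_def using nz by (simp add: divide_simps) (simp add: algebra_simps power2_eq_square)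
    then show ?case unfolding elim(1) d2 z_def by (simp add: right_diff_distrib diff_divide_distrib)
  qed
  ultimately show ?thesis by (rule Lim_transform_eventually)
qed

text \<open>Slutsky's argument on the level of characteristic functions: \<open>iexp\<close> is
  bounded and 1-Lipschitz, so dominated convergence applies.\<close>

lemma (in prob_space) tendsto_expectation_iexp_diff:
  fixes X Y :: "nat \<Rightarrow> 'a \<Rightarrow> real"
  assumes [measurable]: "\<And>k. X k \<in> borel_measurable M" "\<And>k. Y k \<in> borel_measurable M"
    and lim: "AE z in M. (\<lambda>k. X k z - Y k z) \<longlonglongrightarrow> 0"
  shows "(\<lambda>k. expectation (\<lambda>z. iexp (X k z)) - expectation (\<lambda>z. iexp (Y k z))) \<longlonglongrightarrow> 0"
proof -
  have i: "integrable M (\<lambda>z. iexp (Z z))" if [measurable]: "Z \<in> borel_measurable M" for Z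
    by (rule integrable_const_bound[where B=1]) auto
  have "(\<lambda>k. expectation (\<lambda>z. iexp (X k z) - iexp (Y k z))) \<longlonglongrightarrow> expectation (\<lambda>z. 0)"
  proof (rule integral_dominated_convergence[where w = "\<lambda>_. 2"])
    show "AE z in M. (\<lambda>k. iexp (X k z) - iexp (Y k z)) \<longlonglongrightarrow> 0"
      using lim
    proof eventually_elim
      case (elim z)
      have "cmod (iexp x - iexp y) \<le> \<bar>x - y\<bar>" for x y
      proof -
        have "iexp x - iexp y = iexp y * (iexp (x - y) - 1)"
          by (simp add: right_diff_distrib exp_add[symmetric])
        then show ?thesis using iexp_approx1[of "x - y" 0] by (simp only: norm_mult norm_exp_i_times) simp
      qed
      then show ?case
        by (intro Lim_null_comparison[OF _ tendsto_rabs_zero[OF elim]] always_eventually allI)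
    qed
    show "AE z in M. norm (iexp (X k z) - iexp (Y k z)) \<le> 2" for k
      by (intro AE_I2 order.trans[OF norm_triangle_ineq4]) simp
  qed auto
  then show ?thesis using i by simp
qed

section \<open>The mixed model at dyadic levels\<close>

locale mixed_space = fbm_space M H B for M :: "'a measure" and H B +
  fixes W :: "real \<Rightarrow> 'a \<Rightarrow> real" and T a b :: real
  assumes T_pos: "0 < T" and a_pos: "0 < a" and b_pos: "0 < b"
    and wiener: "wiener_process W" and indep: "indep_processes {0..} B W"
begin

text \<open>The growth factor of the fBm variation from one dyadic level to the next: the mean of
  \<open>a\<^sup>2 * quad_var T B (2 ^ k)\<close> is \<open>amp * \<kappa> ^ k\<close>.\<close>

definition \<kappa> :: real where "\<kappa> = 2 powr (1 - 2 * H)"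
definition amp :: real where "amp = a\<^sup>2 * T powr (2 * H)"

definition rescaled :: "nat \<Rightarrow> real \<Rightarrow> 'a \<Rightarrow> real" where
  "rescaled k = (\<lambda>t x. (T / 2 ^ k) powr (- H) * B (T / 2 ^ k * t) x)"

definition unit_qv :: "nat \<Rightarrow> 'a \<Rightarrow> real" where
  "unit_qv k x = (\<Sum>i<2 ^ k. (rescaled k (real i + 1) x - rescaled k (real i) x)\<^sup>2)"

text \<open>The relative fluctuation of the quadratic variation at level \<open>k\<close> is split into \<open>fbm_err\<close>, of
  order \<open>2 powr (- k / 2)\<close>, and the negligible \<open>mix_err\<close>, which collects the terms involving \<open>W\<close>.\<close>

definition fbm_err :: "nat \<Rightarrow> 'a \<Rightarrow> real" where
  "fbm_err k x = amp * (unit_qv k x / 2 ^ k - 1)"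

definition mix_err :: "nat \<Rightarrow> 'a \<Rightarrow> real" where
  "mix_err k x = (2 * a * b * (\<Sum>i<2 ^ k. increment T B (2 ^ k) i x * increment T W (2 ^ k) i x)
     + b\<^sup>2 * (quad_var T W (2 ^ k) x - T)) / \<kappa> ^ k"

lemma \<kappa>_gt_1: "1 < \<kappa>"
  unfolding \<kappa>_def using H_less by simp

lemma amp_pos: "0 < amp"
  unfolding amp_def using a_pos T_pos by simp

lemma \<kappa>_power: "\<kappa> ^ k = 2 ^ k / (2 ^ k) powr (2 * H)"
proof -
  have "\<kappa> ^ k = (2 powr (1 - 2 * H)) powr real k"
    unfolding \<kappa>_def by (simp add: powr_realpow)
  also have "\<dots> = 2 powr (real k - real k * (2 * H))" by (simp add: powr_powr algebra_simps)
  also have "\<dots> = 2 powr real k / (2 powr real k) powr (2 * H)" by (simp add: powr_diff powr_powr)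
  finally show ?thesis by (simp add: powr_realpow)
qed

lemma scale_power: "(T / 2 ^ k) powr (2 * H) = T powr (2 * H) * \<kappa> ^ k / 2 ^ k"
  unfolding \<kappa>_power using T_pos by (simp add: powr_divide)

lemma increment_rescaled:
  "increment T B (2 ^ k) i z = (T / 2 ^ k) powr H * (rescaled k (real i + 1) z - rescaled k (real i) z)"
proof -
  have "(T / 2 ^ k) powr H * (T / 2 ^ k) powr (- H) = 1"
    using T_pos by (simp add: powr_add[symmetric])
  then have 1: "(T / 2 ^ k) powr H * ((T / 2 ^ k) powr (- H) * x) = x" for x
    by (simp add: mult.assoc[symmetric])
  show ?thesis
    unfolding rescaled_def right_diff_distrib 1 increment_def by (simp add: algebra_simps)
qed

lemma quad_var_fbm: "quad_var T B (2 ^ k) x = (T / 2 ^ k) powr (2 * H) * unit_qv k x"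
proof -
  have "((T / 2 ^ k) powr H)\<^sup>2 = (T / 2 ^ k) powr (2 * H)"
    by (simp add: power2_eq_square powr_add[symmetric])
  then show ?thesis
    unfolding quad_var_def unit_qv_def increment_rescaled power_mult_distrib by (simp add: sum_distrib_left)
qed

text \<open>The quadratic variation of \<open>W\<close> is centred at its mean \<open>T\<close>. The
  resulting term \<open>b\<^sup>2 * T\<close> does not depend on the level, so the difference of two
  levels removes it; this is the purpose of working with differences.\<close>

lemma quad_var_mixed:
  "quad_var T (mixed_model a b B W) (2 ^ k) x = \<kappa> ^ k * (amp + fbm_err k x + mix_err k x) + b\<^sup>2 * T"
proof -
  let ?n = "2 ^ k :: nat"
  have inc: "increment T (mixed_model a b B W) ?n i x = a * increment T B ?n i x + b * increment T W ?n i x" for i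
    by (simp add: increment_def mixed_model_def algebra_simps)
  have "quad_var T (mixed_model a b B W) ?n x = a\<^sup>2 * quad_var T B ?n x
     + 2 * a * b * (\<Sum>i<?n. increment T B ?n i x * increment T W ?n i x) + b\<^sup>2 * quad_var T W ?n x"
    unfolding quad_var_def inc
    by (simp add: power2_sum power_mult_distrib sum.distrib sum_distrib_left mult_ac)
  also have "a\<^sup>2 * quad_var T B ?n x = \<kappa> ^ k * (amp + fbm_err k x)"
    unfolding quad_var_fbm scale_power amp_def fbm_err_def by (simp add: algebra_simps)
  also have "2 * a * b * (\<Sum>i<?n. increment T B ?n i x * increment T W ?n i x)
     = \<kappa> ^ k * mix_err k x - b\<^sup>2 * (quad_var T W ?n x - T)"
    unfolding mix_err_def using \<kappa>_gt_1 by simp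
  finally show ?thesis by (simp add: algebra_simps)
qed

lemma fbm_rescaled: "fbm_space M H (rescaled k)"
  unfolding rescaled_def by (rule fbm_scaled) (use T_pos in simp)

text \<open>Read on the unit grid of level \<open>k\<close>, the cells of the next two levels are
  halves and quarters. Each halving of the mesh changes the normalisation of squares by
  \<open>2 powr (2 * H)\<close>.\<close>

lemma unit_qv_refine:
  "unit_qv (Suc k) x = 2 powr (2 * H) * (\<Sum>m<2 ^ k. sq_increment (rescaled k) (1 / 2) (real m) x
     + sq_increment (rescaled k) (1 / 2) (real m + 1 / 2) x)"
  "unit_qv (Suc (Suc k)) x = (2 powr (2 * H))\<^sup>2 * (\<Sum>m<2 ^ k. sq_increment (rescaled k) (1 / 4) (real m) x
     + sq_increment (rescaled k) (1 / 4) (real m + 1 / 4) x + sq_increment (rescaled k) (1 / 4) (real m + 1 / 2) x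
     + sq_increment (rescaled k) (1 / 4) (real m + 3 / 4) x)"
proof -
  have halve: "rescaled (Suc k) t x = 2 powr H * rescaled k (t / 2) x" for k t
  proof -
    have "(T / 2 ^ Suc k) powr (- H) = (T / 2 ^ k) powr (- H) * 2 powr H"
      using T_pos by (simp add: powr_divide powr_mult powr_minus field_simps)
    then show ?thesis unfolding rescaled_def by (simp add: mult_ac)
  qed
  have sq: "(2 powr H)\<^sup>2 = 2 powr (2 * H)" by (simp add: power2_eq_square powr_add[symmetric])
  have h1: "(rescaled (Suc k) (t + 1) x - rescaled (Suc k) t x)\<^sup>2 = 2 powr (2 * H) * sq_increment (rescaled k) (1/2) (t / 2) x" for t
    unfolding halve sq_increment_def right_diff_distrib[symmetric] power_mult_distrib sq by (simp add: add_divide_distrib)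
  have h2: "(rescaled (Suc (Suc k)) (t + 1) x - rescaled (Suc (Suc k)) t x)\<^sup>2
     = (2 powr (2 * H))\<^sup>2 * sq_increment (rescaled k) (1/4) (t / 4) x" for t
    unfolding halve sq_increment_def right_diff_distrib[symmetric] power_mult_distrib sq
    by (simp add: add_divide_distrib power2_eq_square)
  have g: "(\<Sum>i<n * l. f i) = (\<Sum>m<n. \<Sum>r<l. f (m * l + r))" for n l :: nat and f :: "nat \<Rightarrow> real"
  proof -
    have "(\<Sum>r<l. f (m * l + r)) = sum f {m * l..<m * l + l}" for m
      by (rule sum.reindex_bij_witness[of _ "\<lambda>q. q - m * l" "\<lambda>i. m * l + i"]) auto
    then show ?thesis by (simp only: sum.nat_group)
  qed
  show "unit_qv (Suc k) x = 2 powr (2 * H) * (\<Sum>m<2 ^ k. sq_increment (rescaled k) (1 / 2) (real m) x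
     + sq_increment (rescaled k) (1 / 2) (real m + 1 / 2) x)"
  proof -
    have n: "(2::nat) ^ Suc k = 2 ^ k * 2" by simp
    show ?thesis unfolding unit_qv_def h1 n g
      by (simp add: numeral_2_eq_2 sum_distrib_left distrib_left add_divide_distrib)
  qed
  show "unit_qv (Suc (Suc k)) x = (2 powr (2 * H))\<^sup>2 * (\<Sum>m<2 ^ k. sq_increment (rescaled k) (1 / 4) (real m) x
     + sq_increment (rescaled k) (1 / 4) (real m + 1 / 4) x + sq_increment (rescaled k) (1 / 4) (real m + 1 / 2) x
     + sq_increment (rescaled k) (1 / 4) (real m + 3 / 4) x)"
  proof -
    have n: "(2::nat) ^ Suc (Suc k) = 2 ^ k * 4" by simp
    have s4: "(\<Sum>r<4. f r) = f 0 + f 1 + f 2 + f (3::nat)" for f :: "nat \<Rightarrow> real"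
      by (simp add: numeral_eq_Suc)
    show ?thesis unfolding unit_qv_def h2 n g s4
      by (simp add: sum_distrib_left distrib_left add_divide_distrib add.commute)
  qed
qed

text \<open>The origin of the weights in \<open>theta\<close>. As
  \<open>\<kappa> = 1 / c_coeff H\<close>, and levels \<open>k + 1\<close> and \<open>k + 2\<close>
  carry the factors \<open>c_coeff H\<close> and \<open>(c_coeff H)\<^sup>2\<close> by refinement,
  the coefficients \<open>1 + \<kappa>\<close> and \<kappa> become \<open>c_coeff H + 1\<close> and
  \<open>c_coeff H\<close>. The constants inside \<open>fbm_err\<close> cancel because
  \<open>1 - (1 + \<kappa>) + \<kappa> = 0\<close>.\<close>

lemma fbm_err_combination:
  "2 powr (k / 2) * (fbm_err k x - (1 + \<kappa>) * fbm_err (Suc k) x + \<kappa> * fbm_err (Suc (Suc k)) x)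
    = amp * ((\<Sum>m<2 ^ k. theta H (rescaled k) m x) / sqrt (2 ^ k))"
proof -
  define n :: real where "n = 2 ^ k"
  define y where "y = (2::real) powr (2 * H)"
  have n: "0 < n" unfolding n_def by simp
  have y: "0 < y" unfolding y_def by simp
  have c: "c_coeff H = y / 2" unfolding c_coeff_def y_def by (simp add: powr_diff)
  have \<kappa>: "\<kappa> = 2 / y" unfolding \<kappa>_def y_def by (simp add: powr_diff)
  have root: "2 powr (real k / 2) = sqrt n"
  proof -
    have "2 powr (real k / 2) = (2 powr real k) powr (1 / 2)" by (simp add: powr_powr)
    then show ?thesis unfolding n_def by (simp add: powr_realpow powr_half_sqrt)
  qed
  define S0 where "S0 = (\<Sum>m<2 ^ k. sq_increment (rescaled k) 1 (real m) x)"
  define S1 where "S1 = (\<Sum>m<2 ^ k. sq_increment (rescaled k) (1 / 2) (real m) x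
     + sq_increment (rescaled k) (1 / 2) (real m + 1 / 2) x)"
  define S2 where "S2 = (\<Sum>m<2 ^ k. sq_increment (rescaled k) (1 / 4) (real m) x
     + sq_increment (rescaled k) (1 / 4) (real m + 1 / 4) x + sq_increment (rescaled k) (1 / 4) (real m + 1 / 2) x
     + sq_increment (rescaled k) (1 / 4) (real m + 3 / 4) x)"
  have q: "unit_qv k x = S0" "unit_qv (Suc k) x = y * S1" "unit_qv (Suc (Suc k)) x = y\<^sup>2 * S2"
    subgoal by (simp add: unit_qv_def S0_def sq_increment_def)
    subgoal by (simp only: unit_qv_refine(1) S1_def y_def)
    subgoal by (simp only: unit_qv_refine(2) S2_def y_def)
    done
  have \<theta>: "(\<Sum>m<2 ^ k. theta H (rescaled k) m x) = S0 - (c_coeff H + 1) * S1 + c_coeff H * S2"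
    unfolding theta_def S0_def S1_def S2_def by (simp only: sum_distrib_left sum.distrib[symmetric] sum_subtractf[symmetric])
  have "fbm_err k x - (1 + \<kappa>) * fbm_err (Suc k) x + \<kappa> * fbm_err (Suc (Suc k)) x
     = amp * (S0 - (c_coeff H + 1) * S1 + c_coeff H * S2) / n"
  proof -
    have "(2::real) ^ Suc k = 2 * n" "(2::real) ^ Suc (Suc k) = 4 * n" "(2::real) ^ k = n" unfolding n_def by simp_all
    then show ?thesis unfolding fbm_err_def q c \<kappa> using n y
      by (simp add: field_simps power2_eq_square)
  qed
  moreover have "sqrt n * (z / n) = z / sqrt n" for z
  proof -
    have "z / sqrt n = z * sqrt n / (sqrt n * sqrt n)"
      by (rule nonzero_mult_divide_mult_cancel_right[symmetric]) (use n in simp)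
    then show ?thesis using n by (simp add: mult.commute)
  qed
  ultimately show ?thesis
    unfolding \<theta> root n_def[symmetric] by (simp only: times_divide_eq_right)
qed

lemma fbm_err_second_moment:
  "integrable M (\<lambda>x. (fbm_err k x)\<^sup>2)"
  "expectation (\<lambda>x. (fbm_err k x)\<^sup>2) \<le> 9 * amp\<^sup>2 * (1 / 2) ^ k"
proof -
  interpret R: fbm_space M H "rescaled k" by (rule fbm_rescaled)
  note u = R.unit_quad_var_second_moment[of "2 ^ k"]
  have eq: "(fbm_err k x)\<^sup>2 = amp\<^sup>2 * ((\<Sum>i<2 ^ k. (rescaled k (real i + 1) x - rescaled k (real i) x)\<^sup>2) / real (2 ^ k) - 1)\<^sup>2" for x
    unfolding fbm_err_def unit_qv_def power_mult_distrib by simp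
  show "integrable M (\<lambda>x. (fbm_err k x)\<^sup>2)" unfolding eq using u by simp
  have "expectation (\<lambda>x. (fbm_err k x)\<^sup>2) \<le> amp\<^sup>2 * (9 / real (2 ^ k))"
    unfolding eq integral_mult_right_zero by (intro mult_left_mono u) auto
  then show "expectation (\<lambda>x. (fbm_err k x)\<^sup>2) \<le> 9 * amp\<^sup>2 * (1 / 2) ^ k"
    by (simp add: power_divide mult_ac)
qed

lemma W_measurable: "0 \<le> t \<Longrightarrow> W t \<in> borel_measurable M"
  using wiener by (simp add: wiener_process_def)

lemma quad_var_measurable:
  assumes "\<And>t. 0 \<le> t \<Longrightarrow> X t \<in> borel_measurable M"
  shows "quad_var T X n \<in> borel_measurable M"
  unfolding quad_var_def[abs_def] increment_def using T_pos
  by (intro borel_measurable_sum borel_measurable_power borel_measurable_diff assms) auto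

text \<open>The cross variation has second moment of order \<open>\<kappa> ^ k / 2 ^ k\<close>, the
  Wiener part of order \<open>1 / 2 ^ k\<close>. Division by \<open>(\<kappa> ^ k)\<^sup>2\<close>
  leaves a gain of at least \<open>1 / \<kappa> ^ k\<close> over \<open>1 / 2 ^ k\<close>, and
  \<open>\<kappa> > 1\<close> is exactly \<open>H < 1 / 2\<close>.\<close>

lemma mix_err_second_moment:
  shows "integrable M (\<lambda>x. (mix_err k x)\<^sup>2)"
    and "2 ^ k * expectation (\<lambda>x. (mix_err k x)\<^sup>2)
      \<le> (2 * (2 * a * b)\<^sup>2 * T * T powr (2 * H) + 4 * (b\<^sup>2)\<^sup>2 * T\<^sup>2) * (1 / \<kappa>) ^ k"
proof -
  let ?n = "2 ^ k :: nat"
  define X where "X x = 2 * a * b * (\<Sum>i<?n. increment T B ?n i x * increment T W ?n i x)" for x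
  define Y where "Y x = b\<^sup>2 * (quad_var T W ?n x - T)" for x
  have n: "0 < ?n" by simp
  have [measurable]: "increment T B n i \<in> borel_measurable M" "increment T W n i \<in> borel_measurable M" for n i
    unfolding increment_def[abs_def] using T_pos
    by (auto intro!: borel_measurable_diff fbm_measurable W_measurable)
  have [measurable]: "quad_var T W n \<in> borel_measurable M" for n by (rule quad_var_measurable[OF W_measurable])
  have m: "X \<in> borel_measurable M" "Y \<in> borel_measurable M"
    unfolding X_def[abs_def] Y_def[abs_def] by measurable
  note cv = cross_variation_second_moment[OF wiener T_pos n indep]
  note wq = wiener_quad_var_second_moment[OF wiener T_pos n]
  have iX: "integrable M (\<lambda>x. (X x)\<^sup>2)" "expectation (\<lambda>x. (X x)\<^sup>2) = (2 * a * b)\<^sup>2 * (T * (T / real ?n) powr (2 * H))"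
    unfolding X_def power_mult_distrib[of "2 * a * b"] using cv by simp_all
  have iY: "integrable M (\<lambda>x. (Y x)\<^sup>2)" "expectation (\<lambda>x. (Y x)\<^sup>2) = (b\<^sup>2)\<^sup>2 * (2 * T\<^sup>2 / real ?n)"
    unfolding Y_def power_mult_distrib[of "b\<^sup>2"] using wq by simp_all
  note s = second_moment_add_le[OF m iX(1) iY(1)]
  have eq: "(mix_err k x)\<^sup>2 = (X x + Y x)\<^sup>2 / (\<kappa> ^ k)\<^sup>2" for x
    unfolding mix_err_def X_def Y_def by (simp add: power_divide)
  show "integrable M (\<lambda>x. (mix_err k x)\<^sup>2)" unfolding eq using s(1) by simp
  have \<kappa>k: "1 \<le> \<kappa> ^ k" using \<kappa>_gt_1 by simp
  have "2 ^ k * expectation (\<lambda>x. (mix_err k x)\<^sup>2) = 2 ^ k * (expectation (\<lambda>x. (X x + Y x)\<^sup>2) / (\<kappa> ^ k)\<^sup>2)"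
    unfolding eq by simp
  also have "\<dots> \<le> 2 ^ k * ((2 * ((2 * a * b)\<^sup>2 * (T * (T / 2 ^ k) powr (2 * H))) + 2 * ((b\<^sup>2)\<^sup>2 * (2 * T\<^sup>2 / 2 ^ k))) / (\<kappa> ^ k)\<^sup>2)"
    using s(2) unfolding iX(2) iY(2) by (intro mult_left_mono divide_right_mono) simp_all
  also have "\<dots> = 2 * (2 * a * b)\<^sup>2 * T * T powr (2 * H) * (1 / \<kappa> ^ k) + 4 * (b\<^sup>2)\<^sup>2 * T\<^sup>2 * (1 / (\<kappa> ^ k * \<kappa> ^ k))"
  proof -
    have "N * ((2 * (P * (T * (R * K / N))) + 2 * (Q * (2 * T\<^sup>2 / N))) / K\<^sup>2)
      = 2 * P * T * R * (1 / K) + 4 * Q * T\<^sup>2 * (1 / (K * K))" if "0 < K" "0 < N" for N P R K Q :: real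
      using that by (simp add: divide_simps) (simp add: algebra_simps power2_eq_square)
    then show ?thesis unfolding scale_power using \<kappa>_gt_1 by simp
  qed
  also have "\<dots> \<le> 2 * (2 * a * b)\<^sup>2 * T * T powr (2 * H) * (1 / \<kappa> ^ k) + 4 * (b\<^sup>2)\<^sup>2 * T\<^sup>2 * (1 / \<kappa> ^ k)"
    using \<kappa>k mult_mono[OF \<kappa>k order.refl, of "\<kappa> ^ k"] by (intro add_left_mono mult_left_mono divide_left_mono) auto
  finally show "2 ^ k * expectation (\<lambda>x. (mix_err k x)\<^sup>2)
      \<le> (2 * (2 * a * b)\<^sup>2 * T * T powr (2 * H) + 4 * (b\<^sup>2)\<^sup>2 * T\<^sup>2) * (1 / \<kappa>) ^ k"
    by (simp only: distrib_right power_divide power_one)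
qed

text \<open>At the scale \<open>2 powr (k / 2)\<close> the second moments are merely bounded; the
  loss of \<epsilon> makes them geometric with ratio
  \<open>2 powr (- 2 * \<epsilon>)\<close>.\<close>

lemma AE_fbm_err:
  assumes "0 < \<epsilon>"
  shows "AE z in M. (\<lambda>k. 2 powr (k * (1 / 2 - \<epsilon>)) * fbm_err k z) \<longlonglongrightarrow> 0"
proof (rule AE_tendsto_zero_of_second_moment)
  have eq: "(2 powr (real k * (1 / 2 - \<epsilon>)) * x)\<^sup>2 = (2 powr (1 - 2 * \<epsilon>)) ^ k * x\<^sup>2" for k x
  proof -
    have "(2 powr (real k * (1 / 2 - \<epsilon>)))\<^sup>2 = 2 powr (real k * (1 - 2 * \<epsilon>))"
      by (simp add: power2_eq_square powr_add[symmetric] algebra_simps)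
    also have "\<dots> = (2 powr (1 - 2 * \<epsilon>)) ^ k"
      by (simp add: powr_powr powr_realpow[symmetric] mult.commute)
    finally show ?thesis by (simp add: power_mult_distrib)
  qed
  show "integrable M (\<lambda>z. (2 powr (real k * (1 / 2 - \<epsilon>)) * fbm_err k z)\<^sup>2)" for k
    unfolding eq using fbm_err_second_moment by simp
  show "expectation (\<lambda>z. (2 powr (real k * (1 / 2 - \<epsilon>)) * fbm_err k z)\<^sup>2) \<le> 9 * amp\<^sup>2 * (2 powr (- 2 * \<epsilon>)) ^ k" for k
  proof -
    have "expectation (\<lambda>z. (2 powr (real k * (1 / 2 - \<epsilon>)) * fbm_err k z)\<^sup>2) \<le> (2 powr (1 - 2 * \<epsilon>)) ^ k * (9 * amp\<^sup>2 * (1 / 2) ^ k)"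
      unfolding eq integral_mult_right_zero by (intro mult_left_mono fbm_err_second_moment) auto
    also have "\<dots> = 9 * amp\<^sup>2 * (2 powr (1 - 2 * \<epsilon>) * (1 / 2)) ^ k" by (simp add: power_mult_distrib power_divide)
    also have "2 powr (1 - 2 * \<epsilon>) * (1 / 2) = 2 powr (- 2 * \<epsilon>)" by (simp add: powr_diff powr_minus field_simps)
    finally show ?thesis .
  qed
  show "2 powr (- 2 * \<epsilon>) < 1" using assms powr_less_mono[of "- 2 * \<epsilon>" 0 2] by simp
qed simp

text \<open>Here the ratio \<open>1 / \<kappa>\<close> is already below 1, so these terms vanish at
  the full scale of the limit law without any loss.\<close>

lemma AE_mix_err: "AE z in M. (\<lambda>k. 2 powr (k / 2) * mix_err k z) \<longlonglongrightarrow> 0"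
proof (rule AE_tendsto_zero_of_second_moment)
  have eq: "(2 powr (real k / 2) * x)\<^sup>2 = 2 ^ k * x\<^sup>2" for k x
    by (simp add: power_mult_distrib power2_eq_square[of "2 powr _"] powr_add[symmetric] powr_realpow)
  show "integrable M (\<lambda>z. (2 powr (real k / 2) * mix_err k z)\<^sup>2)" for k
    unfolding eq using mix_err_second_moment by simp
  show "expectation (\<lambda>z. (2 powr (real k / 2) * mix_err k z)\<^sup>2)
    \<le> (2 * (2 * a * b)\<^sup>2 * T * T powr (2 * H) + 4 * (b\<^sup>2)\<^sup>2 * T\<^sup>2) * (1 / \<kappa>) ^ k" for k
    unfolding eq integral_mult_right_zero by (rule mix_err_second_moment)
qed (use \<kappa>_gt_1 in auto)

end

section \<open>Convergence rate and limit law of the estimator\<close>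

context mixed_space
begin

text \<open>The perturbation \<open>h\<close> of the estimator lemmas, with
  \<open>L = amp * (\<kappa> - 1)\<close>. The factor \<kappa> arises because level
  \<open>k + 1\<close> is also measured in units of \<open>\<kappa> ^ k\<close>.\<close>

definition err :: "nat \<Rightarrow> 'a \<Rightarrow> real" where
  "err k x = (fbm_err k x + mix_err k x) - \<kappa> * (fbm_err (Suc k) x + mix_err (Suc k) x)"

lemma quad_var_diff_mixed:
  "quad_var_diff T (mixed_model a b B W) k x = \<kappa> ^ k * (- (amp * (\<kappa> - 1)) + err k x)"
  unfolding quad_var_diff_def quad_var_mixed err_def by (simp add: algebra_simps)

lemma quad_var_diff_mixed':
  "quad_var_diff T (mixed_model a b B W) k x = (2 powr (1 - 2 * H)) ^ k * (- (amp * (\<kappa> - 1)) + err k x)"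
  by (simp only: quad_var_diff_mixed \<kappa>_def[symmetric])

lemma level_pos: "0 < amp * (\<kappa> - 1)"
  using amp_pos \<kappa>_gt_1 by simp

lemma powr_shift_tendsto:
  fixes x :: "nat \<Rightarrow> real" and c :: real
  assumes "(\<lambda>k. 2 powr (real k * c) * x k) \<longlonglongrightarrow> 0"
  shows "(\<lambda>k. 2 powr (real k * c) * x (Suc k)) \<longlonglongrightarrow> 0"
proof -
  have "(\<lambda>k. 2 powr (- c) * (2 powr (real (Suc k) * c) * x (Suc k))) \<longlonglongrightarrow> 2 powr (- c) * 0"
    by (intro tendsto_intros LIMSEQ_Suc[OF assms])
  moreover have "2 powr (- c) * (2 powr (real (Suc k) * c) * x (Suc k)) = 2 powr (real k * c) * x (Suc k)" for k
    by (simp add: powr_add[symmetric] mult.assoc[symmetric] algebra_simps)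
  ultimately show ?thesis by (simp only: mult_zero_right)
qed

lemma AE_err:
  assumes "0 < \<epsilon>"
  shows "AE x in M. (\<lambda>k. 2 powr (k * (1 / 2 - \<epsilon>)) * err k x) \<longlonglongrightarrow> 0"
  using AE_fbm_err[OF assms] AE_mix_err
proof eventually_elim
  case (elim x)
  have "(\<lambda>k. 2 powr (k * (1 / 2 - \<epsilon>)) * mix_err k x) \<longlonglongrightarrow> 0"
  proof (rule Lim_null_comparison[OF _ tendsto_rabs_zero[OF elim(2)]], intro always_eventually allI)
    fix k
    have "(2::real) powr (real k * (1 / 2 - \<epsilon>)) \<le> 2 powr (real k / 2)"
      using assms by (intro powr_mono) (auto simp: algebra_simps)
    then show "norm (2 powr (real k * (1 / 2 - \<epsilon>)) * mix_err k x) \<le> \<bar>2 powr (real k / 2) * mix_err k x\<bar>"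
      by (simp add: abs_mult mult_right_mono)
  qed
  from tendsto_add[OF elim(1) this]
  have s: "(\<lambda>k. 2 powr (k * (1 / 2 - \<epsilon>)) * (fbm_err k x + mix_err k x)) \<longlonglongrightarrow> 0"
    by (simp add: distrib_left)
  have "(\<lambda>k. 2 powr (k * (1 / 2 - \<epsilon>)) * (fbm_err k x + mix_err k x)
     - \<kappa> * (2 powr (k * (1 / 2 - \<epsilon>)) * (fbm_err (Suc k) x + mix_err (Suc k) x))) \<longlonglongrightarrow> 0 - \<kappa> * 0"
    by (intro tendsto_intros s powr_shift_tendsto[OF s])
  then show ?case unfolding err_def by (simp add: right_diff_distrib mult.left_commute)
qed

lemma err_tendsto_zero:
  assumes "(\<lambda>k. 2 powr (k * (1 / 2 - 1 / 4)) * err k x) \<longlonglongrightarrow> 0"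
  shows "(\<lambda>k. err k x) \<longlonglongrightarrow> 0"
proof (rule Lim_null_comparison[OF _ tendsto_rabs_zero[OF assms]], intro always_eventually allI)
  fix k
  have "1 \<le> (2::real) powr (real k * (1 / 2 - 1 / 4))" by (intro ge_one_powr_ge_zero) auto
  then show "norm (err k x) \<le> \<bar>2 powr (real k * (1 / 2 - 1 / 4)) * err k x\<bar>"
    using mult_right_mono[of 1 "2 powr (real k * (1 / 2 - 1 / 4))" "\<bar>err k x\<bar>"] by (simp add: abs_mult)
qed

lemma estimator_AE_rate:
  assumes "0 < \<epsilon>"
  shows "AE x in M. (\<lambda>k. 2 powr (k * (1 / 2 - \<epsilon>)) * (hurst_estimator T (mixed_model a b B W) k x - H)) \<longlonglongrightarrow> 0"
proof -
  have "AE x in M. (\<lambda>k. 2 powr (k * (1 / 2 - 1 / 4)) * err k x) \<longlonglongrightarrow> 0"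
    by (rule AE_err) simp
  with AE_err[OF assms] show ?thesis
  proof eventually_elim
    case (elim x)
    show ?case
      unfolding hurst_estimator_def
      by (rule estimator_rate[OF level_pos quad_var_diff_mixed' err_tendsto_zero[OF elim(2)] elim(1) powr_shift_tendsto[OF elim(1)]])
  qed
qed

lemma estimator_AE_tendsto:
  "AE x in M. (\<lambda>k. hurst_estimator T (mixed_model a b B W) k x) \<longlonglongrightarrow> H"
proof -
  \<comment> \<open>For \<epsilon> = 1/2 the scale is constantly 1, so the rate reduces to
    consistency.\<close>
  have "AE x in M. (\<lambda>k. 2 powr (k * (1 / 2 - 1 / 2)) * (hurst_estimator T (mixed_model a b B W) k x - H)) \<longlonglongrightarrow> 0"
    by (rule estimator_AE_rate) simp
  then show ?thesis by eventually_elim (simp add: LIM_zero_iff)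
qed

definition theta_fluct :: "nat \<Rightarrow> 'a \<Rightarrow> real" where
  "theta_fluct k x = (\<Sum>m<2 ^ k. theta H (rescaled k) m x) / sqrt (2 ^ k)"

text \<open>The rate with \<epsilon> = 1/4 is the one that \<open>estimator_linearization\<close>
  asks for. The difference of consecutive \<open>err\<close> contains the combination of
  \<open>fbm_err_combination\<close>, whose \<open>amp\<close> cancels against the one in
  \<open>L\<close>, and three values of \<open>mix_err\<close>, which vanish in the limit.\<close>

lemma estimator_AE_linear:
  "AE z in M. (\<lambda>k. 2 powr (k / 2) * (hurst_estimator T (mixed_model a b B W) k z - H)
    - (- 1 / (2 * (\<kappa> - 1) * ln 2)) * theta_fluct k z) \<longlonglongrightarrow> 0"
proof -
  have "AE z in M. (\<lambda>k. 2 powr (k * (1 / 2 - 1 / 4)) * err k z) \<longlonglongrightarrow> 0"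
    by (rule AE_err) simp
  with AE_mix_err show ?thesis
  proof eventually_elim
    case (elim z)
    define L where "L = amp * (\<kappa> - 1)"
    have L: "0 < L" using level_pos unfolding L_def .
    have "(\<lambda>k. 2 powr (k / 4) * err k z) \<longlonglongrightarrow> 0" using elim(2) by simp
    from estimator_linearization[OF L quad_var_diff_mixed'[folded L_def] this, folded hurst_estimator_def]
    have lin: "(\<lambda>k. 2 powr (k / 2) * (hurst_estimator T (mixed_model a b B W) k z - H)
      + 2 powr (k / 2) * (err k z - err (Suc k) z) / (2 * L * ln 2)) \<longlonglongrightarrow> 0" .
    have mS: "(\<lambda>k. 2 powr (k / 2) * x (Suc k)) \<longlonglongrightarrow> 0" if "(\<lambda>k. 2 powr (k / 2) * x k) \<longlonglongrightarrow> 0" for x :: "nat \<Rightarrow> real"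
      using powr_shift_tendsto[of "1/2" x] that by simp
    have mix: "(\<lambda>k. (2 powr (k / 2) * mix_err k z - (1 + \<kappa>) * (2 powr (k / 2) * mix_err (Suc k) z)
       + \<kappa> * (2 powr (k / 2) * mix_err (Suc (Suc k)) z)) / (2 * L * ln 2)) \<longlonglongrightarrow> (0 - (1 + \<kappa>) * 0 + \<kappa> * 0) / (2 * L * ln 2)"
      using L by (intro tendsto_intros elim(1) mS mS[OF mS]) auto
    have e: "2 powr (k / 2) * (err k z - err (Suc k) z) / (2 * L * ln 2)
      = theta_fluct k z / (2 * (\<kappa> - 1) * ln 2) + (2 powr (k / 2) * mix_err k z - (1 + \<kappa>) * (2 powr (k / 2) * mix_err (Suc k) z)
       + \<kappa> * (2 powr (k / 2) * mix_err (Suc (Suc k)) z)) / (2 * L * ln 2)" for k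
    proof -
      have "err k z - err (Suc k) z = (fbm_err k z - (1 + \<kappa>) * fbm_err (Suc k) z + \<kappa> * fbm_err (Suc (Suc k)) z)
        + (mix_err k z - (1 + \<kappa>) * mix_err (Suc k) z + \<kappa> * mix_err (Suc (Suc k)) z)"
        unfolding err_def by (simp add: algebra_simps)
      then have "2 powr (k / 2) * (err k z - err (Suc k) z) = amp * theta_fluct k z
        + (2 powr (k / 2) * mix_err k z - (1 + \<kappa>) * (2 powr (k / 2) * mix_err (Suc k) z)
       + \<kappa> * (2 powr (k / 2) * mix_err (Suc (Suc k)) z))"
        using fbm_err_combination[of k z] unfolding theta_fluct_def[symmetric]
        by (simp only: distrib_left) (simp add: algebra_simps)
      moreover have "amp * theta_fluct k z / (2 * L * ln 2) = theta_fluct k z / (2 * (\<kappa> - 1) * ln 2)"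
        unfolding L_def using amp_pos by simp
      ultimately show ?thesis by (simp only: add_divide_distrib)
    qed
    from tendsto_diff[OF lin mix] show ?case
      unfolding e by (simp add: algebra_simps)
  qed
qed

lemma estimator_measurable: "hurst_estimator T (mixed_model a b B W) k \<in> borel_measurable M"
proof -
  have [measurable]: "quad_var T (mixed_model a b B W) n \<in> borel_measurable M" for n
    by (rule quad_var_measurable)
      (auto simp: mixed_model_def[abs_def] intro!: borel_measurable_add borel_measurable_times fbm_measurable W_measurable)
  show ?thesis
    unfolding hurst_estimator_def[abs_def] log2_plus_def quad_var_diff_def by measurable
qed

text \<open>It is a limit of second moments of sums of \<open>theta\<close> divided by
  \<open>n\<close>. Nonnegativity makes the square root in \<open>sigma\<close> a genuine
  one.\<close>

lemma long_run_variance_nonneg: "0 \<le> long_run_variance H B"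
proof (rule tendsto_lowerbound)
  show "(\<lambda>n. (\<Sum>m<n. \<Sum>m'<n. theta_cov H m m') / real n) \<longlonglongrightarrow> long_run_variance H B"
    unfolding long_run_variance_eq by (rule theta_cov_mean_tendsto[OF H_pos H_less])
  have "(\<Sum>m<n. \<Sum>m'<n. theta_cov H m m') = expectation (\<lambda>x. (\<Sum>m<n. theta H B m x)\<^sup>2)" for n
  proof -
    have "expectation (\<lambda>x. \<Sum>m<n. \<Sum>m'<n. 1 * (theta H B m x * theta H B m' x))
      = (\<Sum>m<n. \<Sum>m'<n. 1 * expectation (\<lambda>x. theta H B m x * theta H B m' x))"
      by (intro integral_double_sum expectation_theta_mult)
    then show ?thesis by (simp add: expectation_theta_mult power2_eq_square sum_product)
  qed
  then show "\<forall>\<^sub>F n in sequentially. 0 \<le> (\<Sum>m<n. \<Sum>m'<n. theta_cov H m m') / real n"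
    by (intro always_eventually allI) simp
qed simp

text \<open>Level \<open>k\<close> applies the bound for \<open>2 ^ k\<close> summands to its own
  process \<open>rescaled k\<close>. The error is free of the process and the variances are
  functions of \<open>H\<close>, so both pass to the limit although the process changes with
  \<open>k\<close>.\<close>

lemma theta_fluct_char_tendsto:
  "(\<lambda>k. expectation (\<lambda>x. iexp (\<sigma> * theta_fluct k x))) \<longlonglongrightarrow> exp (- (\<sigma>\<^sup>2 * long_run_variance H B / 2))"
proof -
  define v where "v n = (\<Sum>m<n. \<Sum>m'<n. theta_cov H m m') / real n" for n
  have pow: "filterlim (\<lambda>k. 2 ^ k :: nat) at_top sequentially"
    by (rule filterlim_subseq) (simp add: strict_mono_def power_strict_increasing)
  have "(\<lambda>k. v (2 ^ k)) \<longlonglongrightarrow> long_run_variance H B"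
    unfolding long_run_variance_eq v_def
    by (rule filterlim_compose[OF theta_cov_mean_tendsto[OF H_pos H_less] pow])
  then have "(\<lambda>k. exp (- (\<sigma>\<^sup>2 * v (2 ^ k) / 2))) \<longlonglongrightarrow> exp (- (\<sigma>\<^sup>2 * long_run_variance H B / 2))"
    by (intro tendsto_intros) auto
  then have lim: "(\<lambda>k. complex_of_real (exp (- (\<sigma>\<^sup>2 * v (2 ^ k) / 2)))) \<longlonglongrightarrow> complex_of_real (exp (- (\<sigma>\<^sup>2 * long_run_variance H B / 2)))"
    by (rule tendsto_of_real)
  have "(\<lambda>k. expectation (\<lambda>x. iexp (\<sigma> * theta_fluct k x)) - complex_of_real (exp (- (\<sigma>\<^sup>2 * v (2 ^ k) / 2)))) \<longlonglongrightarrow> 0"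
  proof (rule Lim_null_comparison)
    have "(\<lambda>k. 2 * \<sigma>\<^sup>2 * sqrt (2 * 7 * 16 * 84 ^ 4 * (1 / 2) ^ k)) \<longlonglongrightarrow> 2 * \<sigma>\<^sup>2 * sqrt (2 * 7 * 16 * 84 ^ 4 * 0)"
      by (intro tendsto_intros) auto
    then show "(\<lambda>k. 2 * \<sigma>\<^sup>2 * sqrt (2 * 7 * 16 * 84 ^ 4 * (1 / 2) ^ k)) \<longlonglongrightarrow> 0" by simp
    show "\<forall>\<^sub>F k in sequentially. norm (expectation (\<lambda>x. iexp (\<sigma> * theta_fluct k x)) - complex_of_real (exp (- (\<sigma>\<^sup>2 * v (2 ^ k) / 2))))
       \<le> 2 * \<sigma>\<^sup>2 * sqrt (2 * 7 * 16 * 84 ^ 4 * (1 / 2) ^ k)"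
    proof (intro always_eventually allI)
      fix k
      interpret R: fbm_space M H "rescaled k" by (rule fbm_rescaled)
      have r: "real (2 ^ k) = 2 ^ k" "(1 / 2 :: real) ^ k = 1 / 2 ^ k" by (simp_all add: power_divide)
      show "norm (expectation (\<lambda>x. iexp (\<sigma> * theta_fluct k x)) - complex_of_real (exp (- (\<sigma>\<^sup>2 * v (2 ^ k) / 2))))
         \<le> 2 * \<sigma>\<^sup>2 * sqrt (2 * 7 * 16 * 84 ^ 4 * (1 / 2) ^ k)"
        using R.theta_sum_char_bound[of "2 ^ k" \<sigma>] unfolding v_def theta_fluct_def r by simp
    qed
  qed
  from tendsto_add[OF this lim] show ?thesis by simp
qed

lemma theta_fluct_measurable: "theta_fluct k \<in> borel_measurable M"
proof -
  interpret R: fbm_space M H "rescaled k" by (rule fbm_rescaled)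
  show ?thesis unfolding theta_fluct_def[abs_def] by measurable
qed

lemma estimator_weak_conv:
  "weak_conv_m (\<lambda>k. distr M borel (\<lambda>x. 2 powr (real k / 2) * (hurst_estimator T (mixed_model a b B W) k x - H)))
     (normal_law 0 (sigma H B))"
proof (rule levy_continuity)
  define X where "X k x = 2 powr (real k / 2) * (hurst_estimator T (mixed_model a b B W) k x - H)" for k x
  define c where "c = - 1 / (2 * (\<kappa> - 1) * ln 2)"
  have X: "X k \<in> borel_measurable M" for k
    unfolding X_def[abs_def] using estimator_measurable by measurable
  show "real_distribution (distr M borel (\<lambda>x. 2 powr (real k / 2) * (hurst_estimator T (mixed_model a b B W) k x - H)))" for k
    using X unfolding X_def[abs_def] by (rule real_distribution_distr)
  show "real_distribution (normal_law 0 (sigma H B))" by (rule real_distribution_normal_law)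
  fix t
  have "AE x in M. (\<lambda>k. t * X k x - (t * c) * theta_fluct k x) \<longlonglongrightarrow> 0"
    using estimator_AE_linear
  proof eventually_elim
    case (elim x)
    then have "(\<lambda>k. X k x - c * theta_fluct k x) \<longlonglongrightarrow> 0" unfolding X_def c_def .
    from tendsto_mult_left[OF this, of t] show ?case
      by (simp only: right_diff_distrib mult.assoc mult_zero_right)
  qed
  then have "(\<lambda>k. expectation (\<lambda>x. iexp (t * X k x)) - expectation (\<lambda>x. iexp ((t * c) * theta_fluct k x))) \<longlonglongrightarrow> 0"
    using X theta_fluct_measurable by (intro tendsto_expectation_iexp_diff) auto
  from tendsto_add[OF this theta_fluct_char_tendsto[of "t * c"]]
  have "(\<lambda>k. expectation (\<lambda>x. iexp (t * X k x))) \<longlonglongrightarrow> exp (- ((t * c)\<^sup>2 * long_run_variance H B / 2))" by simp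
  moreover have "char (distr M borel (X k)) t = expectation (\<lambda>x. iexp (t * X k x))" for k
    unfolding char_def using X by (subst integral_distr) auto
  moreover have "(t * c)\<^sup>2 * long_run_variance H B = (sigma H B)\<^sup>2 * t\<^sup>2"
  proof -
    \<comment> \<open>The denominator in \<open>sigma\<close> is thus
      \<open>2 * (\<kappa> - 1) * ln 2\<close>. The linear coefficient \<open>c\<close> has the
      opposite sign, which is invisible in the symmetric limit law.\<close>
    have "2 powr (2 - 2 * H) = 2 * \<kappa>"
      unfolding \<kappa>_def by (simp add: powr_diff)
    then have "sigma H B = - c * sqrt (long_run_variance H B)"
      unfolding sigma_def c_def by (simp add: algebra_simps)
    then show ?thesis using long_run_variance_nonneg by (simp add: power_mult_distrib)
  qed
  ultimately show "(\<lambda>k. char (distr M borel (\<lambda>x. 2 powr (real k / 2) * (hurst_estimator T (mixed_model a b B W) k x - H))) t)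
     \<longlonglongrightarrow> char (normal_law 0 (sigma H B)) t"
    unfolding char_normal_law_0 X_def[symmetric] by simp
qed

end

theorem theorem3p2:
  fixes M :: "'a measure" and B W :: "real \<Rightarrow> 'a \<Rightarrow> real" and a b T H :: real
  assumes "prob_space M"
    and "T > 0" and "a > 0" and "b > 0"
    and "0 < H" and "H < 1 / 2"
    and "prob_space.fractional_brownian_motion M H B"
    and "prob_space.wiener_process M W"
    and "prob_space.indep_processes M {0..} B W"
  shows "(AE \<omega> in M. (\<lambda>k. hurst_estimator T (mixed_model a b B W) k \<omega>) \<longlonglongrightarrow> H) \<and>
         (\<forall>\<epsilon>>0. AE \<omega> in M.
           (\<lambda>k. hurst_estimator T (mixed_model a b B W) k \<omega> - H)
             \<in> o[sequentially](\<lambda>k. 2 powr (real k * (- 1 / 2 + \<epsilon>)))) \<and>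
         (\<forall>m. integrable M (\<lambda>\<omega>. theta H B 0 \<omega> * theta H B m \<omega>)) \<and>
         (summable (\<lambda>m. prob_space.rho M H B (Suc m))) \<and>
         (prob_space.long_run_variance M H B \<ge> 0) \<and>
         (weak_conv_m
           (\<lambda>k. distr M borel
                  (\<lambda>\<omega>. 2 powr (real k / 2) * (hurst_estimator T (mixed_model a b B W) k \<omega> - H)))
           (normal_law 0 (prob_space.sigma M H B)))"
proof -
  interpret prob_space M by fact
  interpret mixed_space M H B W T a b
    by unfold_locales (use assms in auto)
  have rate: "AE \<omega> in M. (\<lambda>k. hurst_estimator T (mixed_model a b B W) k \<omega> - H)
      \<in> o[sequentially](\<lambda>k. 2 powr (real k * (- 1 / 2 + \<epsilon>)))" if "\<epsilon> > 0" for \<epsilon>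
    using estimator_AE_rate[OF that]
  proof eventually_elim
    case (elim \<omega>)
    have "2 powr (real k * (1 / 2 - \<epsilon>)) * x = x / 2 powr (real k * (- 1 / 2 + \<epsilon>))" for k x
    proof -
      have "real k * (1 / 2 - \<epsilon>) = - (real k * (- 1 / 2 + \<epsilon>))" by (simp add: algebra_simps)
      then show ?thesis by (simp only: powr_minus divide_inverse mult.commute)
    qed
    with elim show ?case by (intro smalloI_tendsto) simp_all
  qed
  have "summable (\<lambda>m. rho H B (Suc m))"
    unfolding rho_eq by (rule summable_theta_cov[OF H_pos H_less])
  then show ?thesis
    using estimator_AE_tendsto rate expectation_theta_mult(1) long_run_variance_nonneg estimator_weak_conv
    by blast
qed

end
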